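(* Let $n\ge2$, $1\le k\le n-1$, $\alpha_1,\alpha_2\in\mathbb{R}$ and suppose either $\alpha_1+\alpha_2>k-n$ and $1\le p<\frac{\alpha_1+\alpha_2+n-1}{k-1}$ (read as $+\infty$ if $k=1$), or $\alpha_1+\alpha_2=k-n$ and $p=1$. Let $\gamma_1,\gamma_2\in\mathbb{R}$ and assume $\gamma_1>0$ in case $p=\frac{\alpha_1+n}{k}$. Consider $$\|\sinh^{\gamma_1}d(0,\cdot)\cosh^{\gamma_2}d(0,\cdot)\,R_kf\|_{L^\infty(\Xi_k(\mathbb{H}^n))}\le C\|f\|_{L^p_{\alpha_1,\alpha_2}(\mathbb{H}^n)}\quad\text{for all radial }f\in L^p_{\alpha_1,\alpha_2}(\mathbb{H}^n).\qquad( * )$$ (A) If $k\ge2$, $( * )$ holds if and only if $\gamma_1\ge\max\{0,\frac{\alpha_1+n}{p}-k\}$ and $\gamma_1+\gamma_2\le\frac{\alpha_1+\alpha_2+n-1}{p}$. (B) If $k=1$, $( * )$ holds if and only if these two conditions hold and $p>2$.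
   Context: $\mathbb{H}^n$ is the real hyperbolic space of curvature $-1$ (Poincaré ball model) with origin $0$, distance $d$, volume $dx$. $\Xi_k(\mathbb{H}^n)$ is the set of $k$-dimensional totally geodesic submanifolds with $d(0,\xi)=\inf_{x\in\xi}d(0,x)$ and isometry-invariant measure (the $L^\infty$ norm is the essential supremum with respect to it). $R_kf(\xi)=\int_\xi f\,d_\xi x$ (induced Riemannian measure). $\|f\|^p_{L^p_{\alpha_1,\alpha_2}(\mathbb{H}^n)}=\int|f(x)|^p\sinh^{\alpha_1}d(0,x)\cosh^{\alpha_2}d(0,x)dx$. Radial means depending only on $d(0,x)$. $C$ is independent of $f$. *)

theory Defs
  imports "HOL-Analysis.Analysis"
begin

text \<open>Poincare ball model of real hyperbolic space of dimension CARD('n).\<close>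

definition hball :: "(real^'n) set" where
  "hball = {x. norm x < 1}"

text \<open>Hyperbolic distance from the origin 0 in the ball model (curvature -1).\<close>
definition hdist0 :: "real^'n \<Rightarrow> real" where
  "hdist0 x = 2 * artanh (norm x)"

text \<open>Riemannian volume density w.r.t. Lebesgue measure.\<close>
definition hvol_density :: "real^'n \<Rightarrow> real" where
  "hvol_density x = (2 / (1 - (norm x)^2)) ^ CARD('n)"

text \<open>Moebius translation of the ball taking 0 to a (a hyperbolic isometry).\<close>
definition mobius_tr :: "real^'n \<Rightarrow> real^'n \<Rightarrow> real^'n" where
  "mobius_tr a x =
     (((1 + 2 * (a \<bullet> x) + (norm x)^2) *\<^sub>R a + (1 - (norm a)^2) *\<^sub>R x)
       /\<^sub>R (1 + 2 * (a \<bullet> x) + (norm a)^2 * (norm x)^2))"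

text \<open>p-th power of the weighted norm of f in L^p_{alpha1,alpha2}.\<close>
definition Lp_weighted_pow :: "real \<Rightarrow> real \<Rightarrow> real \<Rightarrow> (real^'n \<Rightarrow> real) \<Rightarrow> ennreal" where
  "Lp_weighted_pow p a1 a2 f =
     (\<integral>\<^sup>+ x \<in> hball. ennreal (\<bar>f x\<bar> powr p * sinh (hdist0 x) powr a1
         * cosh (hdist0 x) powr a2 * hvol_density x) \<partial>lborel)"

definition radial :: "(real^'n \<Rightarrow> real) \<Rightarrow> bool" where
  "radial f \<longleftrightarrow> (\<forall>x\<in>hball. \<forall>y\<in>hball. hdist0 x = hdist0 y \<longrightarrow> f x = f y)"

text \<open>Every k-dimensional totally geodesic submanifold is the image of
  hball \<inter> W (W = range of an injective linear map M : R^k \<rightarrow> R^n) under a Moebius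
  translation; (a, M) is a smooth submersive parametrisation of Xi_k.\<close>
definition tg_sub :: "real^'n \<Rightarrow> real^'k^'n \<Rightarrow> (real^'n) set" where
  "tg_sub a M = mobius_tr a ` (hball \<inter> range ((*v) M))"

definition dist0_tg :: "real^'n \<Rightarrow> real^'k^'n \<Rightarrow> real" where
  "dist0_tg a M = Inf (hdist0 ` tg_sub a M)"

definition param_dom :: "real^'k^'n \<Rightarrow> (real^'k) set" where
  "param_dom M = {u. M *v u \<in> hball}"

text \<open>Integrand of R_k f over tg_sub a M, expressed through the parametrisation
  u \<mapsto> mobius_tr a (M u) (area formula: hyperbolic k-volume density times Gram factor).\<close>
definition Rk_integrand :: "(real^'n \<Rightarrow> real) \<Rightarrow> real^'n \<Rightarrow> real^'k^'n \<Rightarrow> real^'k \<Rightarrow> real" where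
  "Rk_integrand f a M u =
     f (mobius_tr a (M *v u)) * (2 / (1 - (norm (M *v u))^2)) ^ CARD('k)
       * sqrt (det (transpose M ** M))"

definition Rk :: "(real^'n \<Rightarrow> real) \<Rightarrow> real^'n \<Rightarrow> real^'k^'n \<Rightarrow> real" where
  "Rk f a M = (LINT u : param_dom M | lborel. Rk_integrand f a M u)"

text \<open>The estimate (*): L^infinity on Xi_k (null sets of the invariant measure
  = null sets of the parametrisation (a, M)) bounded by C times the weighted L^p norm,
  for all radial f in L^p_{alpha1,alpha2}.\<close>
definition radon_estimate ::
  "'k::finite itself \<Rightarrow> 'n::finite itself \<Rightarrow> real \<Rightarrow> real \<Rightarrow> real \<Rightarrow> real \<Rightarrow> real \<Rightarrow> bool" where
  "radon_estimate _ _ p a1 a2 g1 g2 \<longleftrightarrow>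
     (\<exists>C::real. \<forall>f :: real^'n \<Rightarrow> real.
        f \<in> borel_measurable lborel \<and> radial f \<and> Lp_weighted_pow p a1 a2 f < \<infinity> \<longrightarrow>
        (AE z in (lborel :: ((real^'n) \<times> (real^'k^'n)) measure).
           fst z \<in> hball \<longrightarrow>
             set_integrable lborel (param_dom (snd z)) (Rk_integrand f (fst z) (snd z)) \<and>
             \<bar>sinh (dist0_tg (fst z) (snd z)) powr g1 * cosh (dist0_tg (fst z) (snd z)) powr g2
               * Rk f (fst z) (snd z)\<bar>
             \<le> C * enn2real (Lp_weighted_pow p a1 a2 f) powr (1 / p)))"

end

theory Submission
  imports Defs
begin

text \<open>For radial \<open>f\<close> everything is expressed through \<open>T = sinh\<^sup>2 d(0,x)\<close>. On a geodesic subspace at distance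
  \<open>s\<close> from the origin, with \<open>S = sinh\<^sup>2 s\<close>, a point at distance \<open>\<rho>\<close> from the foot of the
  perpendicular satisfies \<open>cosh d = cosh s cosh \<rho>\<close>, i.e. \<open>T = S + (1 + S) x\<close> with \<open>x = sinh\<^sup>2 \<rho>\<close>. Hence
  \<open>R\<^sub>k f\<close> is a multiple of the integral of \<open>F (S + (1 + S) x) x\<^bsup>k/2-1\<^esup> (1 + x)\<^bsup>-1/2\<^esup>\<close> over \<open>x > 0\<close>, and the
  \<open>p\<close>-th power of the norm is a multiple of that of \<open>|F T|\<^bsup>p\<^esup> T\<^bsup>(\<alpha>\<^sub>1+n)/2-1\<^esup> (1 + T)\<^bsup>(\<alpha>\<^sub>2-1)/2\<^esup>\<close>.
  Sufficiency follows from Hoelder's inequality (for \<open>p = 1\<close> from a pointwise bound) and a uniform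
  bound for a family of Beta integrals; necessity is tested on indicators of intervals \<open>[t, 5t]\<close> at the
  scales \<open>S \<rightarrow> 0\<close> and \<open>S \<rightarrow> \<infinity>\<close> and, for \<open>k = 1\<close>, on truncations of \<open>(T - 1)\<^bsup>-1/2\<^esup>\<close>.\<close>

section \<open>Change of variables and polar coordinates\<close>

text \<open>With A = (a1 + n) / 2 and B = (a2 - 1) / 2 the conditions read 2A/p - k <= g1 and g1 +
  g2 <= 2(A + B)/p. For p > 1 the range p (k - 1) < 2(A + B) is convergence of the Hoelder integral
  as x tends to infinity. As S tends to 0 that integral stays bounded, or grows like a power of 1/S
  that the weight absorbs, or, on the borderline p = (a1 + n) / k, grows like a logarithm, against
  which a positive power of S is available when g1 > 0. The estimate holds only for almost every
  subspace, with a null set depending on f. A test function therefore yields an inequality at some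
  uncontrolled S in a prescribed interval, and each test needs a lower bound valid on the whole
  interval. Integrability of the integrand of \<open>Rk\<close> is part of the claim, so all
  identities are proved for nonnegative extended integrals first.\<close>

lemma absolute_integral_eq_iff_nn_integral:
  fixes u :: "'a::euclidean_space \<Rightarrow> real"
  assumes u: "set_borel_measurable borel A u" and A: "A \<in> sets borel"
    and nonneg: "\<And>x. x \<in> A \<Longrightarrow> 0 \<le> u x"
  shows "u absolutely_integrable_on A \<and> integral A u = b \<longleftrightarrow>
    0 \<le> b \<and> (\<integral>\<^sup>+x\<in>A. ennreal (u x) \<partial>lborel) = ennreal b"
proof
  assume L: "u absolutely_integrable_on A \<and> integral A u = b"
  then have hi: "(u has_integral b) A"
    using absolutely_integrable_on_def by blast
  then have "0 \<le> b"
    using has_integral_nonneg nonneg by blast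
  with nn_integral_has_integral_lebesgue'[OF nonneg hi]
  show "0 \<le> b \<and> (\<integral>\<^sup>+x\<in>A. ennreal (u x) \<partial>lborel) = ennreal b"
    by simp
next
  assume R: "0 \<le> b \<and> (\<integral>\<^sup>+x\<in>A. ennreal (u x) \<partial>lborel) = ennreal b"
  have eq: "(\<integral>\<^sup>+x\<in>A. ennreal (u x) \<partial>lborel) = (\<integral>\<^sup>+x. ennreal (indicator A x * u x) \<partial>lborel)"
    by (intro nn_integral_cong) (auto simp: indicator_def)
  have "((\<lambda>x. indicator A x * u x) has_integral b) UNIV"
    using u R nonneg unfolding eq set_borel_measurable_def
    by (intro nn_integral_has_integral) (auto simp: indicator_def)
  also have "(\<lambda>x. indicator A x * u x) = (\<lambda>x. if x \<in> A then u x else 0)"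
    by (auto simp: indicator_def)
  finally have hi: "(u has_integral b) A"
    by (simp add: has_integral_restrict_UNIV)
  then show "u absolutely_integrable_on A \<and> integral A u = b"
    using nonneg by (auto intro!: nonnegative_absolutely_integrable_1)
qed

text \<open>The change-of-variables theorems compare absolute integrability together with a finite
  value \<open>b\<close>. Agreement for all \<open>b\<close> determines both sides even when one is
  infinite: then no \<open>b\<close> is attained on either side. The clause \<open>0 \<le> b\<close>
  in the translation keeps a negative \<open>b\<close> from being read as
  \<open>ennreal b = 0\<close>.\<close>

lemma nn_integral_eq_if_same_absolute_integrals:
  fixes u :: "'a::euclidean_space \<Rightarrow> real" and v :: "'b::euclidean_space \<Rightarrow> real"
  assumes "set_borel_measurable borel A u" "A \<in> sets borel" "\<And>x. x \<in> A \<Longrightarrow> 0 \<le> u x"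
    and "set_borel_measurable borel B v" "B \<in> sets borel" "\<And>x. x \<in> B \<Longrightarrow> 0 \<le> v x"
    and same: "\<And>b. u absolutely_integrable_on A \<and> integral A u = b \<longleftrightarrow>
                v absolutely_integrable_on B \<and> integral B v = b"
  shows "(\<integral>\<^sup>+x\<in>A. ennreal (u x) \<partial>lborel) = (\<integral>\<^sup>+x\<in>B. ennreal (v x) \<partial>lborel)"
proof -
  have iff: "0 \<le> b \<and> (\<integral>\<^sup>+x\<in>A. ennreal (u x) \<partial>lborel) = ennreal b \<longleftrightarrow>
        0 \<le> b \<and> (\<integral>\<^sup>+x\<in>B. ennreal (v x) \<partial>lborel) = ennreal b" for b
    using same[of b] absolute_integral_eq_iff_nn_integral[OF assms(1-3), of b]
      absolute_integral_eq_iff_nn_integral[OF assms(4-6), of b] by metis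
  show ?thesis
  proof (cases "\<integral>\<^sup>+x\<in>A. ennreal (u x) \<partial>lborel")
    case (real r)
    with iff[of r] show ?thesis by simp
  next
    case top
    with iff have "\<not> (0 \<le> b \<and> (\<integral>\<^sup>+x\<in>B. ennreal (v x) \<partial>lborel) = ennreal b)" for b
      by simp
    with top show ?thesis
      by (cases "\<integral>\<^sup>+x\<in>B. ennreal (v x) \<partial>lborel") auto
  qed
qed

lemma nn_integral_change_of_variables_real:
  fixes f g g' :: "real \<Rightarrow> real"
  assumes S: "S \<in> sets borel" and gS: "g ` S \<in> sets borel"
    and der: "\<And>x. x \<in> S \<Longrightarrow> (g has_field_derivative g' x) (at x)"
    and inj: "inj_on g S"
    and f: "set_borel_measurable borel (g ` S) f" "\<And>x. x \<in> g ` S \<Longrightarrow> 0 \<le> f x"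
    and fg: "set_borel_measurable borel S (\<lambda>x. \<bar>g' x\<bar> * f (g x))"
  shows "(\<integral>\<^sup>+x\<in>S. ennreal (\<bar>g' x\<bar> * f (g x)) \<partial>lborel) = (\<integral>\<^sup>+x\<in>g ` S. ennreal (f x) \<partial>lborel)"
  using assms
  by (intro nn_integral_eq_if_same_absolute_integrals has_absolute_integral_change_of_variables_1')
    (auto intro: has_field_derivative_at_within)

lemma nn_integral_change_of_variables:
  fixes f :: "real^'m::{finite,wellorder} \<Rightarrow> real" and g :: "real^'m::_ \<Rightarrow> real^'m::_"
  assumes S: "S \<in> sets borel" and gS: "g ` S \<in> sets borel"
    and der: "\<And>x. x \<in> S \<Longrightarrow> (g has_derivative g' x) (at x)"
    and inj: "inj_on g S"
    and f: "set_borel_measurable borel (g ` S) f" "\<And>x. x \<in> g ` S \<Longrightarrow> 0 \<le> f x"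
    and fg: "set_borel_measurable borel S (\<lambda>x. \<bar>det (matrix (g' x))\<bar> * f (g x))"
  shows "(\<integral>\<^sup>+x\<in>S. ennreal (\<bar>det (matrix (g' x))\<bar> * f (g x)) \<partial>lborel) =
    (\<integral>\<^sup>+x\<in>g ` S. ennreal (f x) \<partial>lborel)"
proof (intro nn_integral_eq_if_same_absolute_integrals)
  fix b
  \<comment> \<open>The theorem in several variables concerns vector-valued functions, so the scalar
    integrand passes through \<open>real ^ 1\<close>.\<close>
  have "(\<lambda>x. \<bar>det (matrix (g' x))\<bar> *\<^sub>R vec (f(g x)) :: real ^ 1) absolutely_integrable_on S \<and>
           integral S (\<lambda>x. \<bar>det (matrix (g' x))\<bar> *\<^sub>R vec (f(g x))) = (vec b :: real ^ 1)
         \<longleftrightarrow> (\<lambda>x. vec (f x) :: real ^ 1) absolutely_integrable_on (g ` S) \<and>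
           integral (g ` S) (\<lambda>x. vec (f x)) = (vec b :: real ^ 1)"
    using assms
    by (intro has_absolute_integral_change_of_variables)
      (auto intro: has_derivative_at_withinI)
  then show "(\<lambda>x. \<bar>det (matrix (g' x))\<bar> * f (g x)) absolutely_integrable_on S \<and>
      integral S (\<lambda>x. \<bar>det (matrix (g' x))\<bar> * f (g x)) = b \<longleftrightarrow>
      f absolutely_integrable_on g ` S \<and> integral (g ` S) f = b"
    by (simp add: absolutely_integrable_on_1_iff integral_on_1_eq)
qed (use assms in auto)

text \<open>For \<open>a \<ge> 0\<close> both measures give \<open>{..a}\<close> the volume of the
  ball of radius \<open>a\<close>, a multiple of the power \<open>DIM('a)\<close> of
  \<open>a\<close>, whose derivative is the density; for \<open>a < 0\<close> both vanish.
  Half-lines are an intersection-stable generator.\<close>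

lemma distr_norm_lborel:
  "distr lborel borel (norm :: 'a::euclidean_space \<Rightarrow> real) =
   density lborel (\<lambda>r. ennreal (DIM('a) * measure lborel (ball (0::'a) 1) * r ^ (DIM('a) - 1)) * indicator {0..} r)"
  (is "?L = ?R")
proof (rule measure_eqI_generator_eq)
  let ?V = "measure lborel (ball (0::'a) 1)"
  show "Int_stable (range (\<lambda>a::real. {..a}))"
    by (simp add: Int_stable_def)
  show "range (\<lambda>a::real. {..a}) \<subseteq> Pow UNIV" by simp
  show "sets ?L = sigma_sets UNIV (range (\<lambda>a::real. {..a}))"
    "sets ?R = sigma_sets UNIV (range (\<lambda>a::real. {..a}))"
    by (simp_all add: borel_eq_atMost)
  show "range (\<lambda>i::nat. {..real i}) \<subseteq> range (\<lambda>a::real. {..a})" by blast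
  show "(\<Union>i::nat. {..real i}) = UNIV"
    using real_arch_simple by blast
  have pre: "(norm :: 'a \<Rightarrow> real) -` {..a} = cball 0 a" for a
    by (auto simp: cball_def)
  have V: "emeasure lborel (cball (0::'a) a) = ennreal (a ^ DIM('a) * ?V)" if "a \<ge> 0" for a
  proof -
    have "emeasure lborel (cball (0::'a) a) = ennreal (measure lborel (cball (0::'a) a))"
      using emeasure_lborel_cball_finite[of "0::'a" a] by (intro emeasure_eq_ennreal_measure) auto
    also have "measure lborel (cball (0::'a) a) = a ^ DIM('a) * measure lborel (ball (0::'a) 1)"
      by (simp add: content_cball_conv_ball content_ball_conv_unit_ball[OF that])
    finally show ?thesis .
  qed
  show "emeasure ?L {..real i} \<noteq> \<infinity>" for i
    by (simp add: emeasure_distr pre V)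
  fix X assume "X \<in> range (\<lambda>a::real. {..a})"
  then obtain a where X: "X = {..a}" by auto
  show "emeasure ?L X = emeasure ?R X"
  proof (cases "a < 0")
    case True
    have "emeasure ?R X = (\<integral>\<^sup>+(r::real). ennreal (DIM('a) * ?V * r ^ (DIM('a) - 1)) * indicator {0..} r *
        indicator X r \<partial>lborel)"
      unfolding X by (subst emeasure_density) auto
    also have "\<dots> = (\<integral>\<^sup>+(r::real). 0 \<partial>lborel)"
      using True unfolding X by (intro nn_integral_cong) (auto simp: indicator_def)
    finally have "emeasure ?R X = (\<integral>\<^sup>+(r::real). 0 \<partial>lborel)" .
    with True show ?thesis
      by (simp add: X emeasure_distr pre)
  next
    case False
    let ?F = "\<lambda>r::real. ?V * r ^ DIM('a)"
    have "emeasure ?R X = (\<integral>\<^sup>+r. ennreal (DIM('a) * ?V * r ^ (DIM('a) - 1)) * indicator {0..a} r \<partial>lborel)"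
      unfolding X by (subst emeasure_density) (auto intro!: nn_integral_cong simp: indicator_def)
    also have "\<dots> = ennreal (?F a - ?F 0)"
    proof (rule nn_integral_FTC_Icc)
      show "\<And>x. x \<in> {0..a} \<Longrightarrow> (?F has_real_derivative DIM('a) * ?V * x ^ (DIM('a) - 1)) (at x)"
        using DERIV_cmult[OF DERIV_pow[of "DIM('a)"], where c = ?V] by (simp add: mult_ac)
      show "\<And>x. x \<in> {0..a} \<Longrightarrow> 0 \<le> DIM('a) * ?V * x ^ (DIM('a) - 1)"
        by auto
    qed (use False in auto)
    also have "\<dots> = emeasure ?L X"
      using False by (simp add: X emeasure_distr pre V zero_power mult.commute)
    finally show ?thesis ..
  qed
qed

lemma nn_integral_norm:
  fixes G :: "real \<Rightarrow> ennreal"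
  assumes [measurable]: "G \<in> borel_measurable borel"
  shows "(\<integral>\<^sup>+x. G (norm x) \<partial>(lborel :: 'a::euclidean_space measure)) =
    (\<integral>\<^sup>+r\<in>{0<..}. ennreal (DIM('a) * measure lborel (ball (0::'a) 1) * r ^ (DIM('a) - 1)) * G r \<partial>lborel)"
proof -
  have "(\<integral>\<^sup>+x. G (norm x) \<partial>(lborel :: 'a::euclidean_space measure)) =
    (\<integral>\<^sup>+r. G r \<partial>distr lborel borel (norm :: 'a \<Rightarrow> real))"
    by (simp add: nn_integral_distr)
  also have "\<dots> = (\<integral>\<^sup>+r. ennreal (DIM('a) * measure lborel (ball (0::'a) 1) * r ^ (DIM('a) - 1)) *
       indicator {0..} r * G r \<partial>lborel)"
    by (simp add: distr_norm_lborel nn_integral_density)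
  also have "\<dots> = (\<integral>\<^sup>+r\<in>{0<..}. ennreal (DIM('a) * measure lborel (ball (0::'a) 1) * r ^ (DIM('a) - 1)) * G r \<partial>lborel)"
    by (rule nn_integral_cong_AE, use AE_lborel_singleton[of 0] in eventually_elim)
      (auto simp: indicator_def)
  finally show ?thesis .
qed

text \<open>\<open>sinh2 r = sinh\<^sup>2 (2 artanh r)\<close>: here \<open>r\<close> is the Euclidean norm of a point of the ball.\<close>
definition sinh2 :: "real \<Rightarrow> real" where
  "sinh2 r = 4 * r\<^sup>2 / (1 - r\<^sup>2)\<^sup>2"

text \<open>If x = sinh^2 d, then the Euclidean norm is tanh (d/2), and tanh^2 (d/2) = (cosh d - 1)
  / (cosh d + 1) with cosh d = sqrt (1 + x).\<close>

definition sinh2_inv :: "real \<Rightarrow> real" where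
  "sinh2_inv x = sqrt ((sqrt (1 + x) - 1) / (sqrt (1 + x) + 1))"

text \<open>The base of the square on the right is cosh (2 artanh r), so this is 1 + sinh^2 =
  cosh^2.\<close>

lemma one_plus_sinh2: "\<bar>r\<bar> < 1 \<Longrightarrow> 1 + sinh2 r = ((1 + r\<^sup>2) / (1 - r\<^sup>2))\<^sup>2"
proof -
  assume "\<bar>r\<bar> < 1"
  then have "1 - r\<^sup>2 \<noteq> 0"
    by (simp add: abs_square_eq_1 abs_square_less_1)
  then show ?thesis
    by (simp add: sinh2_def field_simps) algebra
qed

lemma sinh2_inv_range:
  assumes "0 \<le> x"
  shows "0 \<le> sinh2_inv x \<and> sinh2_inv x < 1"
proof
  note x = assms
  then have "(sqrt (1 + x) - 1) / (sqrt (1 + x) + 1) < 1"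
    by (simp add: divide_less_eq add_nonneg_pos)
  with x show "sinh2_inv x < 1"
    by (simp add: sinh2_inv_def)
qed (use assms in \<open>simp add: sinh2_inv_def\<close>)

lemma sinh2_inv_pos: "0 < x \<Longrightarrow> 0 < sinh2_inv x"
  by (auto simp: sinh2_inv_def intro!: divide_pos_pos add_nonneg_pos)

lemma sinh2_sinh2_inv:
  assumes "0 \<le> x" shows "sinh2 (sinh2_inv x) = x"
proof -
  define y where "y = sqrt (1 + x)"
  have y: "y \<ge> 1" "y\<^sup>2 = 1 + x"
    using assms by (auto simp: y_def)
  have "(sinh2_inv x)\<^sup>2 = (y - 1) / (y + 1)"
    using y by (simp add: sinh2_inv_def y_def)
  then have "sinh2 (sinh2_inv x) = 4 * ((y - 1) / (y + 1)) / (1 - (y - 1) / (y + 1))\<^sup>2"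
    by (simp add: sinh2_def)
  also have "1 - (y - 1) / (y + 1) = 2 / (y + 1)"
    using y by (simp add: field_simps)
  also have "4 * ((y - 1) / (y + 1)) / (2 / (y + 1))\<^sup>2 = y\<^sup>2 - 1"
    using y by (simp add: field_simps power2_eq_square)
  finally show ?thesis using y by simp
qed

lemma sinh2_inv_sinh2:
  assumes "0 \<le> r" "r < 1" shows "sinh2_inv (sinh2 r) = r"
proof -
  have r: "r\<^sup>2 < 1" using assms by (simp add: abs_square_less_1)
  have "sqrt (1 + sinh2 r) = (1 + r\<^sup>2) / (1 - r\<^sup>2)"
    using assms r by (simp add: one_plus_sinh2)
  moreover have "((1 + r\<^sup>2) / (1 - r\<^sup>2) - 1) / ((1 + r\<^sup>2) / (1 - r\<^sup>2) + 1) = r\<^sup>2"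
    using r by (simp add: field_simps)
  ultimately show ?thesis
    using assms by (simp add: sinh2_inv_def)
qed

lemma sinh2_nonneg [simp]: "0 \<le> sinh2 r"
  by (simp add: sinh2_def)

lemma sinh2_image: "sinh2 ` {0<..<1} = {0<..}"
proof safe
  fix r :: real assume "r \<in> {0<..<1}"
  then show "0 < sinh2 r"
    by (auto simp: sinh2_def abs_square_eq_1)
next
  fix x :: real assume "0 < x"
  then have "x = sinh2 (sinh2_inv x)" "sinh2_inv x \<in> {0<..<1}"
    using sinh2_sinh2_inv[of x] sinh2_inv_range[of x] sinh2_inv_pos[of x] by auto
  then show "x \<in> sinh2 ` {0<..<1}" by blast
qed

lemma sinh2_measurable [measurable]: "sinh2 \<in> borel_measurable borel"
  unfolding sinh2_def by measurable

lemma sinh2_inv_measurable [measurable]: "sinh2_inv \<in> borel_measurable borel"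
  unfolding sinh2_inv_def by measurable

lemma has_real_derivative_sinh2:
  assumes "\<bar>r\<bar> < 1"
  shows "(sinh2 has_real_derivative 8 * r * (1 + r\<^sup>2) / (1 - r\<^sup>2) ^ 3) (at r)"
proof -
  have "1 - r\<^sup>2 \<noteq> 0"
    using assms by (simp add: abs_square_eq_1 abs_square_less_1)
  then show ?thesis
    unfolding sinh2_def
    by (auto intro!: derivative_eq_intros simp: power2_eq_square power3_eq_cube divide_simps)
      algebra
qed

text \<open>Half the area of the unit sphere; the half comes from dx = 2 sinh d cosh d dd for x =
  sinh^2 d.\<close>

definition polar_const :: "'a::euclidean_space itself \<Rightarrow> real" where
  "polar_const _ = DIM('a) * measure lborel (ball (0::'a) 1) / 2"

lemma polar_const_pos: "0 < polar_const TYPE('a::euclidean_space)"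
  by (simp add: polar_const_def content_ball_pos)

text \<open>In geodesic polar coordinates the volume of a ball of dimension k is the sphere area
  times sinh^(k-1) d dd. Substituting x = sinh^2 d produces the powers k/2 - 1 of x and -1/2 of 1 +
  x.\<close>

lemma nn_integral_hyperbolic_polar:
  fixes G :: "real \<Rightarrow> real"
  assumes [measurable]: "G \<in> borel_measurable borel" and G: "\<And>x. 0 \<le> G x"
  shows "(\<integral>\<^sup>+w\<in>{w::'a::euclidean_space. norm w < 1}.
        ennreal (G (sinh2 (norm w)) * (2 / (1 - (norm w)\<^sup>2)) ^ DIM('a)) \<partial>lborel) =
    ennreal (polar_const TYPE('a)) *
      (\<integral>\<^sup>+x\<in>{0<..}. ennreal (G x * x powr (DIM('a) / 2 - 1) * (1 + x) powr (-1/2)) \<partial>lborel)"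
proof -
  let ?k = "DIM('a)"
  let ?V = "measure lborel (ball (0::'a) 1)"
  let ?f = "\<lambda>x. G x * x powr (?k / 2 - 1) * (1 + x) powr (-1/2)"
  let ?g' = "\<lambda>r. 8 * r * (1 + r\<^sup>2) / (1 - r\<^sup>2) ^ 3"
  have key: "\<bar>?g' r\<bar> * ?f (sinh2 r) = 2 * (r ^ (?k - 1) * (G (sinh2 r) * (2 / (1 - r\<^sup>2)) ^ ?k))"
    if "0 < r" "r < 1" for r
  proof -
    have r2: "r\<^sup>2 < 1" using that by (simp add: abs_square_less_1)
    \<comment> \<open>\<open>s\<close> and, below, \<open>q\<close> are sinh and cosh of the
      distance 2 artanh r.\<close>
    define s where "s = 2 * r / (1 - r\<^sup>2)"
    have s: "s > 0" "sinh2 r = s\<^sup>2"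
      using that r2 by (auto simp: s_def sinh2_def power_divide power_mult_distrib)
    have "sinh2 r powr (?k / 2 - 1) = s powr (real ?k - 2)"
      using s powr_powr[of s 2 "?k / 2 - 1"] by (simp add: algebra_simps)
    also have "\<dots> = s ^ ?k / s\<^sup>2"
      using s by (simp add: powr_diff powr_realpow)
    finally have 1: "sinh2 r powr (?k / 2 - 1) = s ^ ?k / s\<^sup>2" .
    define q where "q = (1 + r\<^sup>2) / (1 - r\<^sup>2)"
    have q: "q > 0" "1 + sinh2 r = q\<^sup>2"
      using that r2 by (auto simp: q_def one_plus_sinh2 intro!: divide_pos_pos add_pos_nonneg)
    have 2: "(1 + sinh2 r) powr (-1/2) = 1 / q"
      using q by (simp add: powr_minus_divide powr_half_sqrt)
    have 3: "\<bar>?g' r\<bar> = ?g' r"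
      using that r2 by simp
    have 4: "s ^ ?k = 2 ^ ?k * (r * r ^ (?k - 1)) / (1 - r\<^sup>2) ^ ?k"
      using power_minus_mult[of ?k r] by (simp add: s_def power_divide power_mult_distrib mult.commute)
    have *: "?g' r / (s\<^sup>2 * q) * r = 2"
    proof -
      have "8 * r * h / e ^ 3 / ((2 * r / e)\<^sup>2 * (h / e)) * r = 2" if "e > 0" "h > 0" for e h
        using that \<open>0 < r\<close> by (simp add: field_simps power2_eq_square power3_eq_cube)
      from this[of "1 - r\<^sup>2" "1 + r\<^sup>2"] r2 show ?thesis
        unfolding s_def q_def by (simp add: add_pos_nonneg)
    qed
    have "\<bar>?g' r\<bar> * ?f (sinh2 r) = G (sinh2 r) * (?g' r / (s\<^sup>2 * q)) * s ^ ?k"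
      unfolding 1 2 3 by simp
    also have "\<dots> = G (sinh2 r) * (?g' r / (s\<^sup>2 * q) * r) * (2 ^ ?k * r ^ (?k - 1) / (1 - r\<^sup>2) ^ ?k)"
      unfolding 4 by simp
    also have "\<dots> = 2 * (r ^ (?k - 1) * (G (sinh2 r) * (2 / (1 - r\<^sup>2)) ^ ?k))"
      unfolding * by (simp add: power_divide)
    finally show ?thesis .
  qed
  have "(\<integral>\<^sup>+w\<in>{w::'a. norm w < 1}.
        ennreal (G (sinh2 (norm w)) * (2 / (1 - (norm w)\<^sup>2)) ^ ?k) \<partial>lborel) =
     (\<integral>\<^sup>+w. ennreal (G (sinh2 (norm w)) * (2 / (1 - (norm w)\<^sup>2)) ^ ?k) * indicator {..<1} (norm w)
        \<partial>(lborel :: 'a measure))"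
    by (intro nn_integral_cong) (auto simp: indicator_def)
  also have "\<dots> = (\<integral>\<^sup>+r\<in>{0<..}. ennreal (?k * ?V * r ^ (?k - 1)) *
      (ennreal (G (sinh2 r) * (2 / (1 - r\<^sup>2)) ^ ?k) * indicator {..<1} r) \<partial>lborel)"
    by (rule nn_integral_norm) measurable
  also have "\<dots> = (\<integral>\<^sup>+r. ennreal (polar_const TYPE('a)) *
       (ennreal (\<bar>?g' r\<bar> * ?f (sinh2 r)) * indicator {0<..<1} r) \<partial>lborel)"
  proof (rule nn_integral_cong)
    fix r :: real
    show "ennreal (?k * ?V * r ^ (?k - 1)) *
      (ennreal (G (sinh2 r) * (2 / (1 - r\<^sup>2)) ^ ?k) * indicator {..<1} r) * indicator {0<..} r =
      ennreal (polar_const TYPE('a)) * (ennreal (\<bar>?g' r\<bar> * ?f (sinh2 r)) * indicator {0<..<1} r)"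
    proof (cases "0 < r \<and> r < 1")
      case True
      then have "r\<^sup>2 < 1" by (simp add: abs_square_less_1)
      then have nn: "0 \<le> G (sinh2 r) * (2 / (1 - r\<^sup>2)) ^ ?k"
        using G by auto
      have "ennreal (?k * ?V * r ^ (?k - 1)) * ennreal (G (sinh2 r) * (2 / (1 - r\<^sup>2)) ^ ?k) =
        ennreal (polar_const TYPE('a)) * ennreal (2 * (r ^ (?k - 1) * (G (sinh2 r) * (2 / (1 - r\<^sup>2)) ^ ?k)))"
        using True nn polar_const_pos[where 'a='a]
        by (subst (1 2) ennreal_mult[symmetric]) (auto simp: polar_const_def)
      with True key[of r] show ?thesis by simp
    qed auto
  qed
  also have "\<dots> = ennreal (polar_const TYPE('a)) *
       (\<integral>\<^sup>+r\<in>{0<..<1}. ennreal (\<bar>?g' r\<bar> * ?f (sinh2 r)) \<partial>lborel)"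
    by (rule nn_integral_cmult) measurable
  also have "(\<integral>\<^sup>+r\<in>{0<..<1}. ennreal (\<bar>?g' r\<bar> * ?f (sinh2 r)) \<partial>lborel) =
     (\<integral>\<^sup>+x\<in>sinh2 ` {0<..<1}. ennreal (?f x) \<partial>lborel)"
  proof (rule nn_integral_change_of_variables_real)
    show "inj_on sinh2 {0<..<1}"
      by (rule inj_on_inverseI[of _ sinh2_inv]) (auto simp: sinh2_inv_sinh2)
    show "sinh2 ` {0<..<1} \<in> sets borel" by (simp add: sinh2_image)
    show "set_borel_measurable borel (sinh2 ` {0<..<1}) ?f"
      "set_borel_measurable borel {0<..<1} (\<lambda>r. \<bar>?g' r\<bar> * ?f (sinh2 r))"
      unfolding sinh2_image set_borel_measurable_def by measurable
    show "(sinh2 has_real_derivative ?g' r) (at r)" if "r \<in> {0<..<1}" for r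
      using that by (intro has_real_derivative_sinh2) auto
  qed (use G in auto)
  finally show ?thesis unfolding sinh2_image .
qed

section \<open>Moebius translations\<close>

text \<open>Besides being the denominator of \<open>mobius_tr\<close>, it determines the conformal
  factor (1 - |a|^2) / \<open>mobius_den a x\<close> of the translation at x.\<close>

definition mobius_den :: "real^'n \<Rightarrow> real^'n \<Rightarrow> real" where
  "mobius_den a x = 1 + 2 * (a \<bullet> x) + (norm a)\<^sup>2 * (norm x)\<^sup>2"

lemma mobius_den_pos:
  assumes "norm a < 1" "norm x < 1"
  shows "mobius_den a x > 0"
proof -
  have "norm a * norm x < 1"
    using assms mult_left_le[of "norm x" "norm a"] by simp
  then have "0 < (1 - norm a * norm x)\<^sup>2" by simp
  also have "\<dots> \<le> mobius_den a x"
    using Cauchy_Schwarz_ineq2[of a x]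
    by (simp add: mobius_den_def power2_eq_square algebra_simps)
  finally show ?thesis .
qed

lemma power2_norm_less_1: "norm x < 1 \<Longrightarrow> (norm x)\<^sup>2 < 1"
  by (simp add: abs_square_less_1)

lemma mobius_tr_den:
  "mobius_tr a x = inverse (mobius_den a x) *\<^sub>R
     ((1 + 2 * (a \<bullet> x) + (norm x)\<^sup>2) *\<^sub>R a + (1 - (norm a)\<^sup>2) *\<^sub>R x)"
  by (simp add: mobius_tr_def mobius_den_def)

text \<open>In the scalars A = |a|^2, X = |x|^2 and t = a . x this is a polynomial identity. It says
  that the conformal factor carries the hyperbolic density at the image to the density at x.\<close>

lemma one_minus_norm_mobius_tr:
  assumes "mobius_den a x \<noteq> 0"
  shows "1 - (norm (mobius_tr a x))\<^sup>2 = (1 - (norm a)\<^sup>2) * (1 - (norm x)\<^sup>2) / mobius_den a x"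
proof -
  define A X t d where "A = (norm a)\<^sup>2" and "X = (norm x)\<^sup>2" and "t = a \<bullet> x" and "d = mobius_den a x"
  have d: "d = 1 + 2 * t + A * X" "d \<noteq> 0"
    using assms by (auto simp: d_def mobius_den_def A_def X_def t_def)
  have ip: "a \<bullet> a = A" "x \<bullet> x = X" "a \<bullet> x = t" "x \<bullet> a = t"
    by (simp_all add: A_def X_def t_def power2_norm_eq_inner inner_commute)
  have "(norm ((1 + 2 * t + X) *\<^sub>R a + (1 - A) *\<^sub>R x))\<^sup>2 =
      (1 + 2 * t + X)\<^sup>2 * A + 2 * (1 + 2 * t + X) * (1 - A) * t + (1 - A)\<^sup>2 * X"
    unfolding power2_norm_eq_inner inner_add_left inner_add_right inner_scaleR_left inner_scaleR_right ip
    by algebra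
  then have "(norm (mobius_tr a x))\<^sup>2 =
      ((1 + 2 * t + X)\<^sup>2 * A + 2 * (1 + 2 * t + X) * (1 - A) * t + (1 - A)\<^sup>2 * X) / d\<^sup>2"
    unfolding mobius_tr_den norm_scaleR power_mult_distrib A_def[symmetric] X_def[symmetric]
      t_def[symmetric] d_def[symmetric]
    by (simp add: divide_inverse power_inverse mult.commute)
  moreover have "d\<^sup>2 - ((1 + 2 * t + X)\<^sup>2 * A + 2 * (1 + 2 * t + X) * (1 - A) * t + (1 - A)\<^sup>2 * X) =
      (1 - A) * (1 - X) * d"
    unfolding d(1) by algebra
  ultimately have "1 - (norm (mobius_tr a x))\<^sup>2 = (1 - A) * (1 - X) * d / d\<^sup>2"
    using d(2) by (simp add: field_simps)
  then show ?thesis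
    using d(2) by (simp add: A_def X_def d_def power2_eq_square)
qed

lemma norm_mobius_tr_less_1:
  assumes "norm a < 1" "norm x < 1"
  shows "norm (mobius_tr a x) < 1"
proof -
  have "0 < (1 - (norm a)\<^sup>2) * (1 - (norm x)\<^sup>2) / mobius_den a x"
    using assms mobius_den_pos[OF assms] power2_norm_less_1[of a] power2_norm_less_1[of x] by simp
  then have "(norm (mobius_tr a x))\<^sup>2 < 1"
    using one_minus_norm_mobius_tr[of a x] mobius_den_pos[OF assms] by simp
  then show ?thesis
    by (simp add: abs_square_less_1)
qed

text \<open>The square of the difference is expanded into two norms, known from
  \<open>one_minus_norm_mobius_tr\<close>, and an inner product; the rest is polynomial algebra.
  Conformality is read off from this formula, so the derivative of the translation is never
  computed.\<close>

lemma norm_mobius_tr_diff: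
  assumes "mobius_den a x \<noteq> 0" "mobius_den a y \<noteq> 0"
  shows "(norm (mobius_tr a x - mobius_tr a y))\<^sup>2 =
    (1 - (norm a)\<^sup>2)\<^sup>2 * (norm (x - y))\<^sup>2 / (mobius_den a x * mobius_den a y)"
proof -
  define A X Y t s w d e where "A = (norm a)\<^sup>2" and "X = (norm x)\<^sup>2" and "Y = (norm y)\<^sup>2"
    and "t = a \<bullet> x" and "s = a \<bullet> y" and "w = x \<bullet> y"
    and "d = mobius_den a x" and "e = mobius_den a y"
  have d: "d = 1 + 2 * t + A * X" "d \<noteq> 0" and e: "e = 1 + 2 * s + A * Y" "e \<noteq> 0"
    using assms by (auto simp: d_def e_def mobius_den_def A_def X_def Y_def t_def s_def)
  have ip: "a \<bullet> a = A" "x \<bullet> x = X" "y \<bullet> y = Y" "a \<bullet> x = t" "x \<bullet> a = t" "a \<bullet> y = s" "y \<bullet> a = s"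
    "x \<bullet> y = w" "y \<bullet> x = w"
    by (simp_all add: A_def X_def Y_def t_def s_def w_def power2_norm_eq_inner inner_commute)
  have g1: "D * N = D - P" if "1 - N = P / D" "D \<noteq> 0" for D N P :: real
    using that by (simp add: field_simps)
  have g2: "D * E * (inverse D * inverse E * m) = m" if "D \<noteq> 0" "E \<noteq> 0" for D E m :: real
    using that by (simp add: field_simps)
  have g3: "N = P / (D * E)" if "D * E * N = P" "D \<noteq> 0" "E \<noteq> 0" for D E N P :: real
    using that by (simp add: field_simps)
  have 1: "d * (norm (mobius_tr a x))\<^sup>2 = d - (1 - A) * (1 - X)"
    using one_minus_norm_mobius_tr[OF assms(1)] d(2) unfolding A_def X_def d_def by (rule g1)
  have 2: "e * (norm (mobius_tr a y))\<^sup>2 = e - (1 - A) * (1 - Y)"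
    using one_minus_norm_mobius_tr[OF assms(2)] e(2) unfolding A_def Y_def e_def by (rule g1)
  have "mobius_tr a x \<bullet> mobius_tr a y = inverse d * inverse e *
    (((1 + 2 * t + X) *\<^sub>R a + (1 - A) *\<^sub>R x) \<bullet> ((1 + 2 * s + Y) *\<^sub>R a + (1 - A) *\<^sub>R y))"
    unfolding mobius_tr_den A_def[symmetric] X_def[symmetric] Y_def[symmetric] s_def[symmetric]
      t_def[symmetric] d_def[symmetric] e_def[symmetric] by simp
  also have "((1 + 2 * t + X) *\<^sub>R a + (1 - A) *\<^sub>R x) \<bullet> ((1 + 2 * s + Y) *\<^sub>R a + (1 - A) *\<^sub>R y) =
    (1 + 2 * t + X) * (1 + 2 * s + Y) * A + (1 + 2 * t + X) * (1 - A) * s +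
    (1 + 2 * s + Y) * (1 - A) * t + (1 - A)\<^sup>2 * w" (is "_ = ?m")
    unfolding inner_add_left inner_add_right inner_scaleR_left inner_scaleR_right ip by algebra
  finally have 3: "d * e * (mobius_tr a x \<bullet> mobius_tr a y) = ?m"
    using g2[OF d(2) e(2)] by simp
  have "d * e * (norm (mobius_tr a x - mobius_tr a y))\<^sup>2 =
    e * (d * (norm (mobius_tr a x))\<^sup>2) + d * (e * (norm (mobius_tr a y))\<^sup>2)
      - 2 * (d * e * (mobius_tr a x \<bullet> mobius_tr a y))"
    by (simp add: power2_norm_eq_inner inner_diff_left inner_diff_right inner_commute algebra_simps)
  also have "\<dots> = e * (d - (1 - A) * (1 - X)) + d * (e - (1 - A) * (1 - Y)) - 2 * ?m"
    unfolding 1 2 3 ..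
  also have "\<dots> = (1 - A)\<^sup>2 * (X + Y - 2 * w)"
    unfolding d(1) e(1) by algebra
  also have "X + Y - 2 * w = (norm (x - y))\<^sup>2"
    by (simp add: power2_norm_eq_inner inner_diff_left inner_diff_right ip)
  finally show ?thesis
    using d(2) e(2) unfolding A_def d_def e_def by (rule g3)
qed

lemma mobius_tr_inverse:
  assumes "norm a < 1" "norm x < 1"
  shows "mobius_tr (- a) (mobius_tr a x) = x"
proof -
  define A X t d y where "A = (norm a)\<^sup>2" and "X = (norm x)\<^sup>2" and "t = a \<bullet> x" and "d = mobius_den a x"
    and "y = mobius_tr a x"
  have d: "d = 1 + 2 * t + A * X" "d > 0"
    using mobius_den_pos[OF assms] by (auto simp: d_def mobius_den_def A_def X_def t_def)
  have A: "A < 1" using assms(1) power2_norm_less_1 A_def by blast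
  have y: "y = inverse d *\<^sub>R ((1 + 2 * t + X) *\<^sub>R a + (1 - A) *\<^sub>R x)"
    by (simp add: y_def mobius_tr_den A_def X_def t_def d_def)
  have ay: "a \<bullet> y = ((1 + 2 * t + X) * A + (1 - A) * t) / d"
    by (simp add: y inner_add_right A_def power2_norm_eq_inner t_def divide_inverse mult.commute)
  have ny: "(norm y)\<^sup>2 = 1 - (1 - A) * (1 - X) / d"
    using one_minus_norm_mobius_tr[of a x] d(2) by (simp add: y_def d_def A_def X_def)
  \<comment> \<open>The conformal factors (1 - A) / d at x and (1 - A) /
    \<open>mobius_den (- a) y\<close> at the image multiply to 1, as they must for inverse
    maps.\<close>
  have den: "mobius_den (- a) y = (1 - A)\<^sup>2 / d"
  proof -
    have "mobius_den (- a) y * d = d - 2 * ((1 + 2 * t + X) * A + (1 - A) * t) + A * (d - (1 - A) * (1 - X))"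
      using d(2) by (simp add: mobius_den_def ay ny A_def[symmetric] field_simps)
    also have "\<dots> = (1 - A)\<^sup>2"
      unfolding d(1) by algebra
    finally show ?thesis
      using d(2) by (simp add: field_simps)
  qed
  have num: "1 - 2 * (a \<bullet> y) + (norm y)\<^sup>2 = (1 - A) * (1 + 2 * t + X) / d"
  proof -
    have "(1 - 2 * (a \<bullet> y) + (norm y)\<^sup>2) * d =
        d - 2 * ((1 + 2 * t + X) * A + (1 - A) * t) + (d - (1 - A) * (1 - X))"
      using d(2) by (simp add: ay ny field_simps)
    also have "\<dots> = (1 - A) * (1 + 2 * t + X)"
      unfolding d(1) by algebra
    finally show ?thesis
      using d(2) by (simp add: field_simps)
  qed
  have "mobius_tr (- a) y = inverse ((1 - A)\<^sup>2 / d) *\<^sub>R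
      (((1 - A) * (1 + 2 * t + X) / d) *\<^sub>R (- a) + (1 - A) *\<^sub>R y)"
    unfolding mobius_tr_den den
    by (simp add: num A_def)
  also have "((1 - A) * (1 + 2 * t + X) / d) *\<^sub>R (- a) + (1 - A) *\<^sub>R y = ((1 - A)\<^sup>2 / d) *\<^sub>R x"
    unfolding y by (simp add: scaleR_add_right divide_inverse power2_eq_square mult_ac)
  finally show ?thesis
    using A d(2) by (simp add: y_def)
qed

lemma mobius_tr_differentiable:
  assumes "mobius_den a x \<noteq> 0"
  shows "mobius_tr a differentiable (at x)"
proof -
  have eq: "mobius_tr a = (\<lambda>x. inverse (1 + 2 * (a \<bullet> x) + (a \<bullet> a) * (x \<bullet> x)) *\<^sub>R
     ((1 + 2 * (a \<bullet> x) + x \<bullet> x) *\<^sub>R a + (1 - (norm a)\<^sup>2) *\<^sub>R x))"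
    by (auto simp: fun_eq_iff mobius_tr_def power2_norm_eq_inner)
  show ?thesis
    unfolding eq using assms
    by (intro derivative_intros) (auto simp: mobius_den_def power2_norm_eq_inner)
qed

text \<open>Apply \<open>norm_mobius_tr_diff\<close> to x + t h and x, divide by t^2 and let t tend
  to 0: one limit is |L h|^2, the other is explicit because \<open>mobius_den\<close> is
  continuous.\<close>

lemma mobius_tr_conformal:
  assumes der: "(mobius_tr a has_derivative L) (at x)" and "norm a < 1" "norm x < 1"
  shows "norm (L h) = (1 - (norm a)\<^sup>2) / mobius_den a x * norm h"
proof -
  let ?u = "\<lambda>t::real. x + t *\<^sub>R h"
  have d: "mobius_den a x > 0" using assms mobius_den_pos by blast
  have A: "(norm a)\<^sup>2 < 1" using assms power2_norm_less_1 by blast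
  have L: "linear L" using der has_derivative_linear by blast
  have u0: "(?u has_derivative (\<lambda>t. t *\<^sub>R h)) (at 0)"
    by (auto intro!: derivative_eq_intros)
  have "((mobius_tr a \<circ> ?u) has_derivative (L \<circ> (\<lambda>t. t *\<^sub>R h))) (at 0)"
    using diff_chain_at[OF u0, of "mobius_tr a" L] der by simp
  then have "((\<lambda>t. norm (mobius_tr a (?u t) - mobius_tr a x - t *\<^sub>R L h) / norm t) \<longlongrightarrow> 0) (at 0)"
    by (simp add: has_derivative_iff_norm o_def linear_cmul[OF L])
  moreover have "\<forall>\<^sub>F t in at 0. norm (mobius_tr a (?u t) - mobius_tr a x - t *\<^sub>R L h) / norm t =
      norm ((mobius_tr a (?u t) - mobius_tr a x) /\<^sub>R t - L h)"
  proof (rule eventually_at_filter[THEN iffD2], intro always_eventually allI impI)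
    fix t :: real assume "t \<noteq> 0"
    then have "(mobius_tr a (?u t) - mobius_tr a x) /\<^sub>R t - L h =
        (mobius_tr a (?u t) - mobius_tr a x - t *\<^sub>R L h) /\<^sub>R t"
      by (simp add: scaleR_diff_right)
    then show "norm (mobius_tr a (?u t) - mobius_tr a x - t *\<^sub>R L h) / norm t =
      norm ((mobius_tr a (?u t) - mobius_tr a x) /\<^sub>R t - L h)"
      by (simp add: divide_inverse mult.commute)
  qed
  ultimately have "((\<lambda>t. norm ((mobius_tr a (?u t) - mobius_tr a x) /\<^sub>R t - L h)) \<longlongrightarrow> 0) (at 0)"
    by (rule Lim_transform_eventually)
  then have "((\<lambda>t. (mobius_tr a (?u t) - mobius_tr a x) /\<^sub>R t) \<longlongrightarrow> L h) (at 0)"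
    by (rule LIM_zero_cancel[OF tendsto_norm_zero_cancel])
  then have lim1: "((\<lambda>t. (norm ((mobius_tr a (?u t) - mobius_tr a x) /\<^sub>R t))\<^sup>2) \<longlongrightarrow> (norm (L h))\<^sup>2) (at 0)"
    by (intro tendsto_intros)
  have cont: "((\<lambda>t. mobius_den a (?u t)) \<longlongrightarrow> mobius_den a (?u 0)) (at 0)"
    unfolding mobius_den_def by (intro tendsto_intros)
  then have "\<forall>\<^sub>F t in at 0. mobius_den a (?u t) > 0"
    using d by (auto dest!: order_tendstoD(1)[where a = 0])
  moreover have "\<forall>\<^sub>F t in at 0. (t::real) \<noteq> 0"
    by (auto simp: eventually_at intro!: exI[of _ 1])
  ultimately have ev: "\<forall>\<^sub>F t in at 0. (norm ((mobius_tr a (?u t) - mobius_tr a x) /\<^sub>R t))\<^sup>2 =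
      (1 - (norm a)\<^sup>2)\<^sup>2 * (norm h)\<^sup>2 / (mobius_den a (?u t) * mobius_den a x)"
  proof eventually_elim
    case (elim t)
    then have "(norm (mobius_tr a (?u t) - mobius_tr a x))\<^sup>2 =
      (1 - (norm a)\<^sup>2)\<^sup>2 * (norm (t *\<^sub>R h))\<^sup>2 / (mobius_den a (?u t) * mobius_den a x)"
      using norm_mobius_tr_diff[of a "?u t" x] d by simp
    moreover have "(norm ((mobius_tr a (?u t) - mobius_tr a x) /\<^sub>R t))\<^sup>2 =
        (norm (mobius_tr a (?u t) - mobius_tr a x))\<^sup>2 / t\<^sup>2"
      by (simp add: power_mult_distrib power_inverse divide_inverse mult.commute)
    moreover have "(norm (t *\<^sub>R h))\<^sup>2 = t\<^sup>2 * (norm h)\<^sup>2"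
      by (simp add: power_mult_distrib)
    ultimately show ?case
      using elim by simp
  qed
  have "((\<lambda>t. (1 - (norm a)\<^sup>2)\<^sup>2 * (norm h)\<^sup>2 / (mobius_den a (?u t) * mobius_den a x)) \<longlongrightarrow>
      (1 - (norm a)\<^sup>2)\<^sup>2 * (norm h)\<^sup>2 / (mobius_den a x * mobius_den a x)) (at 0)"
    using cont d by (intro tendsto_intros) auto
  then have "((\<lambda>t. (norm ((mobius_tr a (?u t) - mobius_tr a x) /\<^sub>R t))\<^sup>2) \<longlongrightarrow>
      (1 - (norm a)\<^sup>2)\<^sup>2 * (norm h)\<^sup>2 / (mobius_den a x * mobius_den a x)) (at 0)"
    by (subst tendsto_cong[OF ev])
  with lim1 have "(norm (L h))\<^sup>2 = (1 - (norm a)\<^sup>2)\<^sup>2 * (norm h)\<^sup>2 / (mobius_den a x * mobius_den a x)"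
    by (rule tendsto_unique[OF trivial_limit_at])
  also have "\<dots> = ((1 - (norm a)\<^sup>2) / mobius_den a x * norm h)\<^sup>2"
    by (simp add: power2_eq_square)
  finally show ?thesis
    by (rule power2_eq_imp_eq) (use A d in auto)
qed

text \<open>L / c is orthogonal, so its determinant is 1 or -1.\<close>

lemma abs_det_conformal:
  fixes L :: "real^'m \<Rightarrow> real^'m"
  assumes "linear L" and c: "c > 0" and norm: "\<And>h. norm (L h) = c * norm h"
  shows "\<bar>det (matrix L)\<bar> = c ^ CARD('m)"
proof -
  define T where "T = (\<lambda>h. (1 / c) *\<^sub>R L h)"
  have linT: "linear T"
    unfolding T_def using assms(1) by (rule linear_compose_scale_right)
  have "orthogonal_transformation T"
    unfolding orthogonal_transformation
    using linT c by (auto simp: T_def norm)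
  then have T: "\<bar>det (matrix T)\<bar> = 1"
    using det_orthogonal_matrix orthogonal_transformation_matrix by fastforce
  have "L = (*\<^sub>R) c \<circ> T"
    using c by (auto simp: T_def)
  then have "matrix L = matrix ((*\<^sub>R) c) ** matrix T"
    using linT by (simp add: matrix_compose)
  then show ?thesis
    using T c by (simp add: det_mul abs_mult)
qed

text \<open>The hyperbolic law of cosines: the left side is cosh of the distance from 0 to the
  image, equally the distance from -a to x, and the right side is cosh cosh + sinh sinh cos for the
  triangle with vertices 0, -a and x.\<close>

lemma mobius_cosh:
  assumes "norm a < 1" "norm x < 1"
  shows "(1 + (norm (mobius_tr a x))\<^sup>2) / (1 - (norm (mobius_tr a x))\<^sup>2) =
    ((1 + (norm a)\<^sup>2) * (1 + (norm x)\<^sup>2) + 4 * (a \<bullet> x)) / ((1 - (norm a)\<^sup>2) * (1 - (norm x)\<^sup>2))"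
proof -
  define A X t d y where "A = (norm a)\<^sup>2" and "X = (norm x)\<^sup>2" and "t = a \<bullet> x" and "d = mobius_den a x"
    and "y = (norm (mobius_tr a x))\<^sup>2"
  have d: "d = 1 + 2 * t + A * X" "d > 0"
    using mobius_den_pos[OF assms] by (auto simp: d_def mobius_den_def A_def X_def t_def)
  have pos: "1 - A > 0" "1 - X > 0"
    using assms power2_norm_less_1 by (auto simp: A_def X_def)
  have y: "1 - y = (1 - A) * (1 - X) / d"
    using one_minus_norm_mobius_tr[of a x] d by (simp add: y_def A_def X_def d_def)
  have "1 - y > 0" unfolding y using pos d by simp
  then have "(1 + y) / (1 - y) = 2 / (1 - y) - 1"
    by (simp add: field_simps)
  also have "\<dots> = 2 * d / ((1 - A) * (1 - X)) - 1"
    unfolding y using pos d by simp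
  also have "\<dots> = (2 * d - (1 - A) * (1 - X)) / ((1 - A) * (1 - X))"
    using pos by (simp add: diff_divide_distrib)
  also have "2 * d - (1 - A) * (1 - X) = (1 + A) * (1 + X) + 4 * t"
    unfolding d(1) by algebra
  finally show ?thesis
    by (simp add: A_def X_def t_def y_def)
qed

section \<open>Hoelder's inequality and Beta integrals\<close>

text \<open>Young's inequality is applied to f and g divided by \<open>a\<close> and
  \<open>b\<close>, which are the p-norm of f and a positive upper bound for the q-norm of g. Only f
  can make this normalisation degenerate; when X = 0 it vanishes almost everywhere.\<close>

lemma nn_integral_Holder:
  fixes f g :: "'a \<Rightarrow> real"
  assumes [measurable]: "f \<in> borel_measurable M" "g \<in> borel_measurable M"
    and nn: "\<And>x. 0 \<le> f x" "\<And>x. 0 \<le> g x"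
    and pq: "p > 1" "q > 1" "1 / p + 1 / q = 1"
    and X: "(\<integral>\<^sup>+x. ennreal (f x powr p) \<partial>M) = ennreal X" "0 \<le> X"
    and J: "(\<integral>\<^sup>+x. ennreal (g x powr q) \<partial>M) \<le> ennreal J" "0 < J"
  shows "(\<integral>\<^sup>+x. ennreal (f x * g x) \<partial>M) \<le> ennreal (X powr (1 / p) * J powr (1 / q))"
proof (cases "X = 0")
  case True
  then have "AE x in M. ennreal (f x powr p) = 0"
    using X by (subst nn_integral_0_iff_AE[symmetric]) auto
  then have "AE x in M. ennreal (f x * g x) = 0"
    by eventually_elim (use nn in \<open>auto simp: ennreal_eq_0_iff\<close>)
  then have "(\<integral>\<^sup>+x. ennreal (f x * g x) \<partial>M) = 0"
    by (subst nn_integral_0_iff_AE) auto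
  then show ?thesis by simp
next
  case False
  with X have X0: "X > 0" by simp
  define a where "a = X powr (1 / p)"
  define b where "b = J powr (1 / q)"
  have a: "a > 0" "a powr p = X" and b: "b > 0" "b powr q = J"
    using X0 J pq by (auto simp: a_def b_def powr_powr)
  have pt: "f x * g x \<le> (b * a / (p * X)) * (f x powr p) + (b * a / (q * J)) * (g x powr q)" for x
  proof -
    have "f x / a * (g x / b) \<le> (f x / a) powr p / p + (g x / b) powr q / q"
      using nn a b pq by (intro Youngs_inequality) auto
    also have "\<dots> = (f x powr p) / (p * X) + (g x powr q) / (q * J)"
      using nn a b by (simp add: powr_divide mult.commute)
    finally have "a * b * (f x / a * (g x / b)) \<le> a * b * ((f x powr p) / (p * X) + (g x powr q) / (q * J))"
      using a b by (intro mult_left_mono) auto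
    then show ?thesis
      using a b by (simp add: distrib_left mult_ac)
  qed
  have "(\<integral>\<^sup>+x. ennreal (f x * g x) \<partial>M) \<le>
      (\<integral>\<^sup>+x. ennreal (b * a / (p * X)) * ennreal (f x powr p) + ennreal (b * a / (q * J)) * ennreal (g x powr q) \<partial>M)"
    using pt a b X0 J pq
    by (intro nn_integral_mono) (simp add: ennreal_mult[symmetric] ennreal_plus[symmetric] del: ennreal_plus)
  also have "\<dots> = ennreal (b * a / (p * X)) * (\<integral>\<^sup>+x. ennreal (f x powr p) \<partial>M) +
      ennreal (b * a / (q * J)) * (\<integral>\<^sup>+x. ennreal (g x powr q) \<partial>M)"
    by (simp add: nn_integral_add nn_integral_cmult)
  also have "\<dots> \<le> ennreal (b * a / (p * X)) * ennreal X + ennreal (b * a / (q * J)) * ennreal J"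
    using X J by (intro add_mono mult_left_mono) auto
  also have "\<dots> = ennreal (b * a / (p * X) * X + b * a / (q * J) * J)"
    using a b X0 J pq by (simp add: ennreal_mult[symmetric] ennreal_plus[symmetric] del: ennreal_plus)
  also have "b * a / (p * X) * X + b * a / (q * J) * J = a * b * (1 / p + 1 / q)"
    using X0 J by (simp add: distrib_left mult.commute)
  finally show ?thesis
    by (simp add: pq a_def b_def)
qed

lemma powr_between:
  fixes y c e :: real
  assumes "1 \<le> y" "y \<le> c"
  shows "y powr e \<le> c powr \<bar>e\<bar>"
proof -
  have "y powr e \<le> y powr \<bar>e\<bar>"
    using assms by (intro powr_mono) auto
  also have "\<dots> \<le> c powr \<bar>e\<bar>"
    using assms by (intro powr_mono2) auto
  finally show ?thesis .
qed

text \<open>The integrand is comparable to x^u on (0,1] and to x^(-1-v) beyond 1. The constant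
  \<open>c\<close> bounds the leftover power, whose base 1 + x, respectively (1 + x) / x, lies
  between 1 and 2.\<close>

lemma nn_integral_beta_finite:
  fixes u v :: real
  assumes "u > -1" "v > 0"
  obtains K where "K \<ge> 0"
    "(\<integral>\<^sup>+x\<in>{0<..}. ennreal (x powr u * (1 + x) powr (- (u + 1 + v))) \<partial>lborel) \<le> ennreal K"
proof
  define c where "c = 2 powr \<bar>u + 1 + v\<bar>"
  define K where "K = c * (1 / (u + 1)) + c * (1 / v)"
  show "K \<ge> 0" using assms by (simp add: K_def c_def)
  have c: "c \<ge> 0" by (simp add: c_def)
  have 1: "(\<integral>\<^sup>+x. ennreal (x powr u) * indicator {0..1} x \<partial>lborel) = ennreal (1 / (u + 1))"
    using nn_integral_has_integral_lebesgue'[OF _ has_integral_powr_from_0[of u 1]] assms by simp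
  have 2: "(\<integral>\<^sup>+x. ennreal (x powr (- 1 - v)) * indicator {1..} x \<partial>lborel) = ennreal (1 / v)"
    using nn_integral_has_integral_lebesgue'[OF _ has_integral_powr_to_inf[of "- 1 - v" 1]] assms by simp
  have "(\<integral>\<^sup>+x\<in>{0<..}. ennreal (x powr u * (1 + x) powr (- (u + 1 + v))) \<partial>lborel) \<le>
    (\<integral>\<^sup>+x. ennreal c * (ennreal (x powr u) * indicator {0..1} x) +
        ennreal c * (ennreal (x powr (- 1 - v)) * indicator {1..} x) \<partial>lborel)"
  proof (rule nn_integral_mono)
    fix x :: real
    consider "x \<le> 0" | "0 < x" "x \<le> 1" | "1 < x" by linarith
    then show "ennreal (x powr u * (1 + x) powr (- (u + 1 + v))) * indicator {0<..} x \<le>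
      ennreal c * (ennreal (x powr u) * indicator {0..1} x) +
        ennreal c * (ennreal (x powr (- 1 - v)) * indicator {1..} x)"
    proof cases
      case 2
      have "(1 + x) powr (- (u + 1 + v)) \<le> c"
        using 2 powr_between[of "1 + x" 2 "- (u + 1 + v)"] unfolding c_def abs_minus_cancel by linarith
      then have "x powr u * (1 + x) powr (- (u + 1 + v)) \<le> c * x powr u"
        by (subst mult.commute, intro mult_right_mono) auto
      then have "ennreal (x powr u * (1 + x) powr (- (u + 1 + v))) \<le> ennreal c * ennreal (x powr u)"
        using c by (simp add: ennreal_mult[symmetric] ennreal_leI)
      then show ?thesis
        using 2 by (simp add: add_increasing2)
    next
      case 3
      have "((1 + x) / x) powr (- (u + 1 + v)) \<le> c"
        using 3 powr_between[of "(1 + x) / x" 2 "- (u + 1 + v)"] unfolding c_def abs_minus_cancel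
        by (simp add: divide_le_eq le_divide_eq)
      then have "x powr (- 1 - v) * ((1 + x) / x) powr (- (u + 1 + v)) \<le> c * x powr (- 1 - v)"
        by (subst mult.commute, intro mult_right_mono) auto
      also have "x powr (- 1 - v) * ((1 + x) / x) powr (- (u + 1 + v)) = x powr u * (1 + x) powr (- (u + 1 + v))"
        using 3 by (simp add: powr_divide powr_minus powr_add powr_diff divide_simps)
      finally have "ennreal (x powr u * (1 + x) powr (- (u + 1 + v))) \<le> ennreal c * ennreal (x powr (- 1 - v))"
        using c by (simp add: ennreal_mult[symmetric] ennreal_leI)
      then show ?thesis
        using 3 by (simp add: add_increasing)
    qed simp
  qed
  also have "\<dots> = ennreal c * ennreal (1 / (u + 1)) + ennreal c * ennreal (1 / v)"
    by (subst nn_integral_add) (simp_all add: nn_integral_cmult 1 2)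
  also have "\<dots> = ennreal K"
    using assms c by (simp add: K_def ennreal_mult[symmetric] ennreal_plus[symmetric] del: ennreal_plus)
  finally show "(\<integral>\<^sup>+x\<in>{0<..}. ennreal (x powr u * (1 + x) powr (- (u + 1 + v))) \<partial>lborel) \<le> ennreal K" .
qed

text \<open>Substituting \<phi> x for x, the powers of \<phi> cancel: 1 + e - (\<alpha> + 1 + e) +
  \<alpha> = 0.\<close>

lemma nn_integral_beta_scaled:
  fixes \<phi> e \<alpha> :: real
  assumes "\<phi> > 0"
  shows "(\<integral>\<^sup>+x\<in>{0<..}. ennreal (\<phi> powr e * (\<phi> + x) powr (- (\<alpha> + 1 + e)) * x powr \<alpha>) \<partial>lborel) =
    (\<integral>\<^sup>+x\<in>{0<..}. ennreal (x powr \<alpha> * (1 + x) powr (- (\<alpha> + 1 + e))) \<partial>lborel)"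
proof -
  let ?h = "\<lambda>x. ennreal (\<phi> powr e * (\<phi> + x) powr (- (\<alpha> + 1 + e)) * x powr \<alpha>) * indicator {0<..} x"
  have "(\<integral>\<^sup>+x. ?h x \<partial>lborel) = ennreal \<bar>\<phi>\<bar> * (\<integral>\<^sup>+x. ?h (0 + \<phi> * x) \<partial>lborel)"
    using assms by (intro nn_integral_real_affine) auto
  also have "\<dots> = (\<integral>\<^sup>+x. ennreal \<phi> * ?h (\<phi> * x) \<partial>lborel)"
    using assms by (subst nn_integral_cmult) auto
  also have "\<dots> = (\<integral>\<^sup>+x\<in>{0<..}. ennreal (x powr \<alpha> * (1 + x) powr (- (\<alpha> + 1 + e))) \<partial>lborel)"
  proof (rule nn_integral_cong)
    fix x :: real
    show "ennreal \<phi> * ?h (\<phi> * x) = ennreal (x powr \<alpha> * (1 + x) powr (- (\<alpha> + 1 + e))) * indicator {0<..} x"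
    proof (cases "x > 0")
      case True
      have "\<phi> + \<phi> * x = \<phi> * (1 + x)" by (simp add: algebra_simps)
      then have "\<phi> * (\<phi> powr e * (\<phi> + \<phi> * x) powr (- (\<alpha> + 1 + e)) * (\<phi> * x) powr \<alpha>) =
        (\<phi> powr 1 * \<phi> powr e * \<phi> powr (- (\<alpha> + 1 + e)) * \<phi> powr \<alpha>) * (x powr \<alpha> * (1 + x) powr (- (\<alpha> + 1 + e)))"
        using True assms by (simp add: powr_mult)
      also have "\<phi> powr 1 * \<phi> powr e * \<phi> powr (- (\<alpha> + 1 + e)) * \<phi> powr \<alpha> = 1"
        using assms by (simp only: powr_add[symmetric]) simp
      finally show ?thesis
        using True assms by (simp add: ennreal_mult[symmetric] zero_less_mult_iff)
    next
      case False
      then show ?thesis using assms by (simp add: zero_less_mult_iff)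
    qed
  qed
  finally show ?thesis .
qed

text \<open>The core of sufficiency for p > 1: uniformity as \<phi> tends to 0, where the integrand
  near x = 0 looks like \<phi>^\<theta> (\<phi> + x)^(-e1) x^\<alpha>; R > 0 supplies the decay at
  infinity. The hypothesis admits the borderline \<theta> + \<alpha> + 1 - e1 = 0 when \<theta> > 0,
  but not when \<theta> = 0, where a logarithm appears.\<close>

lemma nn_integral_beta_family_bounded:
  fixes \<theta> e1 \<alpha> R :: real
  assumes "\<alpha> > -1" "R > 0" "\<theta> \<ge> 0"
    and cases: "\<theta> + \<alpha> + 1 - e1 > 0 \<or> (\<alpha> + 1 - e1 < 0 \<and> \<theta> + \<alpha> + 1 - e1 \<ge> 0)"
  obtains K where "K > 0" "\<And>\<phi>. 0 < \<phi> \<Longrightarrow> \<phi> < 1 \<Longrightarrow>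
    (\<integral>\<^sup>+x\<in>{0<..}. ennreal (\<phi> powr \<theta> * ((\<phi> + x) / (1 + x)) powr (- e1) * x powr \<alpha> *
        (1 + x) powr (- (\<alpha> + 1 + R))) \<partial>lborel) \<le> ennreal K"
proof -
  let ?h = "\<lambda>\<phi> x. \<phi> powr \<theta> * ((\<phi> + x) / (1 + x)) powr (- e1) * x powr \<alpha> * (1 + x) powr (- (\<alpha> + 1 + R))"
  let ?I = "\<lambda>\<phi>. \<integral>\<^sup>+x\<in>{0<..}. ennreal (?h \<phi> x) \<partial>lborel"
  let ?w = "\<lambda>x. x powr \<alpha> * (1 + x) powr (- (\<alpha> + 1 + R))"
  have psi: "\<phi> \<le> (\<phi> + x) / (1 + x)" "x / (1 + x) \<le> (\<phi> + x) / (1 + x)" "(\<phi> + x) / (1 + x) \<le> 1"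
     "0 < (\<phi> + x) / (1 + x)" if "0 < \<phi>" "\<phi> < 1" "0 < x" for \<phi> x :: real
    using that by (auto simp: divide_simps algebra_simps mult_le_one add_pos_pos)
  obtain K0 where K0: "K0 \<ge> 0"
    "(\<integral>\<^sup>+x\<in>{0<..}. ennreal (?w x) \<partial>lborel) \<le> ennreal K0"
    using nn_integral_beta_finite[of \<alpha> R] assms by blast
  consider "e1 \<le> \<theta>" | "e1 > \<theta>" "\<theta> + \<alpha> + 1 - e1 > 0" | "\<alpha> + 1 - e1 < 0" "\<theta> + \<alpha> + 1 - e1 \<ge> 0"
    using cases by linarith
  then show ?thesis
  proof cases
    case 1
    show ?thesis
    proof (rule that[of "K0 + 1"])
      fix \<phi> :: real assume \<phi>: "0 < \<phi>" "\<phi> < 1"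
      have "?I \<phi> \<le>
        (\<integral>\<^sup>+x\<in>{0<..}. ennreal (?w x) \<partial>lborel)"
      proof (intro nn_integral_mono)
        fix x :: real
        show "ennreal (?h \<phi> x) * indicator {0<..} x \<le>
          ennreal (?w x) * indicator {0<..} x"
        proof (cases "x > 0")
          case True
          let ?\<psi> = "(\<phi> + x) / (1 + x)"
          have "\<phi> powr \<theta> * ?\<psi> powr (- e1) \<le> ?\<psi> powr \<theta> * ?\<psi> powr (- e1)"
            using psi[OF \<phi> True] \<phi> assms by (intro mult_right_mono powr_mono2) auto
          also have "\<dots> = ?\<psi> powr (\<theta> - e1)"
            by (simp add: powr_add[symmetric])
          also have "\<dots> \<le> 1"
            using psi[OF \<phi> True] 1 \<phi> True by (intro powr_le1) auto
          finally have "\<phi> powr \<theta> * ?\<psi> powr (- e1) * (?w x) \<le>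
            1 * (?w x)"
            by (intro mult_right_mono) auto
          with True show ?thesis by (simp add: ennreal_leI mult_ac)
        qed simp
      qed
      also have "\<dots> \<le> ennreal (K0 + 1)"
        using K0(2) by (rule order_trans) (simp add: ennreal_leI)
      finally show "?I \<phi> \<le> ennreal (K0 + 1)" .
    qed (use K0 in auto)
  next
    case 2
    \<comment> \<open>Enlarging \<phi>^\<theta> to \<psi>^\<theta> leaves \<psi> with the negative
      exponent \<theta> - e1, and \<psi> \<ge> x / (1 + x) turns the bound into a Beta integral free
      of \<phi>.\<close>
    obtain K1 where K1: "K1 \<ge> 0"
      "(\<integral>\<^sup>+x\<in>{0<..}. ennreal (x powr (\<alpha> + \<theta> - e1) * (1 + x) powr (- ((\<alpha> + \<theta> - e1) + 1 + R))) \<partial>lborel) \<le> ennreal K1"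
      using nn_integral_beta_finite[of "\<alpha> + \<theta> - e1" R] assms 2 by (smt (verit))
    show ?thesis
    proof (rule that[of "K1 + 1"])
      fix \<phi> :: real assume \<phi>: "0 < \<phi>" "\<phi> < 1"
      have "?I \<phi> \<le>
        (\<integral>\<^sup>+x\<in>{0<..}. ennreal (x powr (\<alpha> + \<theta> - e1) * (1 + x) powr (- ((\<alpha> + \<theta> - e1) + 1 + R))) \<partial>lborel)"
      proof (intro nn_integral_mono)
        fix x :: real
        show "ennreal (?h \<phi> x) * indicator {0<..} x \<le>
          ennreal (x powr (\<alpha> + \<theta> - e1) * (1 + x) powr (- ((\<alpha> + \<theta> - e1) + 1 + R))) * indicator {0<..} x"
        proof (cases "x > 0")
          case True
          let ?\<psi> = "(\<phi> + x) / (1 + x)"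
          have "\<phi> powr \<theta> * ?\<psi> powr (- e1) \<le> ?\<psi> powr \<theta> * ?\<psi> powr (- e1)"
            using psi[OF \<phi> True] \<phi> assms by (intro mult_right_mono powr_mono2) auto
          also have "\<dots> = ?\<psi> powr (\<theta> - e1)"
            by (simp add: powr_add[symmetric])
          also have "\<dots> \<le> (x / (1 + x)) powr (\<theta> - e1)"
            using psi[OF \<phi> True] 2 True by (intro powr_mono2') auto
          finally have "\<phi> powr \<theta> * ?\<psi> powr (- e1) * (?w x) \<le>
            (x / (1 + x)) powr (\<theta> - e1) * (?w x)"
            by (intro mult_right_mono) auto
          also have "(x / (1 + x)) powr (\<theta> - e1) = x powr (\<theta> - e1) * (1 + x) powr (- (\<theta> - e1))"
            using True unfolding powr_minus_divide by (simp add: powr_divide)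
          also have "x powr (\<theta> - e1) * (1 + x) powr (- (\<theta> - e1)) * (?w x) =
            (x powr (\<theta> - e1) * x powr \<alpha>) * ((1 + x) powr (- (\<theta> - e1)) * (1 + x) powr (- (\<alpha> + 1 + R)))"
            by (simp only: mult_ac)
          also have "\<dots> = x powr (\<alpha> + \<theta> - e1) * (1 + x) powr (- ((\<alpha> + \<theta> - e1) + 1 + R))"
            unfolding powr_add[symmetric] by (simp add: algebra_simps)
          finally show ?thesis using True by (simp add: ennreal_leI mult_ac)
        qed simp
      qed
      also have "\<dots> \<le> ennreal (K1 + 1)"
        using K1(2) by (rule order_trans) (simp add: ennreal_leI)
      finally show "?I \<phi> \<le> ennreal (K1 + 1)" .
    qed (use K1 in auto)
  next
    case 3
    \<comment> \<open>Now the part x \<le> 1 may itself grow like \<phi>^(-e). Since e \<le>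
      \<theta>, the factor \<phi>^e is available, and with it \<open>nn_integral_beta_scaled\<close>
      applies exactly; for x > 1 one has \<psi> \<ge> 1/2.\<close>
    define e where "e = e1 - \<alpha> - 1"
    have e: "e > 0" "e \<le> \<theta>" "e1 = \<alpha> + 1 + e" and e1: "e1 > 0"
      using 3 assms by (auto simp: e_def)
    obtain K1 where K1: "K1 \<ge> 0"
      "(\<integral>\<^sup>+x\<in>{0<..}. ennreal (x powr \<alpha> * (1 + x) powr (- (\<alpha> + 1 + e))) \<partial>lborel) \<le> ennreal K1"
      using nn_integral_beta_finite[of \<alpha> e] assms e by blast
    define c where "c = 2 powr \<bar>e - R\<bar>"
    define d where "d = 2 powr e1"
    have cd: "c > 0" "d > 0" by (auto simp: c_def d_def)
    show ?thesis
    proof (rule that[of "c * K1 + d * K0 + 1"])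
      fix \<phi> :: real assume \<phi>: "0 < \<phi>" "\<phi> < 1"
      let ?u = "\<lambda>x. \<phi> powr e * (\<phi> + x) powr (- (\<alpha> + 1 + e)) * x powr \<alpha>"
      have "?I \<phi> \<le>
        (\<integral>\<^sup>+x. ennreal c * (ennreal (?u x) * indicator {0<..} x) + ennreal d * (ennreal (?w x) * indicator {0<..} x) \<partial>lborel)"
      proof (intro nn_integral_mono)
        fix x :: real
        show "ennreal (?h \<phi> x) * indicator {0<..} x \<le>
          ennreal c * (ennreal (?u x) * indicator {0<..} x) + ennreal d * (ennreal (?w x) * indicator {0<..} x)"
        proof (cases "x > 0")
          case True
          let ?\<psi> = "(\<phi> + x) / (1 + x)"
          have "\<phi> powr \<theta> \<le> \<phi> powr e"
            using \<phi> e by (intro powr_mono') auto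
          then have le1: "\<phi> powr \<theta> * (?\<psi> powr (- e1) * ?w x) \<le> \<phi> powr e * (?\<psi> powr (- e1) * ?w x)"
            by (intro mult_right_mono) auto
          have "\<phi> powr e * (?\<psi> powr (- e1) * ?w x) \<le> c * ?u x + d * ?w x"
          proof (cases "x \<le> 1")
            case x1: True
            have "?\<psi> powr (- e1) = (\<phi> + x) powr (- e1) * (1 + x) powr e1"
              using True \<phi> by (simp add: powr_divide powr_minus_divide)
            then have "\<phi> powr e * (?\<psi> powr (- e1) * ?w x) =
                ?u x * ((1 + x) powr e1 * (1 + x) powr (- (\<alpha> + 1 + R)))"
              by (simp add: e(3) mult_ac)
            also have "(1 + x) powr e1 * (1 + x) powr (- (\<alpha> + 1 + R)) = (1 + x) powr (e - R)"
              unfolding powr_add[symmetric] by (simp add: e(3))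
            also have "?u x * (1 + x) powr (e - R) \<le> ?u x * c"
              unfolding c_def using x1 True by (intro mult_left_mono powr_between) auto
            finally show ?thesis
              using cd by (simp add: mult.commute add_increasing2)
          next
            case x1: False
            have "\<phi> powr e \<le> 1" using \<phi> e by (intro powr_le1) auto
            moreover have "?\<psi> powr (- e1) \<le> (1 / 2) powr (- e1)"
              using x1 \<phi> e1 by (intro powr_mono2') (auto simp: field_simps)
            moreover have "(1 / 2) powr (- e1) = d"
              by (simp add: d_def powr_minus powr_divide)
            ultimately have "\<phi> powr e * (?\<psi> powr (- e1) * ?w x) \<le> 1 * (d * ?w x)"
              using cd by (intro mult_mono) auto
            then show ?thesis
              using cd by (simp add: add_increasing)
          qed
          with le1 have "?h \<phi> x \<le>
              c * ?u x + d * ?w x"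
            by (simp add: mult_ac)
          then have "ennreal (?h \<phi> x) \<le>
            ennreal (c * ?u x + d * ?w x)" by (rule ennreal_leI)
          also have "\<dots> = ennreal c * ennreal (?u x) + ennreal d * ennreal (?w x)"
            using cd by (simp add: ennreal_mult[symmetric] ennreal_plus[symmetric] del: ennreal_plus)
          finally show ?thesis using True by simp
        qed simp
      qed
      also have "\<dots> = ennreal c * (\<integral>\<^sup>+x\<in>{0<..}. ennreal (?u x) \<partial>lborel) + ennreal d * (\<integral>\<^sup>+x\<in>{0<..}. ennreal (?w x) \<partial>lborel)"
        by (subst nn_integral_add) (auto simp: nn_integral_cmult)
      also have "\<dots> \<le> ennreal c * ennreal K1 + ennreal d * ennreal K0"
        unfolding nn_integral_beta_scaled[OF \<phi>(1)] using K1 K0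
        by (intro add_mono mult_left_mono) auto
      also have "\<dots> = ennreal (c * K1 + d * K0)"
        using cd K1 K0 by (simp add: ennreal_mult[symmetric] ennreal_plus[symmetric] del: ennreal_plus)
      also have "\<dots> \<le> ennreal (c * K1 + d * K0 + 1)"
        by (intro ennreal_leI) simp
      finally show "?I \<phi> \<le> ennreal (c * K1 + d * K0 + 1)" .
    qed (use K1 K0 cd in \<open>auto intro: add_nonneg_pos\<close>)
  qed
qed

section \<open>Integration over geodesic subspaces\<close>

lemma mobius_tr_measurable [measurable]: "mobius_tr a \<in> borel_measurable borel"
  unfolding mobius_tr_def[abs_def] by measurable

lemma matrix_vector_mult_measurable [measurable]: "(*v) (M :: real^'k^'n) \<in> borel_measurable borel"
  by (intro borel_measurable_continuous_onI) (simp add: linear_continuous_on matrix_vector_mul_bounded_linear)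

lemma norm_mult_measurable [measurable]:
  "(\<lambda>u. norm ((M :: real^'k^'n) *v u)) \<in> borel_measurable borel"
  by (rule measurable_compose[OF matrix_vector_mult_measurable borel_measurable_norm])

lemma mobius_tr_mult_measurable [measurable]:
  "(\<lambda>u. mobius_tr a ((M :: real^'k^'n) *v u)) \<in> borel_measurable borel"
  by (rule measurable_compose[OF matrix_vector_mult_measurable mobius_tr_measurable])

lemma mobius_tr_image_ball:
  fixes c :: "real^'n"
  assumes "norm c < 1"
  shows "mobius_tr c ` {x. norm x < 1} = {x. norm x < 1}"
proof safe
  fix w :: "real^'n" assume w: "norm w < 1"
  have "w = mobius_tr c (mobius_tr (- c) w)"
    using mobius_tr_inverse[of "- c" w] assms w by simp
  moreover have "norm (mobius_tr (- c) w) < 1"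
    using assms w norm_mobius_tr_less_1[of "- c" w] by simp
  ultimately show "w \<in> mobius_tr c ` {x. norm x < 1}" by blast
qed (use assms norm_mobius_tr_less_1 in auto)

text \<open>Invariance of hyperbolic volume: the Jacobian of the translation is a power of the
  conformal factor and cancels against the ratio of the two densities. What remains is
  \<open>\<bar>det M\<bar>\<close>, the Gram factor of a square matrix.\<close>

lemma nn_integral_mobius_linear:
  fixes c :: "real^'m::{finite,wellorder}" and M :: "real^'m::_^'m::_" and F :: "real \<Rightarrow> real"
  assumes c: "norm c < 1" and M: "det M \<noteq> 0"
    and [measurable]: "F \<in> borel_measurable borel" and F: "\<And>x. 0 \<le> F x"
  shows "(\<integral>\<^sup>+u\<in>{u. norm (M *v u) < 1}. ennreal (F (sinh2 (norm (mobius_tr c (M *v u)))) *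
        (2 / (1 - (norm (M *v u))\<^sup>2)) ^ CARD('m) * \<bar>det M\<bar>) \<partial>lborel) =
    (\<integral>\<^sup>+w\<in>{w::real^'m::_. norm w < 1}. ennreal (F (sinh2 (norm w)) * (2 / (1 - (norm w)\<^sup>2)) ^ CARD('m)) \<partial>lborel)"
proof -
  let ?k = "CARD('m)"
  let ?S = "{u. norm (M *v u) < 1}"
  let ?g = "\<lambda>u. mobius_tr c (M *v u)"
  let ?f = "\<lambda>w::real^'m::_. F (sinh2 (norm w)) * (2 / (1 - (norm w)\<^sup>2)) ^ ?k"
  define L where "L = (\<lambda>x. frechet_derivative (mobius_tr c) (at x))"
  define g' where "g' = (\<lambda>u h. L (M *v u) (M *v h))"
  have inv: "invertible M"
    using M invertible_det_nz by blast
  have surj: "range ((*v) M) = UNIV"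
    using inv by (metis invertible_right_inverse matrix_right_invertible_surjective)
  have injM: "inj ((*v) M)"
    using inv by (metis invertible_left_inverse matrix_left_invertible_injective)
  have L: "(mobius_tr c has_derivative L x) (at x)" if "norm x < 1" for x
    using mobius_tr_differentiable[of c x] mobius_den_pos[OF c that]
    by (simp add: L_def frechet_derivative_works)
  have der: "(?g has_derivative g' u) (at u)" if "u \<in> ?S" for u
  proof -
    have "((*v) M has_derivative (*v) M) (at u)"
      by (rule bounded_linear_imp_has_derivative[OF matrix_vector_mul_bounded_linear])
    from diff_chain_at[OF this L] that show ?thesis
      by (simp add: o_def g'_def)
  qed
  have image: "?g ` ?S = {w. norm w < 1}"
  proof -
    have "(*v) M ` ?S = {x. norm x < 1}"
      using surj by (auto simp: image_iff)
    then have "mobius_tr c ` (*v) M ` ?S = {w. norm w < 1}"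
      using mobius_tr_image_ball[OF c] by simp
    then show ?thesis by (simp add: image_image)
  qed
  have det: "\<bar>det (matrix (g' u))\<bar> = ((1 - (norm c)\<^sup>2) / mobius_den c (M *v u)) ^ ?k * \<bar>det M\<bar>"
    if "u \<in> ?S" for u
  proof -
    have lin: "linear (L (M *v u))"
      using L that has_derivative_linear by blast
    have "matrix (g' u) = matrix (L (M *v u)) ** M"
      using matrix_compose[OF matrix_vector_mul_linear lin, of M] by (simp add: g'_def o_def)
    moreover have "\<bar>det (matrix (L (M *v u)))\<bar> = ((1 - (norm c)\<^sup>2) / mobius_den c (M *v u)) ^ ?k"
    proof (rule abs_det_conformal[OF lin])
      show "0 < (1 - (norm c)\<^sup>2) / mobius_den c (M *v u)"
        using mobius_den_pos[OF c, of "M *v u"] power2_norm_less_1[OF c] that by simp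
      show "norm (L (M *v u) h) = (1 - (norm c)\<^sup>2) / mobius_den c (M *v u) * norm h" for h
        using that c by (intro mobius_tr_conformal L) auto
    qed
    ultimately show ?thesis
      by (simp add: det_mul abs_mult)
  qed
  have key: "\<bar>det (matrix (g' u))\<bar> * ?f (?g u) =
      F (sinh2 (norm (?g u))) * (2 / (1 - (norm (M *v u))\<^sup>2)) ^ ?k * \<bar>det M\<bar>" if "u \<in> ?S" for u
  proof -
    have x: "norm (M *v u) < 1" using that by simp
    define q d y where "q = 1 - (norm c)\<^sup>2" and "d = mobius_den c (M *v u)" and "y = 1 - (norm (M *v u))\<^sup>2"
    have pos: "q > 0" "d > 0" "y > 0"
      using power2_norm_less_1[OF c] power2_norm_less_1[OF x] mobius_den_pos[OF c x]
      by (auto simp: q_def d_def y_def)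
    have "1 - (norm (?g u))\<^sup>2 = q * y / d"
      unfolding q_def y_def d_def using pos by (intro one_minus_norm_mobius_tr) (simp add: d_def)
    then have "\<bar>det (matrix (g' u))\<bar> * ?f (?g u) =
       F (sinh2 (norm (?g u))) * ((q / d) * (2 / (q * y / d))) ^ ?k * \<bar>det M\<bar>"
      unfolding det[OF that] power_mult_distrib by (simp add: q_def d_def)
    also have "(q / d) * (2 / (q * y / d)) = 2 / y"
      using pos by simp
    finally show ?thesis by (simp add: y_def)
  qed
  have borelS [measurable]: "?S \<in> sets borel"
    by (intro borel_open open_Collect_less continuous_intros linear_continuous_on
        matrix_vector_mul_bounded_linear)
  have borel_ball [measurable]: "{w::real^'m::_. norm w < 1} \<in> sets borel"
    by (intro borel_open open_Collect_less continuous_intros)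
  have "(\<integral>\<^sup>+u\<in>?S. ennreal (\<bar>det (matrix (g' u))\<bar> * ?f (?g u)) \<partial>lborel) = (\<integral>\<^sup>+w\<in>?g ` ?S. ennreal (?f w) \<partial>lborel)"
  proof (rule nn_integral_change_of_variables)
    show "?S \<in> sets borel" by (rule borelS)
    show "\<And>u. u \<in> ?S \<Longrightarrow> (?g has_derivative g' u) (at u)" by (rule der)
    show "?g ` ?S \<in> sets borel" using image borel_ball by simp
    show "inj_on ?g ?S"
    proof (rule inj_onI)
      fix u v assume uv: "u \<in> ?S" "v \<in> ?S" "?g u = ?g v"
      have "M *v u = mobius_tr (- c) (?g u)"
        using mobius_tr_inverse[OF c, of "M *v u"] uv(1) by simp
      also have "\<dots> = mobius_tr (- c) (?g v)"
        by (simp only: uv(3))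
      also have "\<dots> = M *v v"
        using mobius_tr_inverse[OF c, of "M *v v"] uv(2) by simp
      finally have "M *v u = M *v v" .
      then show "u = v" using injM by (simp add: inj_eq)
    qed
    have "set_borel_measurable borel {w::real^'m::_. norm w < 1} ?f"
      unfolding set_borel_measurable_def by measurable
    then show "set_borel_measurable borel (?g ` ?S) ?f"
      using image by simp
    show "0 \<le> ?f w" if "w \<in> ?g ` ?S" for w
      using that F power2_norm_less_1[of w] image by auto
    have eq: "(\<lambda>u. indicator ?S u *\<^sub>R (\<bar>det (matrix (g' u))\<bar> * ?f (?g u))) =
      (\<lambda>u. indicator ?S u *\<^sub>R (F (sinh2 (norm (?g u))) * (2 / (1 - (norm (M *v u))\<^sup>2)) ^ ?k * \<bar>det M\<bar>))"
      using key by (auto simp: fun_eq_iff indicator_def)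
    show "set_borel_measurable borel ?S (\<lambda>u. \<bar>det (matrix (g' u))\<bar> * ?f (?g u))"
      unfolding set_borel_measurable_def eq by measurable
  qed
  also have "(\<integral>\<^sup>+u\<in>?S. ennreal (\<bar>det (matrix (g' u))\<bar> * ?f (?g u)) \<partial>lborel) =
     (\<integral>\<^sup>+u\<in>?S. ennreal (F (sinh2 (norm (?g u))) * (2 / (1 - (norm (M *v u))\<^sup>2)) ^ ?k * \<bar>det M\<bar>) \<partial>lborel)"
  proof (rule nn_integral_cong)
    fix u
    show "ennreal (\<bar>det (matrix (g' u))\<bar> * ?f (?g u)) * indicator ?S u =
      ennreal (F (sinh2 (norm (?g u))) * (2 / (1 - (norm (M *v u))\<^sup>2)) ^ ?k * \<bar>det M\<bar>) * indicator ?S u"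
      by (cases "u \<in> ?S") (simp_all only: key, simp)
  qed
  finally show ?thesis using image by simp
qed

section \<open>Linear algebra: Gram determinants, isometric embeddings and relabelling of
  coordinates\<close>

lemma inner_transpose_mult:
  fixes A :: "real^'m^'n"
  shows "(transpose A *v x) \<bullet> y = x \<bullet> (A *v y)"
  unfolding transpose_matrix_vector dot_lmul_matrix ..

text \<open>Choose an isometry Q onto the range of M and set N = Q^T M. As Q preserves inner
  products, M and N have the same Gram matrix, so the Gram factor becomes
  \<open>\<bar>det N\<bar>\<close> and the integral moves to a square matrix.\<close>

lemma linear_factor_isometry:
  fixes M :: "real^'m^'n"
  assumes G: "det (transpose M ** M) \<noteq> 0"
  obtains Q :: "real^'m \<Rightarrow> real^'n" and N :: "real^'m^'m"
  where "linear Q" "\<And>x. norm (Q x) = norm x" "range Q = range ((*v) M)"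
    "\<And>u. M *v u = Q (N *v u)" "det N \<noteq> 0" "sqrt (det (transpose M ** M)) = \<bar>det N\<bar>"
proof -
  have inj: "inj ((*v) M)"
  proof (rule linear_injective_0[THEN iffD2, OF matrix_vector_mul_linear], intro allI impI)
    fix u assume "M *v u = 0"
    then have "(transpose M ** M) *v u = 0"
      by (simp flip: matrix_vector_mul_assoc)
    moreover have "invertible (transpose M ** M)"
      using G invertible_det_nz by blast
    ultimately show "u = 0"
      by (metis invertible_left_inverse matrix_left_invertible_ker)
  qed
  have sub: "subspace (range ((*v) M))"
    by (simp add: linear_subspace_image matrix_vector_mul_linear)
  have "dim (range ((*v) M)) = dim (UNIV :: (real^'m) set)"
    using inj by (intro dim_image_eq matrix_vector_mul_linear) (simp add: inj_on_subset)
  then obtain Q :: "real^'m \<Rightarrow> real^'n" where Q: "linear Q" "range Q = range ((*v) M)"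
      "\<And>x. norm (Q x) = norm x"
    using isometry_subspaces[OF subspace_UNIV sub, where 'a = "real^'m"] by auto
  define N where "N = transpose (matrix Q) ** M"
  have inner: "Q x \<bullet> Q y = x \<bullet> y" for x y
    unfolding dot_norm linear_add[OF Q(1), symmetric] Q(3) ..
  have QtQ: "transpose (matrix Q) *v (Q x) = x" for x
  proof -
    have "(transpose (matrix Q) *v (Q x)) \<bullet> y = x \<bullet> y" for y
      unfolding inner_transpose_mult fun_cong[OF matrix_vector_mul(2)[OF Q(1)]] by (rule inner)
    then show ?thesis using vector_eq_rdot by blast
  qed
  have fac: "M *v u = Q (N *v u)" for u
  proof -
    obtain x where x: "M *v u = Q x"
      using Q(2) by (metis rangeE rangeI)
    have "N *v u = x"
      unfolding N_def by (simp only: x QtQ matrix_vector_mul_assoc[symmetric])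
    then show ?thesis using x by simp
  qed
  have "(transpose M ** M) *v u = (transpose N ** N) *v u" for u
  proof -
    have "((transpose M ** M) *v u) \<bullet> y = ((transpose N ** N) *v u) \<bullet> y" for y
    proof -
      have "((transpose M ** M) *v u) \<bullet> y = (M *v u) \<bullet> (M *v y)"
        by (simp only: matrix_vector_mul_assoc[symmetric] inner_transpose_mult)
      also have "\<dots> = (N *v u) \<bullet> (N *v y)"
        by (simp add: fac inner)
      also have "\<dots> = ((transpose N ** N) *v u) \<bullet> y"
        by (simp only: matrix_vector_mul_assoc[symmetric] inner_transpose_mult)
      finally show ?thesis .
    qed
    then show ?thesis using vector_eq_rdot by blast
  qed
  then have "transpose M ** M = transpose N ** N"
    by (simp add: matrix_eq)
  then have "det (transpose M ** M) = (det N)\<^sup>2"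
    by (simp add: det_mul power2_eq_square)
  then show ?thesis
    using that[of Q N] Q fac G by auto
qed

text \<open>The library's change of variables on \<^typ>\<open>real^'m\<close> needs a well-ordered index type, so integrals over
  \<^typ>\<open>real^'k\<close> are transported to a well-ordered copy of the index type.\<close>
typedef ('a::finite) idx = "{..<CARD('a)}"
  by (rule exI[of _ 0]) simp

instantiation idx :: (finite) "{finite, wellorder}"
begin

definition less_eq_idx :: "'a idx \<Rightarrow> 'a idx \<Rightarrow> bool" where
  "less_eq_idx x y \<longleftrightarrow> Rep_idx x \<le> Rep_idx y"

definition less_idx :: "'a idx \<Rightarrow> 'a idx \<Rightarrow> bool" where
  "less_idx x y \<longleftrightarrow> Rep_idx x < Rep_idx y"

instance
proof
  have "finite (Rep_idx ` (UNIV :: 'a idx set))"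
    by (rule finite_subset[of _ "{..<CARD('a)}"]) (use Rep_idx in auto)
  then show "finite (UNIV :: 'a idx set)"
    by (rule finite_imageD) (simp add: inj_on_def Rep_idx_inject)
  fix P :: "'a idx \<Rightarrow> bool" and a
  assume step: "\<And>x. (\<And>y. y < x \<Longrightarrow> P y) \<Longrightarrow> P x"
  show "P a"
    by (induction a rule: measure_induct_rule[of Rep_idx]) (metis step less_idx_def)
qed (auto simp: less_eq_idx_def less_idx_def Rep_idx_inject)

end

lemma card_idx: "CARD('a::finite idx) = CARD('a)"
  using type_definition.card[OF type_definition_idx] by simp

text \<open>Relabelling carries boxes to boxes and only reorders the product of the side
  lengths.\<close>

lemma distr_lborel_relabel:
  fixes \<pi> :: "'m::finite \<Rightarrow> 'k::finite"
  assumes "bij \<pi>"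
  shows "lborel = distr lborel borel (\<lambda>u. \<chi> j. u $ inv \<pi> j :: real^'k)"
proof (rule lborel_eqI)
  let ?P = "\<lambda>u::real^'m. \<chi> j. u $ inv \<pi> j :: real^'k"
  have [measurable]: "?P \<in> borel_measurable borel"
    by (intro borel_measurable_continuous_onI continuous_intros)
  have inv: "\<pi> (inv \<pi> j) = j" "inv \<pi> (\<pi> i) = i" for i j
    using assms by (simp_all add: bij_is_surj surj_f_inv_f bij_is_inj)
  fix l u :: "real^'k"
  assume le: "\<And>b. b \<in> Basis \<Longrightarrow> l \<bullet> b \<le> u \<bullet> b"
  let ?l = "\<chi> i. l $ \<pi> i" and ?u = "\<chi> i. u $ \<pi> i"
  have le': "l $ j \<le> u $ j" for j
    using le[of "axis j 1"] by (simp add: inner_axis axis_in_Basis_iff)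
  have "?P -` box l u = box ?l ?u"
    by (auto simp: mem_box_cart) (metis inv)+
  then have "emeasure (distr lborel borel ?P) (box l u) = emeasure lborel (box ?l ?u)"
    by (simp add: emeasure_distr)
  also have "\<dots> = ennreal (measure lborel (cbox ?l ?u))"
    using le' by (simp add: emeasure_lborel_box_eq emeasure_lborel_cbox_eq measure_def
        eucl_le[where 'a="real^'m"] less_eq_vec_def)
  also have "measure lborel (cbox ?l ?u) = (\<Prod>i\<in>UNIV. u $ \<pi> i - l $ \<pi> i)"
    using le' by (subst content_cbox_cart) (auto simp: interval_ne_empty_cart)
  also have "\<dots> = (\<Prod>j\<in>UNIV. u $ j - l $ j)"
    using assms by (rule prod.reindex_bij_betw)
  also have "\<dots> = measure lborel (cbox l u)"
    using le' by (subst content_cbox_cart) (auto simp: interval_ne_empty_cart)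
  also have "\<dots> = (\<Prod>b\<in>Basis. (u - l) \<bullet> b)"
    using le by (simp add: inner_diff_left)
  finally show "emeasure (distr lborel borel ?P) (box l u) = ennreal (\<Prod>b\<in>Basis. (u - l) \<bullet> b)" .
qed simp

lemma nn_integral_lborel_relabel:
  fixes \<pi> :: "'m::finite \<Rightarrow> 'k::finite"
  assumes "bij \<pi>" and [measurable]: "h \<in> borel_measurable borel"
  shows "(\<integral>\<^sup>+u. h u \<partial>lborel) = (\<integral>\<^sup>+u. h (\<chi> j. u $ inv \<pi> j :: real^'k) \<partial>lborel)"
proof -
  have [measurable]: "(\<lambda>u. \<chi> j. u $ inv \<pi> j :: real^'k) \<in> borel_measurable borel"
    by (intro borel_measurable_continuous_onI continuous_intros)
  show ?thesis
    by (subst distr_lborel_relabel[OF assms(1)], subst nn_integral_distr) simp_all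
qed

text \<open>Conjugation by \<pi> is a bijection between the permutations of the two index types that
  preserves signs, so the Leibniz sums agree term by term.\<close>

lemma det_relabel:
  fixes A :: "real^'k^'k" and \<pi> :: "'m::finite \<Rightarrow> 'k::finite"
  assumes "bij \<pi>"
  shows "det (\<chi> i j. A $ \<pi> i $ \<pi> j) = det A"
proof -
  have inv: "\<pi> (inv \<pi> j) = j" "inv \<pi> (\<pi> i) = i" for i j
    using assms by (simp_all add: bij_is_surj surj_f_inv_f bij_is_inj)
  have inj: "inj \<pi>" "inj (inv \<pi>)"
    using assms by (simp_all add: bij_is_inj bij_imp_bij_inv)
  have app: "map_permutation UNIV \<pi> p (\<pi> i) = \<pi> (p i)" for p i
    using inj by (intro map_permutation_apply) auto
  show ?thesis
    unfolding det_def
  proof (rule sum.reindex_bij_witness[where i = "map_permutation UNIV (inv \<pi>)" and j = "map_permutation UNIV \<pi>"])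
    fix p :: "'m \<Rightarrow> 'm" assume "p \<in> {p. p permutes UNIV}"
    then have p: "p permutes UNIV" by simp
    show "map_permutation UNIV (inv \<pi>) (map_permutation UNIV \<pi> p) = p"
      using p assms inv by (intro map_permutation_compose_inv[where B = UNIV]) auto
    show "map_permutation UNIV \<pi> p \<in> {p. p permutes UNIV}"
      using map_permutation_permutes[OF assms p] by simp
    have "sign (map_permutation UNIV \<pi> p) = sign p"
      using inj p by (intro sign_map_permutation) auto
    moreover have "(\<Prod>i\<in>UNIV. A $ \<pi> i $ \<pi> (p i)) = (\<Prod>j\<in>UNIV. A $ j $ map_permutation UNIV \<pi> p j)"
      using prod.reindex_bij_betw[OF assms, of "\<lambda>j. A $ j $ map_permutation UNIV \<pi> p j"]
      by (simp add: app)
    ultimately show "of_int (sign (map_permutation UNIV \<pi> p)) * (\<Prod>i\<in>UNIV. A $ i $ map_permutation UNIV \<pi> p i) =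
      of_int (sign p) * (\<Prod>i\<in>UNIV. (\<chi> i j. A $ \<pi> i $ \<pi> j) $ i $ p i)"
      by simp
  next
    fix p :: "'k \<Rightarrow> 'k" assume "p \<in> {p. p permutes UNIV}"
    then have p: "p permutes UNIV" by simp
    show "map_permutation UNIV \<pi> (map_permutation UNIV (inv \<pi>) p) = p"
      using p assms inv by (intro map_permutation_compose_inv[where B = UNIV]) (auto simp: bij_imp_bij_inv)
    show "map_permutation UNIV (inv \<pi>) p \<in> {p. p permutes UNIV}"
      using map_permutation_permutes[OF bij_imp_bij_inv[OF assms] p] by simp
  qed
qed

text \<open>The value of \<open>sinh\<^sup>2 (d(0, \<xi>))\<close> for \<open>\<xi> = tg_sub a M\<close>.\<close>
definition tg_sinh2 :: "real^'n \<Rightarrow> real^'k^'n \<Rightarrow> real" where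
  "tg_sinh2 a M = 4 * (infdist a (range ((*v) M)))\<^sup>2 / (1 - (norm a)\<^sup>2)\<^sup>2"

lemma tg_sinh2_nonneg: "0 \<le> tg_sinh2 a M"
  by (simp add: tg_sinh2_def)

text \<open>Pythagoras: \<open>Q (adjoint Q a)\<close> is the orthogonal projection of a onto the
  range.\<close>

lemma infdist_range_isometry:
  fixes Q :: "'a::euclidean_space \<Rightarrow> 'b::euclidean_space"
  assumes "linear Q" "\<And>x. norm (Q x) = norm x"
  shows "(infdist a (range Q))\<^sup>2 = (norm a)\<^sup>2 - (norm (adjoint Q a))\<^sup>2"
proof -
  define b where "b = adjoint Q a"
  have adj: "a \<bullet> Q x = b \<bullet> x" for x
    using adjoint_works[OF assms(1), of x a] by (simp add: b_def inner_commute)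
  have dist: "(dist a (Q x))\<^sup>2 = (norm a)\<^sup>2 - (norm b)\<^sup>2 + (norm (b - x))\<^sup>2" for x
  proof -
    have "(dist a (Q x))\<^sup>2 = (norm a)\<^sup>2 - 2 * (a \<bullet> Q x) + (norm (Q x))\<^sup>2"
      by (simp add: dist_norm power2_norm_eq_inner inner_diff_left inner_diff_right inner_commute)
    also have "\<dots> = (norm a)\<^sup>2 - 2 * (b \<bullet> x) + (norm x)\<^sup>2"
      by (simp add: adj assms(2))
    also have "\<dots> = (norm a)\<^sup>2 - (norm b)\<^sup>2 + (norm (b - x))\<^sup>2"
      by (simp add: power2_norm_eq_inner inner_diff_left inner_diff_right inner_commute)
    finally show ?thesis .
  qed
  have "infdist a (range Q) = dist a (Q b)"
  proof (rule antisym)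
    show "infdist a (range Q) \<le> dist a (Q b)"
      by (rule infdist_le) simp
    have "dist a (Q b) \<le> dist a (Q x)" for x
      by (rule power2_le_imp_le) (simp_all add: dist)
    then show "dist a (Q b) \<le> infdist a (range Q)"
      by (auto simp: infdist_def intro!: cINF_greatest)
  qed
  then show ?thesis
    using dist[of b] by (simp add: b_def)
qed

lemma norm_adjoint_isometry_le:
  fixes Q :: "'a::euclidean_space \<Rightarrow> 'b::euclidean_space"
  assumes "linear Q" "\<And>x. norm (Q x) = norm x"
  shows "norm (adjoint Q a) \<le> norm a"
proof -
  have "(norm (adjoint Q a))\<^sup>2 \<le> (norm a)\<^sup>2"
    using infdist_range_isometry[OF assms, of a] zero_le_power2[of "infdist a (range Q)"] by linarith
  then show ?thesis by (rule power2_le_imp_le) simp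
qed

text \<open>In the hyperboloid model \<open>cosh d(0, \<cdot>)\<close> restricted to the geodesic subspace is a linear
  functional; the Moebius translation by \<open>c\<close> is the Lorentz boost that moves its minimum to the origin.\<close>
lemma mobius_recentre:
  fixes Q :: "real^'m \<Rightarrow> real^'n"
  assumes "linear Q" "\<And>x. norm (Q x) = norm x" and a: "norm a < 1"
  obtains c where "norm c < 1" "\<And>v. norm v < 1 \<Longrightarrow>
    1 + sinh2 (norm (mobius_tr a (Q v))) =
      (1 + 4 * (infdist a (range Q))\<^sup>2 / (1 - (norm a)\<^sup>2)\<^sup>2) * (1 + sinh2 (norm (mobius_tr c v)))"
proof -
  define b where "b = adjoint Q a"
  define \<beta> A where "\<beta> = (norm b)\<^sup>2" and "A = (norm a)\<^sup>2"
  have adj: "a \<bullet> Q x = b \<bullet> x" for x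
    using adjoint_works[OF assms(1), of x a] by (simp add: b_def inner_commute)
  have A: "0 \<le> A" "A < 1" using power2_norm_less_1[OF a] by (auto simp: A_def)
  have \<beta>: "0 \<le> \<beta>" "\<beta> \<le> A"
    using norm_adjoint_isometry_le[OF assms(1,2), of a] by (auto simp: \<beta>_def A_def b_def power_mono)
  have S: "(infdist a (range Q))\<^sup>2 = A - \<beta>"
    using infdist_range_isometry[OF assms(1,2)] by (simp add: A_def \<beta>_def b_def)
  define q where "q = (1 + A) / 2"
  have "q\<^sup>2 - A = ((1 - A) / 2)\<^sup>2"
    by (simp add: q_def power2_eq_square field_simps)
  then have "q\<^sup>2 > A"
    using A by (smt (verit) zero_less_power2 divide_pos_pos)
  then have q\<beta>: "q\<^sup>2 - \<beta> > 0" using \<beta> by simp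
  \<comment> \<open>By \<open>mobius_cosh\<close>, cosh for c is governed by (1 + |c|^2)(1 + X) + 4
    c . v and for a by (1 + A)(1 + X) + 4 b . v. They are proportional if c = b / w with w^2 +
    \<beta> = (1 + A) w; the larger root makes |c| < 1.\<close>
  define w where "w = q + sqrt (q\<^sup>2 - \<beta>)"
  have q: "q > 0" using A by (simp add: q_def)
  have w: "w > q" "w\<^sup>2 + \<beta> = 2 * q * w"
    using q\<beta> by (auto simp: w_def power2_eq_square algebra_simps)
  have w0: "w > 0" using w q by linarith
  define c where "c = (1 / w) *\<^sub>R b"
  have nc: "(norm c)\<^sup>2 = \<beta> / w\<^sup>2"
    by (simp add: c_def \<beta>_def power_divide)
  have "\<beta> < w\<^sup>2"
    using q\<beta> w q power_strict_mono[of q w 2] by simp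
  then have c1: "norm c < 1"
    using w0 nc abs_square_less_1[of "norm c"] by simp
  have opc: "1 + (norm c)\<^sup>2 = (1 + A) / w"
  proof -
    have "1 + \<beta> / w\<^sup>2 = (w\<^sup>2 + \<beta>) / w\<^sup>2"
      using w0 by (simp add: add_divide_distrib)
    also have "w\<^sup>2 + \<beta> = (1 + A) * w"
    proof -
      have "2 * q = 1 + A" by (simp add: q_def)
      with w(2) show ?thesis by simp
    qed
    finally show ?thesis
      unfolding nc using w0 by (simp add: power2_eq_square)
  qed
  have omc: "(1 - (norm c)\<^sup>2)\<^sup>2 = ((1 + A)\<^sup>2 - 4 * \<beta>) / w\<^sup>2"
  proof -
    have "(1 - (norm c)\<^sup>2)\<^sup>2 = (1 + (norm c)\<^sup>2)\<^sup>2 - 4 * (norm c)\<^sup>2"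
      by algebra
    then show ?thesis
      unfolding opc unfolding nc by (simp add: power_divide diff_divide_distrib)
  qed
  show ?thesis
  proof (rule that[OF c1])
    fix v :: "real^'m" assume v: "norm v < 1"
    define X t where "X = (norm v)\<^sup>2" and "t = b \<bullet> v"
    have X: "X < 1" using power2_norm_less_1[OF v] by (simp add: X_def)
    have e1: "1 + sinh2 (norm (mobius_tr a (Q v))) = (((1 + A) * (1 + X) + 4 * t) / ((1 - A) * (1 - X)))\<^sup>2"
      using a v norm_mobius_tr_less_1[of a "Q v"] mobius_cosh[of a "Q v"]
      by (simp add: one_plus_sinh2 assms(2) A_def X_def t_def adj)
    have e2: "1 + sinh2 (norm (mobius_tr c v)) =
        (((1 + A) / w * (1 + X) + 4 * (t / w)) / ((1 - (norm c)\<^sup>2) * (1 - X)))\<^sup>2"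
    proof -
      have "c \<bullet> v = t / w" by (simp add: c_def t_def)
      then show ?thesis
        using c1 v norm_mobius_tr_less_1[of c v] mobius_cosh[of c v]
        by (simp add: one_plus_sinh2 X_def opc)
    qed
    have e3: "((1 + A) / w * (1 + X) + 4 * (t / w)) / ((1 - (norm c)\<^sup>2) * (1 - X)) =
       ((1 + A) * (1 + X) + 4 * t) / (w * (1 - (norm c)\<^sup>2) * (1 - X))"
    proof -
      have "P / w * Y + 4 * (t / w) = (P * Y + 4 * t) / w" for P Y
        by (simp add: add_divide_distrib)
      then show ?thesis by (simp only: divide_divide_eq_left mult.assoc)
    qed
    have e4: "(w * (1 - (norm c)\<^sup>2) * (1 - X))\<^sup>2 = ((1 + A)\<^sup>2 - 4 * \<beta>) * (1 - X)\<^sup>2"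
      unfolding power_mult_distrib omc using w0 by simp
    \<comment> \<open>The quotient on the right is the squared ratio of the two cosh functionals; it
      equals 1 + S, the squared cosh of the distance to the subspace.\<close>
    have e5: "1 + 4 * (A - \<beta>) / (1 - A)\<^sup>2 = ((1 + A)\<^sup>2 - 4 * \<beta>) / (1 - A)\<^sup>2"
    proof -
      have "(1 + A)\<^sup>2 - 4 * \<beta> = (1 - A)\<^sup>2 + 4 * (A - \<beta>)" by algebra
      then have "((1 + A)\<^sup>2 - 4 * \<beta>) / (1 - A)\<^sup>2 = (1 - A)\<^sup>2 / (1 - A)\<^sup>2 + 4 * (A - \<beta>) / (1 - A)\<^sup>2"
        by (simp only: add_divide_distrib)
      then show ?thesis using A by simp
    qed
    have e6: "(1 + A)\<^sup>2 - 4 * \<beta> > 0"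
      using q\<beta> by (simp add: q_def power_divide)
    show "1 + sinh2 (norm (mobius_tr a (Q v))) =
      (1 + 4 * (infdist a (range Q))\<^sup>2 / (1 - (norm a)\<^sup>2)\<^sup>2) * (1 + sinh2 (norm (mobius_tr c v)))"
      unfolding S A_def[symmetric] e1 e2 e3 e5 power_divide e4
      using e6 by (simp add: power_mult_distrib)
  qed
qed

text \<open>A radial function sees \<open>mobius_tr a\<close> only through \<open>sinh2\<close> of a
  norm, and \<open>mobius_recentre\<close> expresses this by a translation c of the ball in
  dimension m. Thus the change of variables takes place between spaces of equal dimension.\<close>

lemma radial_integral_wellorder:
  fixes M :: "real^'m::{finite,wellorder}^'n"
  assumes a: "norm a < 1" and G: "det (transpose M ** M) \<noteq> 0"
    and [measurable]: "F \<in> borel_measurable borel" and F: "\<And>x. 0 \<le> F x"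
  shows "(\<integral>\<^sup>+u\<in>{u. norm (M *v u) < 1}. ennreal (F (sinh2 (norm (mobius_tr a (M *v u)))) *
        (2 / (1 - (norm (M *v u))\<^sup>2)) ^ CARD('m) * sqrt (det (transpose M ** M))) \<partial>lborel) =
    (\<integral>\<^sup>+w\<in>{w::real^'m::_. norm w < 1}. ennreal (F (tg_sinh2 a M + (1 + tg_sinh2 a M) * sinh2 (norm w)) *
        (2 / (1 - (norm w)\<^sup>2)) ^ CARD('m)) \<partial>lborel)"
proof -
  obtain Q and N :: "real^'m::_^'m::_" where Q: "linear Q" "\<And>x. norm (Q x) = norm x"
    "range Q = range ((*v) M)" "\<And>u. M *v u = Q (N *v u)" "det N \<noteq> 0"
    "sqrt (det (transpose M ** M)) = \<bar>det N\<bar>"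
    using linear_factor_isometry[OF G] by blast
  obtain c where c: "norm c < 1" "\<And>v. norm v < 1 \<Longrightarrow>
    1 + sinh2 (norm (mobius_tr a (Q v))) = (1 + tg_sinh2 a M) * (1 + sinh2 (norm (mobius_tr c v)))"
    using mobius_recentre[OF Q(1,2) a] unfolding tg_sinh2_def Q(3)[symmetric] by blast
  let ?F = "\<lambda>x. F (tg_sinh2 a M + (1 + tg_sinh2 a M) * x)"
  have eq: "sinh2 (norm (mobius_tr a (Q v))) =
      tg_sinh2 a M + (1 + tg_sinh2 a M) * sinh2 (norm (mobius_tr c v))" if "norm v < 1" for v
    using c(2)[OF that] by (simp add: algebra_simps)
  have "(\<integral>\<^sup>+u\<in>{u. norm (M *v u) < 1}. ennreal (F (sinh2 (norm (mobius_tr a (M *v u)))) *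
        (2 / (1 - (norm (M *v u))\<^sup>2)) ^ CARD('m) * sqrt (det (transpose M ** M))) \<partial>lborel) =
    (\<integral>\<^sup>+u\<in>{u. norm (N *v u) < 1}. ennreal (?F (sinh2 (norm (mobius_tr c (N *v u)))) *
        (2 / (1 - (norm (N *v u))\<^sup>2)) ^ CARD('m) * \<bar>det N\<bar>) \<partial>lborel)"
    unfolding Q(4,6) Q(2) by (intro nn_integral_cong) (auto simp: indicator_def eq)
  also have "\<dots> = (\<integral>\<^sup>+w\<in>{w::real^'m::_. norm w < 1}. ennreal (?F (sinh2 (norm w)) *
        (2 / (1 - (norm w)\<^sup>2)) ^ CARD('m)) \<partial>lborel)"
    using c(1) Q(5) F by (intro nn_integral_mobius_linear) auto
  finally show ?thesis .
qed

lemma tg_sinh2_minimum: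
  fixes M :: "real^'k^'n"
  assumes a: "norm a < 1" and G: "det (transpose M ** M) \<noteq> 0"
  shows "\<exists>x. norm x < 1 \<and> x \<in> range ((*v) M) \<and> sinh2 (norm (mobius_tr a x)) = tg_sinh2 a M"
    and "\<And>x. norm x < 1 \<Longrightarrow> x \<in> range ((*v) M) \<Longrightarrow> tg_sinh2 a M \<le> sinh2 (norm (mobius_tr a x))"
proof -
  obtain Q and N :: "real^'k^'k" where Q: "linear Q" "\<And>x. norm (Q x) = norm x"
    "range Q = range ((*v) M)" "\<And>u. M *v u = Q (N *v u)" "det N \<noteq> 0"
    "sqrt (det (transpose M ** M)) = \<bar>det N\<bar>"
    using linear_factor_isometry[OF G] by blast
  obtain c where c: "norm c < 1" "\<And>v. norm v < 1 \<Longrightarrow>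
    1 + sinh2 (norm (mobius_tr a (Q v))) = (1 + tg_sinh2 a M) * (1 + sinh2 (norm (mobius_tr c v)))"
    using mobius_recentre[OF Q(1,2) a] unfolding tg_sinh2_def Q(3)[symmetric] by blast
  \<comment> \<open>The foot of the perpendicular from the origin is the point that the recentring
    translation sends to 0.\<close>
  define v where "v = mobius_tr (- c) 0"
  have v: "norm v < 1" "mobius_tr c v = 0"
    using c(1) norm_mobius_tr_less_1[of "- c" 0] mobius_tr_inverse[of "- c" 0] by (auto simp: v_def)
  have "norm (Q v) < 1 \<and> Q v \<in> range ((*v) M) \<and> sinh2 (norm (mobius_tr a (Q v))) = tg_sinh2 a M"
    using v c(2)[of v] Q by (auto simp: sinh2_def)
  then show "\<exists>x. norm x < 1 \<and> x \<in> range ((*v) M) \<and> sinh2 (norm (mobius_tr a x)) = tg_sinh2 a M"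
    by blast
  fix x assume x: "norm x < 1" "x \<in> range ((*v) M)"
  then obtain y where y: "x = Q y" using Q(3) by blast
  have "1 + tg_sinh2 a M \<le> (1 + tg_sinh2 a M) * (1 + sinh2 (norm (mobius_tr c y)))"
    using tg_sinh2_nonneg[of a M] by (simp add: algebra_simps)
  also have "\<dots> = 1 + sinh2 (norm (mobius_tr a x))"
    using c(2)[of y] x y Q by simp
  finally show "tg_sinh2 a M \<le> sinh2 (norm (mobius_tr a x))" by simp
qed

section \<open>Distances, weights and radial integrals in the variable sinh^2 d\<close>

lemma hball_iff: "x \<in> hball \<longleftrightarrow> norm x < 1"
  by (simp add: hball_def)

lemma sinh_cosh_hdist0:
  assumes "norm x < 1"
  shows "sinh (hdist0 x) = sqrt (sinh2 (norm x))" "cosh (hdist0 x) = sqrt (1 + sinh2 (norm x))"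
proof -
  define r where "r = norm x"
  have r: "0 \<le> r" "r < 1" and r2: "r\<^sup>2 < 1"
    using assms power2_norm_less_1 by (auto simp: r_def)
  define z where "z = (1 + r) / (1 - r)"
  have z: "z > 0" using r by (simp add: z_def)
  have h: "hdist0 x = ln z"
    by (simp add: hdist0_def artanh_def r_def z_def)
  have e: "1 - r\<^sup>2 = (1 - r) * (1 + r)" by (simp add: power2_eq_square algebra_simps)
  have "sinh (hdist0 x) = (z - inverse z) / 2"
    unfolding h using z by (simp add: sinh_ln_real)
  also have "\<dots> = 2 * r / (1 - r\<^sup>2)"
    unfolding e z_def using r by (simp add: divide_simps) (simp add: algebra_simps)
  also have "\<dots> = sqrt (sinh2 r)"
    using r r2 by (simp add: sinh2_def real_sqrt_divide real_sqrt_mult)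
  finally show "sinh (hdist0 x) = sqrt (sinh2 (norm x))" by (simp add: r_def)
  have "cosh (hdist0 x) = (z + inverse z) / 2"
    unfolding h using z by (simp add: cosh_ln_real)
  also have "\<dots> = (1 + r\<^sup>2) / (1 - r\<^sup>2)"
    unfolding e z_def using r by (simp add: divide_simps) (simp add: algebra_simps power2_eq_square)
  also have "\<dots> = sqrt (1 + sinh2 r)"
    using r r2 by (simp add: one_plus_sinh2)
  finally show "cosh (hdist0 x) = sqrt (1 + sinh2 (norm x))" by (simp add: r_def)
qed

text \<open>\<open>tg_sinh2_minimum\<close> shows that sinh^2 of the distance attains its minimum on
  the subspace; sinh is increasing, so the infimum in \<open>dist0_tg\<close> is attained at the
  same point.\<close>

lemma sinh_cosh_dist0_tg:
  fixes M :: "real^'k^'n"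
  assumes a: "norm a < 1" and G: "det (transpose M ** M) \<noteq> 0"
  shows "sinh (dist0_tg a M) = sqrt (tg_sinh2 a M)" "cosh (dist0_tg a M) = sqrt (1 + tg_sinh2 a M)"
proof -
  obtain x where x: "norm x < 1" "x \<in> range ((*v) M)" "sinh2 (norm (mobius_tr a x)) = tg_sinh2 a M"
    using tg_sinh2_minimum(1)[OF assms] by blast
  have n: "norm (mobius_tr a y) < 1" if "norm y < 1" for y
    using norm_mobius_tr_less_1[OF a that] .
  have "dist0_tg a M = hdist0 (mobius_tr a x)"
    unfolding dist0_tg_def
  proof (rule cInf_eq_minimum)
    show "hdist0 (mobius_tr a x) \<in> hdist0 ` tg_sub a M"
      using x by (auto simp: tg_sub_def hball_iff)
    fix d assume "d \<in> hdist0 ` tg_sub a M"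
    then obtain y where y: "norm y < 1" "y \<in> range ((*v) M)" "d = hdist0 (mobius_tr a y)"
      by (auto simp: tg_sub_def hball_iff)
    have "sinh (hdist0 (mobius_tr a x)) \<le> sinh d"
      using tg_sinh2_minimum(2)[OF assms y(1,2)] x y by (simp add: sinh_cosh_hdist0 n)
    then show "hdist0 (mobius_tr a x) \<le> d" by simp
  qed
  then show "sinh (dist0_tg a M) = sqrt (tg_sinh2 a M)" "cosh (dist0_tg a M) = sqrt (1 + tg_sinh2 a M)"
    using sinh_cosh_hdist0[OF n[OF x(1)]] x(3) by simp_all
qed

lemma hdist0_powr:
  assumes "norm x < 1"
  shows "sinh (hdist0 x) powr a = sinh2 (norm x) powr (a / 2)"
    "cosh (hdist0 x) powr a = (1 + sinh2 (norm x)) powr (a / 2)"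
  using assms by (simp_all add: sinh_cosh_hdist0 powr_half_sqrt[symmetric] powr_powr add_nonneg_nonneg)

lemma dist0_tg_powr:
  fixes M :: "real^'k^'n"
  assumes a: "norm a < 1" and G: "det (transpose M ** M) \<noteq> 0"
  shows "sinh (dist0_tg a M) powr b = tg_sinh2 a M powr (b / 2)"
    "cosh (dist0_tg a M) powr b = (1 + tg_sinh2 a M) powr (b / 2)"
  using sinh_cosh_dist0_tg[OF assms] tg_sinh2_nonneg[of a M]
  by (simp_all add: powr_half_sqrt[symmetric] powr_powr add_nonneg_nonneg)

lemma param_dom_borel [measurable]: "param_dom M \<in> sets borel"
  unfolding param_dom_def hball_iff
  by (intro borel_open open_Collect_less continuous_intros linear_continuous_on
      matrix_vector_mul_bounded_linear)

text \<open>Transport to the well-ordered index type changes neither the range of M, hence not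
  \<open>tg_sinh2\<close>, nor the Gram determinant; recentring and polar coordinates in dimension k
  then give a one-dimensional integral.\<close>

lemma radial_integral:
  fixes M :: "real^'k^'n"
  assumes a: "norm a < 1" and G: "det (transpose M ** M) \<noteq> 0"
    and [measurable]: "F \<in> borel_measurable borel" and F: "\<And>x. 0 \<le> F x"
  shows "(\<integral>\<^sup>+u\<in>param_dom M. ennreal (F (sinh2 (norm (mobius_tr a (M *v u)))) *
        (2 / (1 - (norm (M *v u))\<^sup>2)) ^ CARD('k) * sqrt (det (transpose M ** M))) \<partial>lborel) =
    ennreal (polar_const TYPE(real^'k idx)) *
    (\<integral>\<^sup>+x\<in>{0<..}. ennreal (F (tg_sinh2 a M + (1 + tg_sinh2 a M) * x) * x powr (CARD('k) / 2 - 1) *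
       (1 + x) powr (-1/2)) \<partial>lborel)"
proof -
  obtain \<pi> :: "'k idx \<Rightarrow> 'k" where \<pi>: "bij \<pi>"
    using finite_same_card_bij[of "UNIV :: 'k idx set" "UNIV :: 'k set"] by (auto simp: card_idx)
  have inv: "\<pi> (inv \<pi> j) = j" "inv \<pi> (\<pi> i) = i" for i j
    using \<pi> by (simp_all add: bij_is_surj surj_f_inv_f bij_is_inj)
  define P where "P = (\<lambda>u. \<chi> j. u $ inv \<pi> j :: real^'k)"
  define N where "N = (\<chi> i j. M $ i $ \<pi> j)"
  have MP: "M *v P u = N *v u" for u
    using sum.reindex_bij_betw[OF \<pi>, of "\<lambda>j. M $ i $ j * u $ inv \<pi> j" for i]
    by (simp add: vec_eq_iff matrix_vector_mult_def P_def N_def inv)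
  have "surj P"
    by (rule surjI[of _ "\<lambda>v. \<chi> i. v $ \<pi> i"]) (simp add: P_def inv vec_eq_iff)
  then have range: "range ((*v) N) = range ((*v) M)"
    using MP by (auto simp: image_iff) (metis surj_def)+
  have "transpose N ** N = (\<chi> i j. (transpose M ** M) $ \<pi> i $ \<pi> j)"
    by (simp add: vec_eq_iff matrix_matrix_mult_def transpose_def N_def)
  then have det: "det (transpose N ** N) = det (transpose M ** M)"
    using det_relabel[OF \<pi>] by simp
  have S: "tg_sinh2 a N = tg_sinh2 a M"
    by (simp add: tg_sinh2_def range)
  let ?h = "\<lambda>u. ennreal (F (sinh2 (norm (mobius_tr a (M *v u)))) *
        (2 / (1 - (norm (M *v u))\<^sup>2)) ^ CARD('k) * sqrt (det (transpose M ** M))) * indicator (param_dom M) u"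
  have "(\<integral>\<^sup>+u. ?h u \<partial>lborel) = (\<integral>\<^sup>+u. ?h (P u) \<partial>lborel)"
    unfolding P_def by (rule nn_integral_lborel_relabel[OF \<pi>]) measurable
  also have "\<dots> = (\<integral>\<^sup>+u\<in>{u. norm (N *v u) < 1}. ennreal (F (sinh2 (norm (mobius_tr a (N *v u)))) *
        (2 / (1 - (norm (N *v u))\<^sup>2)) ^ CARD('k idx) * sqrt (det (transpose N ** N))) \<partial>lborel)"
    by (intro nn_integral_cong) (simp add: MP det card_idx param_dom_def hball_iff indicator_def)
  also have "\<dots> = (\<integral>\<^sup>+w\<in>{w::real^'k idx. norm w < 1}. ennreal (F (tg_sinh2 a M + (1 + tg_sinh2 a M) * sinh2 (norm w)) *
        (2 / (1 - (norm w)\<^sup>2)) ^ CARD('k idx)) \<partial>lborel)"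
    unfolding S[symmetric] by (rule radial_integral_wellorder[OF a]) (use G det F in auto)
  also have "\<dots> = ennreal (polar_const TYPE(real^'k idx)) *
    (\<integral>\<^sup>+x\<in>{0<..}. ennreal (F (tg_sinh2 a M + (1 + tg_sinh2 a M) * x) * x powr (CARD('k) / 2 - 1) *
       (1 + x) powr (-1/2)) \<partial>lborel)"
    using nn_integral_hyperbolic_polar[where 'a = "real^'k idx", of "\<lambda>x. F (tg_sinh2 a M + (1 + tg_sinh2 a M) * x)"] F
    by (simp add: card_idx)
  finally show ?thesis .
qed

text \<open>The index \<open>undefined\<close> selects some coordinate axis; for a radial f every
  unit vector gives the same values.\<close>

definition profile :: "(real^'n \<Rightarrow> real) \<Rightarrow> real \<Rightarrow> real" where
  "profile f x = f (sinh2_inv x *\<^sub>R axis undefined 1)"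

lemma profile_measurable:
  assumes [measurable]: "f \<in> borel_measurable borel"
  shows "profile f \<in> borel_measurable borel"
  unfolding profile_def by measurable

lemma radial_profile:
  fixes f :: "real^'n \<Rightarrow> real"
  assumes "radial f" "norm x < 1"
  shows "f x = profile f (sinh2 (norm x))"
proof -
  define y :: "real^'n" where "y = sinh2_inv (sinh2 (norm x)) *\<^sub>R axis undefined 1"
  have "norm y = norm x"
    using assms(2) by (simp add: y_def sinh2_inv_sinh2 norm_axis_1)
  then have "hdist0 x = hdist0 y" "x \<in> hball" "y \<in> hball"
    using assms(2) by (simp_all add: hdist0_def hball_iff)
  then have "f x = f y"
    using assms(1) unfolding radial_def by blast
  then show ?thesis
    by (simp add: profile_def y_def)
qed

lemma Lp_weighted_pow_radial:
  fixes f :: "real^'n \<Rightarrow> real"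
  assumes [measurable]: "f \<in> borel_measurable borel" and "radial f"
  shows "Lp_weighted_pow p a1 a2 f = ennreal (polar_const TYPE(real^'n)) *
    (\<integral>\<^sup>+x\<in>{0<..}. ennreal (\<bar>profile f x\<bar> powr p * x powr ((a1 + CARD('n)) / 2 - 1) *
       (1 + x) powr ((a2 - 1) / 2)) \<partial>lborel)"
proof -
  note [measurable] = profile_measurable[OF assms(1)]
  let ?G = "\<lambda>x. \<bar>profile f x\<bar> powr p * x powr (a1 / 2) * (1 + x) powr (a2 / 2)"
  have "Lp_weighted_pow p a1 a2 f = (\<integral>\<^sup>+w\<in>{w::real^'n. norm w < 1}.
        ennreal (?G (sinh2 (norm w)) * (2 / (1 - (norm w)\<^sup>2)) ^ CARD('n)) \<partial>lborel)"
    unfolding Lp_weighted_pow_def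
    by (intro nn_integral_cong)
      (auto simp: indicator_def hball_iff hdist0_powr hvol_density_def radial_profile[OF assms(2)])
  also have "\<dots> = ennreal (polar_const TYPE(real^'n)) *
     (\<integral>\<^sup>+x\<in>{0<..}. ennreal (?G x * x powr (CARD('n) / 2 - 1) * (1 + x) powr (-1/2)) \<partial>lborel)"
    using nn_integral_hyperbolic_polar[where 'a = "real^'n", of ?G] by simp
  also have "(\<integral>\<^sup>+x\<in>{0<..}. ennreal (?G x * x powr (CARD('n) / 2 - 1) * (1 + x) powr (-1/2)) \<partial>lborel) =
    (\<integral>\<^sup>+x\<in>{0<..}. ennreal (\<bar>profile f x\<bar> powr p * x powr ((a1 + CARD('n)) / 2 - 1) *
       (1 + x) powr ((a2 - 1) / 2)) \<partial>lborel)"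
  proof (intro nn_integral_cong)
    fix x :: real
    have "x powr (a1 / 2) * x powr (CARD('n) / 2 - 1) = x powr ((a1 + CARD('n)) / 2 - 1)"
      "(1 + x) powr (a2 / 2) * (1 + x) powr (-1/2) = (1 + x) powr ((a2 - 1) / 2)"
      by (simp_all add: powr_add[symmetric] field_simps)
    moreover have "?G x * x powr (CARD('n) / 2 - 1) * (1 + x) powr (-1/2) = \<bar>profile f x\<bar> powr p *
        (x powr (a1 / 2) * x powr (CARD('n) / 2 - 1)) * ((1 + x) powr (a2 / 2) * (1 + x) powr (-1/2))"
      by (simp only: mult_ac)
    ultimately show "ennreal (?G x * x powr (CARD('n) / 2 - 1) * (1 + x) powr (-1/2)) * indicator {0<..} x =
      ennreal (\<bar>profile f x\<bar> powr p * x powr ((a1 + CARD('n)) / 2 - 1) * (1 + x) powr ((a2 - 1) / 2)) * indicator {0<..} x"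
      by (simp only:)
  qed
  finally show ?thesis .
qed

lemma Rk_integrand_measurable:
  fixes M :: "real^'k^'n"
  assumes [measurable]: "f \<in> borel_measurable borel"
  shows "Rk_integrand f a M \<in> borel_measurable borel"
  unfolding Rk_integrand_def[abs_def] by measurable

lemma det_gram_nonneg:
  fixes M :: "real^'k^'n"
  assumes "det (transpose M ** M) \<noteq> 0"
  shows "0 \<le> det (transpose M ** M)"
proof -
  obtain Q :: "real^'k \<Rightarrow> real^'n" and N :: "real^'k^'k"
    where "sqrt (det (transpose M ** M)) = \<bar>det N\<bar>"
    using linear_factor_isometry[OF assms] by metis
  then show ?thesis by (metis abs_ge_zero real_sqrt_ge_0_iff)
qed

lemma nn_integral_abs_Rk_integrand:
  fixes M :: "real^'k^'n"
  assumes [measurable]: "f \<in> borel_measurable borel" and "radial f"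
    and a: "norm a < 1" and G: "det (transpose M ** M) \<noteq> 0"
  shows "(\<integral>\<^sup>+u\<in>param_dom M. ennreal \<bar>Rk_integrand f a M u\<bar> \<partial>lborel) =
    ennreal (polar_const TYPE(real^'k idx)) *
    (\<integral>\<^sup>+x\<in>{0<..}. ennreal (\<bar>profile f (tg_sinh2 a M + (1 + tg_sinh2 a M) * x)\<bar> *
       x powr (CARD('k) / 2 - 1) * (1 + x) powr (-1/2)) \<partial>lborel)"
proof -
  note [measurable] = profile_measurable[OF assms(1)]
  have "(\<integral>\<^sup>+u\<in>param_dom M. ennreal \<bar>Rk_integrand f a M u\<bar> \<partial>lborel) =
    (\<integral>\<^sup>+u\<in>param_dom M. ennreal (\<bar>profile f (sinh2 (norm (mobius_tr a (M *v u))))\<bar> *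
        (2 / (1 - (norm (M *v u))\<^sup>2)) ^ CARD('k) * sqrt (det (transpose M ** M))) \<partial>lborel)"
  proof (rule nn_integral_cong)
    fix u
    show "ennreal \<bar>Rk_integrand f a M u\<bar> * indicator (param_dom M) u =
      ennreal (\<bar>profile f (sinh2 (norm (mobius_tr a (M *v u))))\<bar> *
        (2 / (1 - (norm (M *v u))\<^sup>2)) ^ CARD('k) * sqrt (det (transpose M ** M))) * indicator (param_dom M) u"
    proof (cases "u \<in> param_dom M")
      case True
      then have u: "norm (M *v u) < 1" by (simp add: param_dom_def hball_iff)
      have "0 \<le> det (transpose M ** M)"
        using det_gram_nonneg[OF G] .
      with u power2_norm_less_1[OF u] radial_profile[OF assms(2) norm_mobius_tr_less_1[OF a u]] show ?thesis
        by (simp add: Rk_integrand_def abs_mult)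
    qed simp
  qed
  also have "\<dots> = ennreal (polar_const TYPE(real^'k idx)) *
    (\<integral>\<^sup>+x\<in>{0<..}. ennreal (\<bar>profile f (tg_sinh2 a M + (1 + tg_sinh2 a M) * x)\<bar> *
       x powr (CARD('k) / 2 - 1) * (1 + x) powr (-1/2)) \<partial>lborel)"
    by (rule radial_integral[OF a G]) auto
  finally show ?thesis .
qed

section \<open>Sufficiency\<close>

definition radon_1d :: "real \<Rightarrow> real \<Rightarrow> (real \<Rightarrow> real) \<Rightarrow> ennreal" where
  "radon_1d k S F =
     (\<integral>\<^sup>+x\<in>{0<..}. ennreal (F (S + (1 + S) * x) * x powr (k / 2 - 1) * (1 + x) powr (-1/2)) \<partial>lborel)"

text \<open>For A = (a1 + n) / 2 and B = (a2 - 1) / 2 this is the p-th power of the weighted norm up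
  to \<open>polar_const\<close>. The dimensions enter only as real parameters from here on.\<close>

definition norm_1d :: "real \<Rightarrow> real \<Rightarrow> real \<Rightarrow> (real \<Rightarrow> real) \<Rightarrow> ennreal" where
  "norm_1d p A B F = (\<integral>\<^sup>+x\<in>{0<..}. ennreal (F x powr p * x powr (A - 1) * (1 + x) powr B) \<partial>lborel)"

text \<open>The density of \<open>norm_1d\<close> pulled back along T = S + (1 + S) x; the leading 1
  + S is the Jacobian.\<close>

definition shifted_weight :: "real \<Rightarrow> real \<Rightarrow> real \<Rightarrow> real \<Rightarrow> real" where
  "shifted_weight A B S x = (1 + S) * (S + (1 + S) * x) powr (A - 1) * (1 + (S + (1 + S) * x)) powr B"

text \<open>The substitution T = S + (1 + S) x with x > 0 covers only T > S, whence an inequality: a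
  subspace sees f only outside the ball that it touches.\<close>

lemma norm_1d_ge_shifted:
  assumes [measurable]: "F \<in> borel_measurable borel" and F: "\<And>x. 0 \<le> F x" and S: "S > 0"
  shows "(\<integral>\<^sup>+x\<in>{0<..}. ennreal (F (S + (1 + S) * x) powr p * shifted_weight A B S x) \<partial>lborel) \<le> norm_1d p A B F"
proof -
  let ?h = "\<lambda>x. ennreal (F x powr p * x powr (A - 1) * (1 + x) powr B) * indicator {0<..} x"
  have "norm_1d p A B F = ennreal \<bar>1 + S\<bar> * (\<integral>\<^sup>+x. ?h (S + (1 + S) * x) \<partial>lborel)"
    unfolding norm_1d_def using S by (intro nn_integral_real_affine) auto
  also have "\<dots> = (\<integral>\<^sup>+x. ennreal (1 + S) * ?h (S + (1 + S) * x) \<partial>lborel)"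
    using S by (subst nn_integral_cmult) auto
  also have "\<dots> \<ge> (\<integral>\<^sup>+x\<in>{0<..}. ennreal (F (S + (1 + S) * x) powr p * shifted_weight A B S x) \<partial>lborel)"
  proof (rule nn_integral_mono)
    fix x :: real
    show "ennreal (F (S + (1 + S) * x) powr p * shifted_weight A B S x) * indicator {0<..} x \<le>
      ennreal (1 + S) * ?h (S + (1 + S) * x)"
    proof (cases "x > 0")
      case True
      then have "S + (1 + S) * x > 0" using S by (simp add: add_pos_pos)
      moreover have "ennreal (F (S + (1 + S) * x) powr p * shifted_weight A B S x) = ennreal (1 + S) *
          ennreal (F (S + (1 + S) * x) powr p * (S + (1 + S) * x) powr (A - 1) * (1 + (S + (1 + S) * x)) powr B)"
        by (subst ennreal_mult[symmetric]) (use S in \<open>auto simp: shifted_weight_def mult_ac\<close>)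
      ultimately show ?thesis using True by simp
    qed simp
  qed
  finally show ?thesis .
qed

text \<open>Logarithmic coordinates: with \<open>\<phi> = S/(1+S)\<close> and \<open>\<psi> = (\<phi>+x)/(1+x)\<close> every quantity in the
  kernel is a monomial in \<open>1+S\<close>, \<open>1+x\<close>, \<open>\<phi>\<close>, \<open>\<psi>\<close> and \<open>x\<close>.\<close>
lemma log_coordinates:
  fixes S x :: real
  assumes "S > 0" "x > 0"
  defines "\<phi> \<equiv> S / (1 + S)"
  defines "\<psi> \<equiv> (\<phi> + x) / (1 + x)"
  shows "0 < \<phi>" "\<phi> < 1" "0 < \<psi>" "ln \<phi> \<le> ln \<psi>" "ln \<psi> \<le> 0" "ln x \<le> ln (1 + x) + ln \<psi>"
    and "ln S = ln (1 + S) + ln \<phi>"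
    and "ln (S + (1 + S) * x) = ln (1 + S) + ln (1 + x) + ln \<psi>"
    and "ln (1 + (S + (1 + S) * x)) = ln (1 + S) + ln (1 + x)"
proof -
  show \<phi>: "0 < \<phi>" "\<phi> < 1" using assms(1,2) by (auto simp: \<phi>_def)
  show \<psi>: "0 < \<psi>" unfolding \<psi>_def using \<phi> assms(1,2) by (intro divide_pos_pos) auto
  have "\<phi> * x \<le> x" using \<phi> assms(1,2) by simp
  then have "\<phi> \<le> \<psi>" unfolding \<psi>_def using \<phi> assms(1,2) by (simp add: le_divide_eq algebra_simps)
  then show "ln \<phi> \<le> ln \<psi>" using \<phi> \<psi> by simp
  have "\<psi> \<le> 1" unfolding \<psi>_def using \<phi> assms(1,2) by (simp add: divide_le_eq)
  then show "ln \<psi> \<le> 0" using \<psi> by simp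
  have s: "1 + S > 0" "1 + x > 0" using assms(1,2) by auto
  have 1: "(1 + x) * \<psi> = \<phi> + x" using s by (simp add: \<psi>_def)
  have 2: "(1 + S) * \<phi> = S" using s by (simp add: \<phi>_def)
  have "x \<le> (1 + x) * \<psi>" unfolding 1 using \<phi> by simp
  then have "ln x \<le> ln ((1 + x) * \<psi>)" using assms(2) by (subst ln_le_cancel_iff) auto
  then show "ln x \<le> ln (1 + x) + ln \<psi>" using s \<psi> by (simp add: ln_mult)
  show "ln S = ln (1 + S) + ln \<phi>"
    using s \<phi> by (subst (1) 2[symmetric]) (simp add: ln_mult)
  have "S + (1 + S) * x = (1 + S) * ((1 + x) * \<psi>)"
    unfolding 1 using 2 by (simp add: distrib_left)
  then show "ln (S + (1 + S) * x) = ln (1 + S) + ln (1 + x) + ln \<psi>"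
    using s \<psi> by (simp add: ln_mult)
  have "1 + (S + (1 + S) * x) = (1 + S) * (1 + x)" by (simp add: algebra_simps)
  then show "ln (1 + (S + (1 + S) * x)) = ln (1 + S) + ln (1 + x)"
    using s by (simp add: ln_mult)
qed

lemma powr_eq_exp: "x > 0 \<Longrightarrow> x powr e = exp (e * ln (x::real))"
  by (simp add: powr_def)

text \<open>For p = 1 the dual exponent is infinite: the quotient of the kernel by
  \<open>shifted_weight\<close> is bounded pointwise by the reciprocal \<open>?W\<close> of the
  weight in the estimate.\<close>

lemma radon_1d_bound_p1:
  fixes k A B g1 g2 :: real
  assumes "k \<ge> 2" "0 \<le> g1" "2 * A - k \<le> g1" "g1 + g2 \<le> 2 * (A + B)" "k - 1 \<le> 2 * (A + B)"
    and [measurable]: "F \<in> borel_measurable borel" and F: "\<And>x. 0 \<le> F x" and S: "S > 0"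
  shows "radon_1d k S F \<le> ennreal (S powr (- (g1 / 2)) * (1 + S) powr (- (g2 / 2))) * norm_1d 1 A B F"
proof -
  let ?W = "S powr (- (g1 / 2)) * (1 + S) powr (- (g2 / 2))"
  have pt: "x powr (k / 2 - 1) * (1 + x) powr (-1/2) \<le> ?W * shifted_weight A B S x" if x: "x > 0" for x
  proof -
    define \<phi> where "\<phi> = S / (1 + S)"
    define \<psi> where "\<psi> = (\<phi> + x) / (1 + x)"
    note lc = log_coordinates[OF S x, folded \<phi>_def, folded \<psi>_def]
    define lx ly ls where "lx = ln x" and "ly = ln (1 + x)" and "ls = ln (1 + S)"
    define lf lp where "lf = ln \<phi>" and "lp = ln \<psi>"
    have pos: "S + (1 + S) * x > 0" "1 + (S + (1 + S) * x) > 0" "1 + S > 0" "1 + x > 0"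
      using S x by (auto simp: add_pos_pos)
    have l0: "0 \<le> ly" "0 \<le> ls" using S x by (auto simp: ly_def ls_def)
    \<comment> \<open>In logarithms the claim is linear. Each of \<open>f1\<close> to
      \<open>f5\<close> uses one of the five assumed inequalities on the exponents, and their sum is
      the claim.\<close>
    have f1: "(k / 2 - 1) * lx \<le> (k / 2 - 1) * (ly + lp)"
      using lc(6) assms(1) by (intro mult_left_mono) (auto simp: lx_def ly_def lp_def)
    have f2: "g1 / 2 * lf \<le> g1 / 2 * lp"
      using lc(4) assms(2) by (intro mult_left_mono) (auto simp: lf_def lp_def)
    have f3: "0 \<le> (A + B - (g1 + g2) / 2) * ls"
      using l0 assms by (intro mult_nonneg_nonneg) auto
    have f4: "(g1 / 2 + k / 2 - A) * lp \<le> 0"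
      using lc(5) assms by (intro mult_nonneg_nonpos) (auto simp: lp_def)
    have f5: "0 \<le> (A + B - (k - 1) / 2) * ly"
      using l0 assms by (intro mult_nonneg_nonneg) auto
    have "(k / 2 - 1) * lx + (-1/2) * ly \<le> - (g1 / 2) * (ls + lf) + - (g2 / 2) * ls +
        (ls + (A - 1) * (ls + ly + lp) + B * (ls + ly))"
      using f1 f2 f3 f4 f5 by (simp add: algebra_simps add_divide_distrib diff_divide_distrib)
    then have "exp ((k / 2 - 1) * lx) * exp ((-1/2) * ly) \<le> exp (- (g1 / 2) * (ls + lf)) * exp (- (g2 / 2) * ls) *
        (exp ls * exp ((A - 1) * (ls + ly + lp)) * exp (B * (ls + ly)))"
      by (simp only: exp_add[symmetric] exp_le_cancel_iff)
    then show ?thesis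
      unfolding shifted_weight_def powr_eq_exp[OF x] powr_eq_exp[OF S] powr_eq_exp[OF pos(1)]
        powr_eq_exp[OF pos(2)] powr_eq_exp[OF pos(3)] powr_eq_exp[OF pos(4)] lc(7,8,9)
      using pos by (simp add: lx_def ly_def ls_def lf_def lp_def)
  qed
  have "radon_1d k S F \<le> (\<integral>\<^sup>+x. ennreal ?W *
      (ennreal (F (S + (1 + S) * x) powr 1 * shifted_weight A B S x) * indicator {0<..} x) \<partial>lborel)"
    unfolding radon_1d_def
  proof (rule nn_integral_mono)
    fix x :: real
    show "ennreal (F (S + (1 + S) * x) * x powr (k / 2 - 1) * (1 + x) powr (-1/2)) * indicator {0<..} x \<le>
      ennreal ?W * (ennreal (F (S + (1 + S) * x) powr 1 * shifted_weight A B S x) * indicator {0<..} x)"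
    proof (cases "x > 0")
      case True
      have "F (S + (1 + S) * x) * (x powr (k / 2 - 1) * (1 + x) powr (-1/2)) \<le>
          F (S + (1 + S) * x) * (?W * shifted_weight A B S x)"
        using pt[OF True] F by (intro mult_left_mono) auto
      then have "ennreal (F (S + (1 + S) * x) * x powr (k / 2 - 1) * (1 + x) powr (-1/2)) \<le>
          ennreal (?W * (F (S + (1 + S) * x) powr 1 * shifted_weight A B S x))"
        using F by (intro ennreal_leI) (simp add: mult_ac)
      also have "\<dots> = ennreal ?W * ennreal (F (S + (1 + S) * x) powr 1 * shifted_weight A B S x)"
        using S by (intro ennreal_mult) (auto simp: shifted_weight_def)
      finally show ?thesis using True by simp
    qed simp
  qed
  also have "\<dots> = ennreal ?W *
      (\<integral>\<^sup>+x\<in>{0<..}. ennreal (F (S + (1 + S) * x) powr 1 * shifted_weight A B S x) \<partial>lborel)"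
    unfolding shifted_weight_def by (intro nn_integral_cmult) measurable
  also have "\<dots> \<le> ennreal ?W * norm_1d 1 A B F"
    by (rule mult_left_mono[OF norm_1d_ge_shifted[OF assms(6) F S]]) simp
  finally show ?thesis .
qed

text \<open>With v the shifted weight, the integrand is split as F v^(1/p) times the kernel divided
  by v^(1/p). The p-norm of the first factor is bounded by the norm of F; the q-norm of the second
  is a Beta integral from the uniformly bounded family.\<close>

lemma radon_1d_bound_p_gt1:
  fixes k A B g1 g2 p :: real
  assumes p: "p > 1" and k: "k \<ge> 2 \<or> (k = 1 \<and> p > 2)"
    and g: "0 \<le> g1" "2 * A / p - k \<le> g1" "g1 + g2 \<le> 2 * (A + B) / p" "p * (k - 1) < 2 * (A + B)"
    and crit: "2 * A / p - k = 0 \<Longrightarrow> g1 > 0"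
  obtains K where "K \<ge> 0" "\<And>F S. F \<in> borel_measurable borel \<Longrightarrow> (\<And>x. 0 \<le> F x) \<Longrightarrow> S > 0 \<Longrightarrow>
      norm_1d p A B F < \<infinity> \<Longrightarrow> radon_1d k S F \<le>
      ennreal (K * (S powr (- (g1 / 2)) * (1 + S) powr (- (g2 / 2))) * enn2real (norm_1d p A B F) powr (1 / p))"
proof -
  define q where "q = p / (p - 1)"
  have q: "q > 1" "1 / p + 1 / q = 1" "1 / p = (q - 1) / q" "p * (q - 1) = q"
    using p by (auto simp: q_def field_simps)
  \<comment> \<open>These come from the q-th power of the kernel over v^(1/p): \<theta> compensates
    the \<phi> in W^q, and -e1, \<alpha> and -(\<alpha> + 1 + R) are the exponents of \<psi>, x and
    1 + x.\<close>
  define \<theta> e1 \<alpha> R where "\<theta> = g1 * q / 2" and "e1 = (A - 1) * (q - 1)" and "\<alpha> = (k / 2 - 1) * q"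
    and "R = q / 2 * (1 - k) + (A + B) * (q - 1)"
  \<comment> \<open>Integrability at x = 0. For k = 1 this says q / 2 < 1, which is exactly p >
    2.\<close>
  have \<alpha>: "\<alpha> > -1"
  proof (cases "k \<ge> 2")
    case True
    then have "\<alpha> \<ge> 0" using q by (simp add: \<alpha>_def)
    then show ?thesis by simp
  next
    case False
    then have "k = 1" "p > 2" using k by auto
    then have "q < 2" by (simp add: q_def divide_less_eq)
    then show ?thesis by (simp add: \<alpha>_def \<open>k = 1\<close>)
  qed
  have "p * (k - 1) * (q - 1) < 2 * (A + B) * (q - 1)"
    using g(4) q(1) by (intro mult_strict_right_mono) auto
  moreover have "p * (k - 1) * (q - 1) = p * (q - 1) * (k - 1)"
    by (simp only: mult_ac)
  moreover have "2 * R = 2 * (A + B) * (q - 1) - q * (k - 1)"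
    by (simp add: R_def field_simps)
  ultimately have R: "R > 0"
    unfolding q(4) by linarith
  have \<theta>: "\<theta> \<ge> 0" using g q by (simp add: \<theta>_def)
  have qp: "q - 1 = q / p"
    using q(4) p by (simp add: field_simps)
  have qA: "q * (2 * A / p) = 2 * A * (q - 1)"
    by (simp add: qp)
  \<comment> \<open>This identity and \<open>rel0\<close> translate the condition on g1 into the
    case distinction of the Beta family; \<open>crit\<close> rules out its logarithmic
    borderline.\<close>
  have rel: "2 * (\<theta> + \<alpha> + 1 - e1) = q * (g1 - (2 * A / p - k))"
    unfolding right_diff_distrib qA by (simp add: \<theta>_def \<alpha>_def e1_def field_simps)
  have rel0: "2 * (\<alpha> + 1 - e1) = q * (0 - (2 * A / p - k))"
    unfolding right_diff_distrib qA by (simp add: \<alpha>_def e1_def field_simps)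
  have cases: "\<theta> + \<alpha> + 1 - e1 > 0 \<or> (\<alpha> + 1 - e1 < 0 \<and> \<theta> + \<alpha> + 1 - e1 \<ge> 0)"
  proof (cases "g1 > 2 * A / p - k")
    case True
    then have "q * (g1 - (2 * A / p - k)) > 0" using q by simp
    then have "2 * (\<theta> + \<alpha> + 1 - e1) > 0" unfolding rel .
    then show ?thesis by simp
  next
    case False
    then have eq: "g1 = 2 * A / p - k" using g by simp
    then have "2 * A / p - k > 0" using g(1) crit by (cases "g1 = 0") auto
    then have "q * (0 - (2 * A / p - k)) < 0" using q by (intro mult_pos_neg) auto
    moreover have "q * (g1 - (2 * A / p - k)) = 0" using eq by simp
    ultimately have "2 * (\<alpha> + 1 - e1) < 0" "2 * (\<theta> + \<alpha> + 1 - e1) = 0"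
      unfolding rel rel0 by simp_all
    then show ?thesis by simp
  qed
  obtain K0 where K0: "K0 > 0" "\<And>\<phi>. 0 < \<phi> \<Longrightarrow> \<phi> < 1 \<Longrightarrow>
    (\<integral>\<^sup>+x\<in>{0<..}. ennreal (\<phi> powr \<theta> * ((\<phi> + x) / (1 + x)) powr (- e1) * x powr \<alpha> *
        (1 + x) powr (- (\<alpha> + 1 + R))) \<partial>lborel) \<le> ennreal K0"
    using nn_integral_beta_family_bounded[OF \<alpha> R \<theta> cases] by blast
  show ?thesis
  proof (rule that[of "K0 powr (1 / q)"])
    fix F :: "real \<Rightarrow> real" and S :: real
    assume [measurable]: "F \<in> borel_measurable borel" and F: "\<And>x. 0 \<le> F x" and S: "S > 0"
      and fin: "norm_1d p A B F < \<infinity>"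
    define W where "W = S powr (- (g1 / 2)) * (1 + S) powr (- (g2 / 2))"
    have W: "W > 0" using S by (simp add: W_def)
    define \<phi> where "\<phi> = S / (1 + S)"
    have \<phi>: "0 < \<phi>" "\<phi> < 1" using S by (auto simp: \<phi>_def)
    let ?v = "shifted_weight A B S"
    have v: "?v x > 0" if "x > 0" for x
    proof -
      have "S + (1 + S) * x > 0" "1 + S > 0" using that S by (auto simp: add_pos_pos)
      then show ?thesis
        unfolding shifted_weight_def by (intro mult_pos_pos) auto
    qed
    have [measurable]: "?v \<in> borel_measurable borel"
      unfolding shifted_weight_def by measurable
    let ?m = "\<lambda>x. x powr (k / 2 - 1) * (1 + x) powr (-1/2)"
    let ?f = "\<lambda>x. F (S + (1 + S) * x) * ?v x powr (1 / p) * indicator {0<..} x"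
    let ?g = "\<lambda>x. ?m x * ?v x powr (- (1 / p)) * indicator {0<..} x"
    have pt: "?g x powr q \<le> W powr q * (\<phi> powr \<theta> * ((\<phi> + x) / (1 + x)) powr (- e1) * x powr \<alpha> *
        (1 + x) powr (- (\<alpha> + 1 + R)))" if x: "x > 0" for x
    proof -
      define \<psi> where "\<psi> = (\<phi> + x) / (1 + x)"
      note lc = log_coordinates[OF S x, folded \<phi>_def, folded \<psi>_def]
      define lx ly ls where "lx = ln x" and "ly = ln (1 + x)" and "ls = ln (1 + S)"
      define lf lp where "lf = ln \<phi>" and "lp = ln \<psi>"
      have pos: "S + (1 + S) * x > 0" "1 + (S + (1 + S) * x) > 0" "1 + S > 0" "1 + x > 0"
        using S x by (auto simp: add_pos_pos)
      have "q * (g1 + g2) \<le> q * (2 * (A + B) / p)"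
        using g(3) q by (intro mult_left_mono) auto
      also have "q * (2 * (A + B) / p) = 2 * (A + B) * (q - 1)"
        unfolding qp by simp
      finally have "q * (g1 + g2) \<le> 2 * (A + B) * (q - 1)" .
      then have "0 \<le> (A + B) * (q - 1) - q * (g1 + g2) / 2"
        by (simp add: field_simps)
      then have ineq: "0 \<le> ((A + B) * (q - 1) - q * (g1 + g2) / 2) * ls"
        using S by (intro mult_nonneg_nonneg) (auto simp: ls_def)
      have lnv: "ln (?v x) = ls + (A - 1) * (ls + ly + lp) + B * (ls + ly)"
        using pos by (simp add: shifted_weight_def ln_mult ln_powr lc(8,9) ls_def ly_def lp_def)
      have lnW: "ln W = - (g1 / 2) * (ls + lf) + - (g2 / 2) * ls"
        using S by (simp add: W_def ln_mult ln_powr lc(7) ls_def lf_def)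
      have lnm: "ln (?m x) = (k / 2 - 1) * lx + (-1/2) * ly"
        using x by (simp add: ln_mult ln_powr lx_def ly_def)
      have "q * (ln (?m x) + - (1 / p) * ln (?v x)) = q * ln (?m x) - (q - 1) * ln (?v x)"
        using q by (simp add: q(3) right_diff_distrib)
      also have "\<dots> \<le> q * ln W + (\<theta> * lf + - e1 * lp + \<alpha> * lx + - (\<alpha> + 1 + R) * ly)"
        unfolding lnv lnW lnm using ineq
        by (simp add: \<theta>_def e1_def \<alpha>_def R_def algebra_simps add_divide_distrib diff_divide_distrib)
      finally have "exp (q * (ln (?m x) + - (1 / p) * ln (?v x))) \<le>
          exp (q * ln W) * (exp (\<theta> * lf) * exp (- e1 * lp) * exp (\<alpha> * lx) * exp (- (\<alpha> + 1 + R) * ly))"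
        by (simp only: exp_add[symmetric] exp_le_cancel_iff)
      moreover have "?g x powr q = exp (q * (ln (?m x) + - (1 / p) * ln (?v x)))"
        using x v[OF x] by (simp add: powr_def[of "_ * _" q] ln_mult ln_powr)
      moreover have "W powr q * (\<phi> powr \<theta> * \<psi> powr (- e1) * x powr \<alpha> * (1 + x) powr (- (\<alpha> + 1 + R))) =
          exp (q * ln W) * (exp (\<theta> * lf) * exp (- e1 * lp) * exp (\<alpha> * lx) * exp (- (\<alpha> + 1 + R) * ly))"
        using W \<phi> lc(3) x unfolding lf_def lp_def lx_def ly_def by (simp add: powr_def)
      ultimately show ?thesis by (simp add: \<psi>_def)
    qed
    have J: "(\<integral>\<^sup>+x. ennreal (?g x powr q) \<partial>lborel) \<le> ennreal (W powr q * K0)"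
    proof -
      let ?b = "\<lambda>x. \<phi> powr \<theta> * ((\<phi> + x) / (1 + x)) powr (- e1) * x powr \<alpha> * (1 + x) powr (- (\<alpha> + 1 + R))"
      have "(\<integral>\<^sup>+x. ennreal (?g x powr q) \<partial>lborel) \<le>
        (\<integral>\<^sup>+x. ennreal (W powr q) * (ennreal (?b x) * indicator {0<..} x) \<partial>lborel)"
      proof (rule nn_integral_mono)
        fix x :: real
        show "ennreal (?g x powr q) \<le> ennreal (W powr q) * (ennreal (?b x) * indicator {0<..} x)"
        proof (cases "x > 0")
          case True
          have "ennreal (?g x powr q) \<le> ennreal (W powr q * ?b x)"
            using pt[OF True] by (intro ennreal_leI)
          also have "\<dots> = ennreal (W powr q) * ennreal (?b x)"
            by (intro ennreal_mult) auto
          finally show ?thesis using True by simp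
        qed simp
      qed
      also have "\<dots> = ennreal (W powr q) * (\<integral>\<^sup>+x\<in>{0<..}. ennreal (?b x) \<partial>lborel)"
        by (intro nn_integral_cmult) measurable
      also have "\<dots> \<le> ennreal (W powr q) * ennreal K0"
        using K0(2)[OF \<phi>] by (intro mult_left_mono) auto
      finally show ?thesis using K0 by (simp add: ennreal_mult)
    qed
    define X where "X = enn2real (\<integral>\<^sup>+x. ennreal (?f x powr p) \<partial>lborel)"
    have "(\<integral>\<^sup>+x. ennreal (?f x powr p) \<partial>lborel) =
      (\<integral>\<^sup>+x\<in>{0<..}. ennreal (F (S + (1 + S) * x) powr p * ?v x) \<partial>lborel)"
    proof (rule nn_integral_cong)
      fix x :: real
      show "ennreal (?f x powr p) = ennreal (F (S + (1 + S) * x) powr p * ?v x) * indicator {0<..} x"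
      proof (cases "x > 0")
        case True
        then show ?thesis using v[OF True] F p by (simp add: powr_mult powr_powr)
      qed (use p in simp)
    qed
    also have "\<dots> \<le> norm_1d p A B F"
      by (rule norm_1d_ge_shifted) (use F S in auto)
    finally have leN: "(\<integral>\<^sup>+x. ennreal (?f x powr p) \<partial>lborel) \<le> norm_1d p A B F" .
    then have X: "(\<integral>\<^sup>+x. ennreal (?f x powr p) \<partial>lborel) = ennreal X" "0 \<le> X"
      using fin by (auto simp: X_def)
    have XN: "X \<le> enn2real (norm_1d p A B F)"
      unfolding X_def using leN fin by (intro enn2real_mono) auto
    have "radon_1d k S F = (\<integral>\<^sup>+x. ennreal (?f x * ?g x) \<partial>lborel)"
      unfolding radon_1d_def
    proof (rule nn_integral_cong)
      fix x :: real
      show "ennreal (F (S + (1 + S) * x) * x powr (k / 2 - 1) * (1 + x) powr (-1/2)) * indicator {0<..} x =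
        ennreal (?f x * ?g x)"
      proof (cases "x > 0")
        case True
        have vv: "?v x powr (1 / p) * ?v x powr (- (1 / p)) = 1"
          using v[OF True] by (simp add: powr_minus)
        have ind: "indicator {0<..} x = (1::real)" "indicator {0<..} x = (1::ennreal)"
          using True by simp_all
        have "?f x * ?g x = F (S + (1 + S) * x) * ?m x * (?v x powr (1 / p) * ?v x powr (- (1 / p)))"
          unfolding ind mult_1_right by (simp only: mult_ac)
        then show ?thesis unfolding vv ind mult_1_right by (simp only: mult.assoc)
      qed simp
    qed
    also have "\<dots> \<le> ennreal (X powr (1 / p) * (W powr q * K0) powr (1 / q))"
    proof (rule nn_integral_Holder[OF _ _ _ _ p q(1,2) X J])
      show "0 < W powr q * K0" using W K0 by simp
      show "0 \<le> ?f x" for x using F by simp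
      show "0 \<le> ?g x" for x by simp
    qed measurable
    also have "(W powr q * K0) powr (1 / q) = W * K0 powr (1 / q)"
      using W K0 q by (simp add: powr_mult powr_powr)
    also have "ennreal (X powr (1 / p) * (W * K0 powr (1 / q))) \<le>
       ennreal (K0 powr (1 / q) * W * enn2real (norm_1d p A B F) powr (1 / p))"
    proof (rule ennreal_leI)
      have "X powr (1 / p) \<le> enn2real (norm_1d p A B F) powr (1 / p)"
        using XN X p by (intro powr_mono2) auto
      then have "(K0 powr (1 / q) * W) * X powr (1 / p) \<le> (K0 powr (1 / q) * W) * enn2real (norm_1d p A B F) powr (1 / p)"
        using W by (intro mult_left_mono) auto
      then show "X powr (1 / p) * (W * K0 powr (1 / q)) \<le> K0 powr (1 / q) * W * enn2real (norm_1d p A B F) powr (1 / p)"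
        by (simp add: mult_ac)
    qed
    finally show "radon_1d k S F \<le> ennreal (K0 powr (1 / q) * (S powr (- (g1 / 2)) * (1 + S) powr (- (g2 / 2))) *
        enn2real (norm_1d p A B F) powr (1 / p))"
      by (simp add: W_def)
  qed simp
qed

section \<open>Null sets of parameters and transfer of the one-dimensional bound\<close>

lemma bounded_bilinear_matrix_vector_mult:
  "bounded_bilinear ((*v) :: real^'k^'n \<Rightarrow> real^'k \<Rightarrow> real^'n)"
  unfolding bilinear_conv_bounded_bilinear[symmetric] bilinear_def
  by (auto intro!: linearI matrix_vector_mul_linear
      simp: matrix_vector_mult_add_rdistrib scaleR_matrix_vector_assoc)

text \<open>The exceptional pairs are the image of (M, u) under (M u, M), a smooth map from
  dimension nk + k into dimension nk + n. Discarding them removes the subspaces through the origin,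
  where S = 0.\<close>

lemma AE_not_in_range:
  assumes "CARD('k) < CARD('n)"
  shows "AE z in (lborel :: ((real^'n) \<times> (real^'k^'n)) measure). fst z \<notin> range ((*v) (snd z))"
proof -
  let ?f = "\<lambda>z :: (real^'k^'n) \<times> (real^'k). (fst z *v snd z, fst z)"
  have "?f differentiable_on UNIV"
    unfolding differentiable_on_def differentiable_def
    using has_derivative_Pair[OF bounded_bilinear.FDERIV[OF bounded_bilinear_matrix_vector_mult
          has_derivative_fst[OF has_derivative_ident] has_derivative_snd[OF has_derivative_ident]]
        has_derivative_fst[OF has_derivative_ident]] by blast
  then have "negligible (range ?f)"
    using assms by (intro negligible_differentiable_image_lowdim) auto
  then have "AE z in lebesgue. z \<notin> range ?f"
    by (intro AE_not_in) (simp add: negligible_iff_null_sets)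
  then have "AE z in lborel. z \<notin> range ?f"
    by (simp add: AE_completion_iff)
  then show ?thesis
  proof eventually_elim
    case (elim z)
    show ?case
    proof
      assume "fst z \<in> range ((*v) (snd z))"
      then obtain u where "fst z = snd z *v u" by blast
      then have "z = ?f (snd z, u)" by (simp add: prod_eq_iff)
      with elim show False by blast
    qed
  qed
qed

lemma closed_range_matrix: "closed (range ((*v) (M :: real^'k^'n)))"
  by (intro closed_subspace linear_subspace_image matrix_vector_mul_linear subspace_UNIV)

lemma tg_sinh2_pos:
  assumes "a \<notin> range ((*v) M)" "norm a < 1"
  shows "tg_sinh2 a M > 0"
proof -
  have "infdist a (range ((*v) M)) \<noteq> 0"
    using in_closed_iff_infdist_zero[OF closed_range_matrix, of M a] assms by auto
  then show ?thesis
    using power2_norm_less_1[OF assms(2)] by (simp add: tg_sinh2_def)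
qed

lemma Lp_weighted_pow_norm_1d:
  fixes f :: "real^'n \<Rightarrow> real"
  assumes "f \<in> borel_measurable borel" and "radial f"
  shows "Lp_weighted_pow p a1 a2 f = ennreal (polar_const TYPE(real^'n)) *
    norm_1d p ((a1 + CARD('n)) / 2) ((a2 - 1) / 2) (\<lambda>x. \<bar>profile f x\<bar>)"
  unfolding norm_1d_def by (rule Lp_weighted_pow_radial[OF assms])

lemma nn_integral_Rk_radon_1d:
  fixes M :: "real^'k^'n"
  assumes "f \<in> borel_measurable borel" and "radial f"
    and "norm a < 1" and "det (transpose M ** M) \<noteq> 0"
  shows "(\<integral>\<^sup>+u\<in>param_dom M. ennreal \<bar>Rk_integrand f a M u\<bar> \<partial>lborel) =
    ennreal (polar_const TYPE(real^'k idx)) * radon_1d CARD('k) (tg_sinh2 a M) (\<lambda>x. \<bar>profile f x\<bar>)"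
  unfolding radon_1d_def by (rule nn_integral_abs_Rk_integrand[OF assms])

lemma set_integral_abs_le_nn_integral:
  fixes g :: "'a::euclidean_space \<Rightarrow> real"
  assumes [measurable]: "g \<in> borel_measurable borel" "D \<in> sets borel"
    and le: "(\<integral>\<^sup>+u\<in>D. ennreal \<bar>g u\<bar> \<partial>lborel) \<le> ennreal c" "0 \<le> c"
  shows "set_integrable lborel D g" "\<bar>LINT u:D|lborel. g u\<bar> \<le> c"
proof -
  have eq: "(\<integral>\<^sup>+u. ennreal (norm (indicator D u *\<^sub>R g u)) \<partial>lborel) = (\<integral>\<^sup>+u\<in>D. ennreal \<bar>g u\<bar> \<partial>lborel)"
    by (intro nn_integral_cong) (auto simp: indicator_def)
  show int: "set_integrable lborel D g"
    unfolding set_integrable_def integrable_iff_bounded eq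
    using le by (auto intro: le_less_trans)
  have "ennreal \<bar>LINT u:D|lborel. g u\<bar> \<le> ennreal (LINT u|lborel. norm (indicator D u *\<^sub>R g u))"
    unfolding set_lebesgue_integral_def using integral_norm_bound[of lborel "\<lambda>u. indicator D u *\<^sub>R g u"]
    by (intro ennreal_leI) simp
  also have "\<dots> = (\<integral>\<^sup>+u. ennreal (norm (indicator D u *\<^sub>R g u)) \<partial>lborel)"
    using int unfolding set_integrable_def by (intro nn_integral_eq_integral[symmetric]) auto
  also have "\<dots> \<le> ennreal c" unfolding eq by (rule le)
  finally show "\<bar>LINT u:D|lborel. g u\<bar> \<le> c" using le by simp
qed

text \<open>Off the null set S > 0, so the weight has the reciprocal W. The bound for the integral
  of the absolute value gives integrability and the estimate at once; C collects the two polar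
  constants.\<close>

lemma radon_estimate_if_1d:
  fixes p a1 a2 g1 g2 K :: real
  defines "A \<equiv> (a1 + CARD('n::finite)) / 2" and "B \<equiv> (a2 - 1) / 2"
  assumes kn: "CARD('k::finite) < CARD('n)" and p: "p > 0" and K: "K \<ge> 0"
    and bound: "\<And>F S. F \<in> borel_measurable borel \<Longrightarrow> (\<And>x. 0 \<le> F x) \<Longrightarrow> S > 0 \<Longrightarrow>
      norm_1d p A B F < \<infinity> \<Longrightarrow> radon_1d CARD('k) S F \<le>
      ennreal (K * (S powr (- (g1 / 2)) * (1 + S) powr (- (g2 / 2))) * enn2real (norm_1d p A B F) powr (1 / p))"
  shows "radon_estimate TYPE('k) TYPE('n) p a1 a2 g1 g2"
proof -
  define cn where "cn = polar_const TYPE(real^'n)"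
  define ck where "ck = polar_const TYPE(real^'k idx)"
  have c: "cn > 0" "ck > 0" by (simp_all add: cn_def ck_def polar_const_pos)
  define C where "C = ck * K / cn powr (1 / p)"
  have C: "C \<ge> 0" using c K by (simp add: C_def)
  show ?thesis
    unfolding radon_estimate_def
  proof (intro exI[of _ C] allI impI)
    fix f :: "real^'n \<Rightarrow> real"
    assume f: "f \<in> borel_measurable lborel \<and> radial f \<and> Lp_weighted_pow p a1 a2 f < \<infinity>"
    then have meas: "f \<in> borel_measurable borel" and rad: "radial f" by auto
    define F where "F = (\<lambda>x. \<bar>profile f x\<bar>)"
    have F: "F \<in> borel_measurable borel" "\<And>x. 0 \<le> F x"
      using profile_measurable[OF meas] by (auto simp: F_def)
    define N where "N = norm_1d p A B F"
    have Lp: "Lp_weighted_pow p a1 a2 f = ennreal cn * N"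
      unfolding N_def A_def B_def F_def cn_def by (rule Lp_weighted_pow_norm_1d[OF meas rad])
    have N: "N < \<infinity>"
      using f c unfolding Lp by (auto simp: ennreal_mult_less_top)
    have LpN: "enn2real (Lp_weighted_pow p a1 a2 f) = cn * enn2real N"
      unfolding Lp using c by (simp add: enn2real_mult)
    show "AE z in (lborel :: ((real^'n) \<times> (real^'k^'n)) measure).
           fst z \<in> hball \<longrightarrow>
             set_integrable lborel (param_dom (snd z)) (Rk_integrand f (fst z) (snd z)) \<and>
             \<bar>sinh (dist0_tg (fst z) (snd z)) powr g1 * cosh (dist0_tg (fst z) (snd z)) powr g2
               * Rk f (fst z) (snd z)\<bar>
             \<le> C * enn2real (Lp_weighted_pow p a1 a2 f) powr (1 / p)"
      using AE_not_in_range[OF kn]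
    proof eventually_elim
      case (elim z)
      define a M where "a = fst z" and "M = snd z"
      have "set_integrable lborel (param_dom M) (Rk_integrand f a M) \<and>
         \<bar>sinh (dist0_tg a M) powr g1 * cosh (dist0_tg a M) powr g2 * Rk f a M\<bar>
             \<le> C * enn2real (Lp_weighted_pow p a1 a2 f) powr (1 / p)" if "a \<in> hball"
      proof (cases "det (transpose M ** M) = 0")
        case True
        \<comment> \<open>For a rank-deficient M the Gram factor vanishes, so the estimate is
          trivial.\<close>
        then have "Rk_integrand f a M = (\<lambda>u. 0)"
          by (auto simp: Rk_integrand_def)
        then show ?thesis
          using C by (simp add: set_integrable_def Rk_def)
      next
        case False
        have a: "norm a < 1" using that by (simp add: hball_iff)
        define S where "S = tg_sinh2 a M"
        have S: "S > 0" unfolding S_def using elim a by (intro tg_sinh2_pos) (auto simp: a_def M_def)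
        define W where "W = S powr (- (g1 / 2)) * (1 + S) powr (- (g2 / 2))"
        have W: "W \<ge> 0" by (simp add: W_def)
        have WW: "S powr (g1 / 2) * (1 + S) powr (g2 / 2) * W = 1"
          using S by (simp add: W_def powr_minus field_simps)
        have "(\<integral>\<^sup>+u\<in>param_dom M. ennreal \<bar>Rk_integrand f a M u\<bar> \<partial>lborel) =
            ennreal ck * radon_1d CARD('k) S F"
          unfolding ck_def S_def F_def by (rule nn_integral_Rk_radon_1d[OF meas rad a False])
        also have "\<dots> \<le> ennreal ck * ennreal (K * W * enn2real N powr (1 / p))"
          unfolding W_def N_def using bound[OF F S] N by (intro mult_left_mono) (auto simp: N_def)
        also have "\<dots> = ennreal (ck * (K * W * enn2real N powr (1 / p)))"
          using c K W by (intro ennreal_mult[symmetric]) auto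
        finally have le: "(\<integral>\<^sup>+u\<in>param_dom M. ennreal \<bar>Rk_integrand f a M u\<bar> \<partial>lborel) \<le>
            ennreal (ck * (K * W * enn2real N powr (1 / p)))" .
        have nn: "0 \<le> ck * (K * W * enn2real N powr (1 / p))"
          using c K W by simp
        note int = set_integral_abs_le_nn_integral[OF Rk_integrand_measurable[OF meas] param_dom_borel le nn]
        have "\<bar>sinh (dist0_tg a M) powr g1 * cosh (dist0_tg a M) powr g2 * Rk f a M\<bar> =
            S powr (g1 / 2) * (1 + S) powr (g2 / 2) * \<bar>Rk f a M\<bar>"
          unfolding dist0_tg_powr[OF a False] S_def by (simp add: abs_mult)
        also have "\<dots> \<le> S powr (g1 / 2) * (1 + S) powr (g2 / 2) * (ck * (K * W * enn2real N powr (1 / p)))"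
          using int(2) unfolding Rk_def by (intro mult_left_mono) auto
        also have "\<dots> = (S powr (g1 / 2) * (1 + S) powr (g2 / 2) * W) * (ck * K * enn2real N powr (1 / p))"
          by (simp only: mult_ac)
        also have "\<dots> = C * enn2real (Lp_weighted_pow p a1 a2 f) powr (1 / p)"
          unfolding WW LpN C_def using c by (simp add: powr_mult)
        finally show ?thesis using int(1) by blast
      qed
      then show ?case by (simp add: a_def M_def)
    qed
  qed
qed

section \<open>Necessity\<close>

lemma AE_lborel_open_ex:
  fixes U :: "'a::euclidean_space set"
  assumes "AE x in lborel. Q x" "open U" "U \<noteq> {}"
  shows "\<exists>x\<in>U. Q x"
proof (rule ccontr)
  assume none: "\<not> (\<exists>x\<in>U. Q x)"
  have "AE x in lebesgue. Q x" using assms(1) by (simp add: AE_completion_iff)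
  then obtain N where N: "\<And>x. x \<notin> N \<Longrightarrow> Q x" "N \<in> null_sets lebesgue"
    by (rule AE_E3) auto
  then have "U \<subseteq> N" using none by blast
  moreover have "negligible N" using N by (simp add: negligible_iff_null_sets)
  ultimately have "negligible U" using negligible_subset by blast
  then show False using open_not_negligible assms by blast
qed

text \<open>Fubini for null sets with the second coordinate chosen first: below, a matrix M is fixed
  before the translation vector varies.\<close>

lemma AE_lborel_pair_swap:
  fixes P :: "'a::euclidean_space \<times> 'b::euclidean_space \<Rightarrow> bool"
  assumes "AE z in lborel. P z"
  shows "AE y in lborel. AE x in lborel. P (x, y)"
proof -
  obtain N where N: "\<And>z. z \<notin> N \<Longrightarrow> P z" "N \<in> null_sets lborel"
    using assms by (rule AE_E3) auto
  have N': "N \<in> null_sets (lborel \<Otimes>\<^sub>M lborel)"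
    using N(2) by (simp add: lborel_prod)
  have "AE z in (lborel \<Otimes>\<^sub>M lborel). z \<notin> N"
    by (rule AE_not_in[OF N'])
  then have "AE x in lborel. AE y in lborel. (x, y) \<notin> N"
    by (rule lborel_pair.AE_pair)
  moreover have "{z \<in> space (lborel \<Otimes>\<^sub>M lborel). (fst z, snd z) \<notin> N} \<in> sets (lborel \<Otimes>\<^sub>M lborel)"
  proof -
    have "{z \<in> space (lborel \<Otimes>\<^sub>M lborel). (fst z, snd z) \<notin> N} = space (lborel \<Otimes>\<^sub>M lborel) - N"
      by auto
    then show ?thesis using N' by (simp only:) (intro sets.compl_sets null_setsD2)
  qed
  ultimately have "AE y in lborel. AE x in lborel. (x, y) \<notin> N"
    using lborel_pair.AE_commute[of "\<lambda>x y. (x, y) \<notin> N"] by simp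
  then show ?thesis
  proof eventually_elim
    case (elim y)
    then show ?case by eventually_elim (use N in auto)
  qed
qed

lemma open_full_rank: "open {M :: real^'k^'n. det (transpose M ** M) \<noteq> 0}"
proof -
  have "continuous_on UNIV (\<lambda>M :: real^'k^'n. det (transpose M ** M))"
    unfolding det_def matrix_matrix_mult_def transpose_def
    by (simp, intro continuous_intros)
  then show ?thesis
    by (intro open_Collect_neq continuous_intros)
qed

lemma ex_full_rank:
  assumes "CARD('k) \<le> CARD('n)"
  shows "\<exists>M :: real^'k^'n. det (transpose M ** M) \<noteq> 0"
proof -
  obtain \<iota> :: "'k \<Rightarrow> 'n" where \<iota>: "inj \<iota>"
    using assms card_le_inj[of "UNIV :: 'k set" "UNIV :: 'n set"] by auto
  define M :: "real^'k^'n" where "M = (\<chi> i j. if i = \<iota> j then 1 else 0)"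
  have "(\<Sum>l\<in>UNIV. (if l = \<iota> i then 1 else 0) * (if l = \<iota> j then 1 else 0)) = (if i = j then 1 else (0::real))" for i j
    using \<iota> by (simp add: inj_eq if_distrib[of "\<lambda>x. x * _"] cong: if_cong)
  then have "transpose M ** M = mat 1"
    by (simp add: vec_eq_iff matrix_matrix_mult_def transpose_def M_def mat_def)
  then show ?thesis by (metis det_I zero_neq_one)
qed

lemma infdist_orthogonal:
  assumes "0 \<in> W" "\<And>y. y \<in> W \<Longrightarrow> a \<bullet> y = 0"
  shows "infdist a W = norm a"
proof (rule antisym)
  show "infdist a W \<le> norm a" using infdist_le[OF assms(1), of a] by simp
  have "norm a \<le> dist a y" if "y \<in> W" for y
  proof (rule power2_le_imp_le)
    have "(dist a y)\<^sup>2 = (norm a)\<^sup>2 + (norm y)\<^sup>2"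
      using assms(2)[OF that]
      by (simp add: dist_norm power2_norm_eq_inner inner_diff_left inner_diff_right inner_commute)
    then show "(norm a)\<^sup>2 \<le> (dist a y)\<^sup>2" by simp
  qed simp
  then show "norm a \<le> infdist a W"
    using assms(1) by (auto simp: infdist_def intro!: cINF_greatest)
qed

text \<open>Since k < n there is a direction orthogonal to the range of M. On that line
  \<open>tg_sinh2 a M\<close> equals \<open>sinh2 (norm a)\<close>, so the midpoint of l and u is
  attained.\<close>

lemma open_tg_sinh2_between:
  fixes M :: "real^'k^'n"
  assumes kn: "CARD('k) < CARD('n)" and lu: "0 \<le> l" "l < u"
  shows "open {a. norm a < 1 \<and> l < tg_sinh2 a M \<and> tg_sinh2 a M < u}"
    and "{a. norm a < 1 \<and> l < tg_sinh2 a M \<and> tg_sinh2 a M < u} \<noteq> {}"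
proof -
  have "continuous_on (ball 0 1) (\<lambda>a. tg_sinh2 a M)"
    unfolding tg_sinh2_def
    by (intro continuous_intros continuous_on_infdist) (auto simp: abs_square_eq_1)
  then have "open (ball 0 1 \<inter> (\<lambda>a. tg_sinh2 a M) -` {l<..<u})"
    by (intro continuous_open_preimage) auto
  also have "ball 0 1 \<inter> (\<lambda>a. tg_sinh2 a M) -` {l<..<u} = {a. norm a < 1 \<and> l < tg_sinh2 a M \<and> tg_sinh2 a M < u}"
    by auto
  finally show "open {a. norm a < 1 \<and> l < tg_sinh2 a M \<and> tg_sinh2 a M < u}" .
  have "dim (range ((*v) M)) \<le> dim (UNIV :: (real^'k) set)"
    by (intro dim_image_le matrix_vector_mul_linear)
  then have "dim (range ((*v) M)) < DIM(real^'n)"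
    using kn by simp
  then obtain e where e: "e \<noteq> 0" "\<And>y. y \<in> span (range ((*v) M)) \<Longrightarrow> orthogonal e y"
    using orthogonal_to_subspace_exists by blast
  define r where "r = sinh2_inv ((l + u) / 2)"
  have r: "0 \<le> r" "r < 1" "sinh2 r = (l + u) / 2"
    using lu sinh2_inv_range[of "(l + u) / 2"] sinh2_sinh2_inv[of "(l + u) / 2"] by (auto simp: r_def)
  define a where "a = (r / norm e) *\<^sub>R e"
  have na: "norm a = r" using e r by (simp add: a_def)
  have "infdist a (range ((*v) M)) = norm a"
  proof (rule infdist_orthogonal)
    show "0 \<in> range ((*v) M)" by (rule range_eqI[of _ _ 0]) simp
    show "a \<bullet> y = 0" if "y \<in> range ((*v) M)" for y
      using e(2)[OF span_base[OF that]] by (simp add: a_def orthogonal_def)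
  qed
  then have "tg_sinh2 a M = (l + u) / 2"
    using r by (simp add: tg_sinh2_def na sinh2_def)
  then show "{a. norm a < 1 \<and> l < tg_sinh2 a M \<and> tg_sinh2 a M < u} \<noteq> {}"
    using na r lu by (intro ex_in_conv[THEN iffD1] exI[of _ a]) auto
qed

text \<open>The exceptional null set depends on f, hence S can be found only after F, and only
  inside a given interval. Positive measure of nonempty open sets is what produces it.\<close>

lemma radon_1d_if_estimate:
  fixes p a1 a2 g1 g2 :: real
  defines "A \<equiv> (a1 + CARD('n::finite)) / 2" and "B \<equiv> (a2 - 1) / 2"
  assumes kn: "CARD('k::finite) < CARD('n)" and p: "p > 0"
    and est: "radon_estimate TYPE('k) TYPE('n) p a1 a2 g1 g2"
  obtains K where "K \<ge> 0" "\<And>F l u. F \<in> borel_measurable borel \<Longrightarrow> (\<And>x. 0 \<le> F x) \<Longrightarrow>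
      norm_1d p A B F < \<infinity> \<Longrightarrow> 0 \<le> l \<Longrightarrow> l < u \<Longrightarrow> \<exists>S. l < S \<and> S < u \<and> radon_1d CARD('k) S F \<le>
      ennreal (K * (S powr (- (g1 / 2)) * (1 + S) powr (- (g2 / 2))) * enn2real (norm_1d p A B F) powr (1 / p))"
proof -
  define cn where "cn = polar_const TYPE(real^'n)"
  define ck where "ck = polar_const TYPE(real^'k idx)"
  have c: "cn > 0" "ck > 0" by (simp_all add: cn_def ck_def polar_const_pos)
  obtain C where C: "\<And>f :: real^'n \<Rightarrow> real.
        f \<in> borel_measurable lborel \<and> radial f \<and> Lp_weighted_pow p a1 a2 f < \<infinity> \<Longrightarrow>
        (AE z in (lborel :: ((real^'n) \<times> (real^'k^'n)) measure).
           fst z \<in> hball \<longrightarrow>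
             set_integrable lborel (param_dom (snd z)) (Rk_integrand f (fst z) (snd z)) \<and>
             \<bar>sinh (dist0_tg (fst z) (snd z)) powr g1 * cosh (dist0_tg (fst z) (snd z)) powr g2
               * Rk f (fst z) (snd z)\<bar>
             \<le> C * enn2real (Lp_weighted_pow p a1 a2 f) powr (1 / p))"
    using est unfolding radon_estimate_def by blast
  show ?thesis
  \<comment> \<open>The constant of the estimate carries no sign, hence \<open>max C 0\<close>; the
    other factors convert the polar constants back.\<close>
  proof (rule that[of "max C 0 * cn powr (1 / p) / ck"])
    show "0 \<le> max C 0 * cn powr (1 / p) / ck" using c by simp
    fix F :: "real \<Rightarrow> real" and l u :: real
    assume F: "F \<in> borel_measurable borel" "\<And>x. 0 \<le> F x" and fin: "norm_1d p A B F < \<infinity>"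
      and lu: "0 \<le> l" "l < u"
    define f :: "real^'n \<Rightarrow> real" where "f = (\<lambda>x. F (sinh2 (norm x)))"
    let ?P = "\<lambda>a (M :: real^'k^'n). a \<in> hball \<longrightarrow> set_integrable lborel (param_dom M) (Rk_integrand f a M) \<and>
             \<bar>sinh (dist0_tg a M) powr g1 * cosh (dist0_tg a M) powr g2 * Rk f a M\<bar>
             \<le> C * enn2real (Lp_weighted_pow p a1 a2 f) powr (1 / p)"
    have meas: "f \<in> borel_measurable borel"
      unfolding f_def using F(1) by measurable
    have "sinh2 (norm x) = sinh2 (norm y)" if "x \<in> hball" "y \<in> hball" "hdist0 x = hdist0 y" for x y :: "real^'n"
    proof -
      have "sqrt (sinh2 (norm x)) = sqrt (sinh2 (norm y))"
        using that sinh_cosh_hdist0(1)[of x] sinh_cosh_hdist0(1)[of y] by (simp add: hball_iff)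
      then show ?thesis by simp
    qed
    then have rad: "radial f"
      unfolding radial_def f_def by metis
    have prof: "\<bar>profile f x\<bar> = F x" if "x > 0" for x
    proof -
      have "profile f x = F (sinh2 (sinh2_inv x))"
        using sinh2_inv_range[of x] that by (simp add: profile_def f_def norm_axis_1)
      then show ?thesis using that F(2) by (simp add: sinh2_sinh2_inv)
    qed
    define N where "N = norm_1d p A B F"
    have "norm_1d p A B (\<lambda>x. \<bar>profile f x\<bar>) = N"
      unfolding N_def norm_1d_def by (intro nn_integral_cong) (auto simp: prof indicator_def)
    then have Lp: "Lp_weighted_pow p a1 a2 f = ennreal cn * N"
      unfolding cn_def A_def B_def using Lp_weighted_pow_norm_1d[OF meas rad] by simp
    have LpN: "enn2real (Lp_weighted_pow p a1 a2 f) = cn * enn2real N"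
      unfolding Lp using c by (simp add: enn2real_mult)
    have "Lp_weighted_pow p a1 a2 f < \<infinity>"
      unfolding Lp using fin by (auto simp: N_def ennreal_mult_less_top)
    then have "AE z in lborel. ?P (fst z) (snd z)"
      using C[of f] meas rad by simp
    \<comment> \<open>A full-rank M is fixed for which almost every \<open>a\<close> is good; a good
      \<open>a\<close> then exists in the open set where \<open>tg_sinh2 a M\<close> lies between l
      and u.\<close>
    from AE_lborel_pair_swap[OF this]
    have "AE M in lborel. AE a in lborel. ?P a M"
      by simp
    from AE_lborel_open_ex[OF this open_full_rank] ex_full_rank[where 'k='k and 'n='n] kn
    obtain M :: "real^'k^'n" where M: "det (transpose M ** M) \<noteq> 0"
      and ae: "AE a in lborel. ?P a M"
      by auto
    from AE_lborel_open_ex[OF ae open_tg_sinh2_between[OF kn lu, of M]]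
    obtain a where a: "norm a < 1" "l < tg_sinh2 a M" "tg_sinh2 a M < u"
      and int: "set_integrable lborel (param_dom M) (Rk_integrand f a M)"
      and le: "\<bar>sinh (dist0_tg a M) powr g1 * cosh (dist0_tg a M) powr g2 * Rk f a M\<bar>
             \<le> C * enn2real (Lp_weighted_pow p a1 a2 f) powr (1 / p)"
      by (auto simp: hball_iff)
    define S where "S = tg_sinh2 a M"
    have S: "S > 0" using a lu by (simp add: S_def)
    let ?V = "S powr (g1 / 2) * (1 + S) powr (g2 / 2)"
    define W where "W = S powr (- (g1 / 2)) * (1 + S) powr (- (g2 / 2))"
    have W: "W > 0" using S by (simp add: W_def)
    have WW: "?V * W = 1"
      using S by (simp add: W_def powr_minus field_simps)
    note det = det_gram_nonneg[OF M]
    have nn: "0 \<le> Rk_integrand f a M u" if "u \<in> param_dom M" for u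
      using that F(2) det power2_norm_less_1[of "M *v u"]
      by (auto simp: Rk_integrand_def f_def param_dom_def hball_iff)
    have Rk: "(\<integral>\<^sup>+u\<in>param_dom M. ennreal \<bar>Rk_integrand f a M u\<bar> \<partial>lborel) = ennreal (Rk f a M)"
    proof -
      have "(\<integral>\<^sup>+u\<in>param_dom M. ennreal \<bar>Rk_integrand f a M u\<bar> \<partial>lborel) =
         (\<integral>\<^sup>+u. ennreal (indicator (param_dom M) u *\<^sub>R Rk_integrand f a M u) \<partial>lborel)"
        using nn by (intro nn_integral_cong) (auto simp: indicator_def)
      also have "\<dots> = ennreal (Rk f a M)"
        unfolding Rk_def set_lebesgue_integral_def
        using int nn unfolding set_integrable_def
        by (intro nn_integral_eq_integral) (auto simp: indicator_def)
      finally show ?thesis .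
    qed
    have "radon_1d CARD('k) S (\<lambda>x. \<bar>profile f x\<bar>) = radon_1d CARD('k) S F"
      unfolding radon_1d_def
      by (intro nn_integral_cong) (use S in \<open>auto simp: prof indicator_def add_pos_pos\<close>)
    then have main: "ennreal ck * radon_1d CARD('k) S F = ennreal (Rk f a M)"
      using nn_integral_Rk_radon_1d[OF meas rad a(1) M] Rk by (simp add: ck_def S_def)
    have "?V * \<bar>Rk f a M\<bar> \<le> C * (cn * enn2real N) powr (1 / p)"
      using le unfolding dist0_tg_powr[OF a(1) M] S_def[symmetric] LpN by (simp add: abs_mult)
    also have "\<dots> \<le> max C 0 * (cn * enn2real N) powr (1 / p)"
      by (intro mult_right_mono) auto
    finally have "W * (?V * \<bar>Rk f a M\<bar>) \<le> W * (max C 0 * (cn * enn2real N) powr (1 / p))"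
      using W by (intro mult_left_mono) auto
    moreover have "W * (?V * \<bar>Rk f a M\<bar>) = (?V * W) * \<bar>Rk f a M\<bar>"
      by (simp only: mult_ac)
    ultimately have R: "\<bar>Rk f a M\<bar> \<le> W * (max C 0 * (cn powr (1 / p) * enn2real N powr (1 / p)))"
      unfolding WW using c by (simp add: powr_mult)
    have "radon_1d CARD('k) S F = ennreal (1 / ck) * (ennreal ck * radon_1d CARD('k) S F)"
      using c by (simp add: mult.assoc[symmetric] ennreal_mult[symmetric])
    also have "\<dots> = ennreal (1 / ck * Rk f a M)"
      unfolding main using c by (subst ennreal_mult') auto
    also have "\<dots> \<le> ennreal (1 / ck * (W * (max C 0 * (cn powr (1 / p) * enn2real N powr (1 / p)))))"
      using R c by (intro ennreal_leI mult_left_mono) auto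
    also have "1 / ck * (W * (max C 0 * (cn powr (1 / p) * enn2real N powr (1 / p)))) =
        max C 0 * cn powr (1 / p) / ck * W * enn2real N powr (1 / p)"
      by simp
    finally have "radon_1d CARD('k) S F \<le> ennreal (max C 0 * cn powr (1 / p) / ck * W * enn2real N powr (1 / p))" .
    then show "\<exists>S. l < S \<and> S < u \<and> radon_1d CARD('k) S F \<le>
      ennreal (max C 0 * cn powr (1 / p) / ck * (S powr (- (g1 / 2)) * (1 + S) powr (- (g2 / 2))) *
        enn2real (norm_1d p A B F) powr (1 / p))"
      using a unfolding W_def N_def S_def by blast
  qed
qed

section \<open>Tests on indicators of intervals\<close>

lemma powr_comparable:
  fixes x y c e :: real
  assumes "y > 0" "y \<le> x" "x \<le> c * y"
  shows "x powr e \<le> c powr \<bar>e\<bar> * y powr e" "y powr e \<le> c powr \<bar>e\<bar> * x powr e"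
proof -
  have c: "1 \<le> x / y" "x / y \<le> c" using assms by (auto simp: field_simps)
  have "x powr e = (x / y) powr e * y powr e"
    using assms by (simp add: powr_divide)
  also have "\<dots> \<le> c powr \<bar>e\<bar> * y powr e"
    using powr_between[OF c] by (intro mult_right_mono) auto
  finally show "x powr e \<le> c powr \<bar>e\<bar> * y powr e" .
  have "y powr e = (x / y) powr (- e) * x powr e"
    using assms by (simp add: powr_divide powr_minus)
  also have "\<dots> \<le> c powr \<bar>e\<bar> * x powr e"
    using powr_between[OF c, of "- e"] by (intro mult_right_mono) auto
  finally show "y powr e \<le> c powr \<bar>e\<bar> * x powr e" .
qed

lemma exponent_nonneg_if_bounded_at_0:
  fixes e K :: real
  assumes "\<And>l. 0 < l \<Longrightarrow> l \<le> 1/2 \<Longrightarrow> l powr e \<le> K"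
  shows "e \<ge> 0"
proof (rule ccontr)
  assume "\<not> e \<ge> 0"
  then have e: "e < 0" by simp
  define l where "l = min (1/2) ((\<bar>K\<bar> + 1) powr (1 / e))"
  have "\<bar>K\<bar> + 1 = ((\<bar>K\<bar> + 1) powr (1 / e)) powr e"
    using e by (simp add: powr_powr)
  also have "\<dots> \<le> l powr e"
    using e by (intro powr_mono2') (auto simp: l_def min_less_iff_disj)
  also have "\<dots> \<le> K"
    by (rule assms) (auto simp: l_def)
  finally show False by simp
qed

lemma exponent_nonpos_if_bounded_at_top:
  fixes e K :: real
  assumes "\<And>l. 1 \<le> l \<Longrightarrow> l powr e \<le> K"
  shows "e \<le> 0"
proof (rule ccontr)
  assume "\<not> e \<le> 0"
  then have e: "e > 0" by simp
  define l where "l = max 1 ((\<bar>K\<bar> + 1) powr (1 / e))"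
  have "\<bar>K\<bar> + 1 = ((\<bar>K\<bar> + 1) powr (1 / e)) powr e"
    using e by (simp add: powr_powr)
  also have "\<dots> \<le> l powr e"
    using e by (intro powr_mono2) (auto simp: l_def)
  also have "\<dots> \<le> K"
    by (rule assms) (auto simp: l_def)
  finally show False by simp
qed

text \<open>On the interval from t to c t each power is comparable to its value at t, and the length
  (c - 1) t raises the exponent A - 1 to A.\<close>

lemma norm_1d_indicator_le:
  fixes t c :: real
  assumes "t > 0" "c \<ge> 1"
  shows "norm_1d p A B (indicator {t..c * t}) \<le>
    ennreal (c * c powr \<bar>A - 1\<bar> * c powr \<bar>B\<bar> * (t powr A * (1 + t) powr B))"
proof -
  let ?d = "(c powr \<bar>A - 1\<bar> * t powr (A - 1)) * (c powr \<bar>B\<bar> * (1 + t) powr B)"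
  have "norm_1d p A B (indicator {t..c * t}) \<le> (\<integral>\<^sup>+x. ennreal ?d * indicator {t..c * t} x \<partial>lborel)"
    unfolding norm_1d_def
  proof (rule nn_integral_mono)
    fix x :: real
    show "ennreal (indicator {t..c * t} x powr p * x powr (A - 1) * (1 + x) powr B) * indicator {0<..} x \<le>
      ennreal ?d * indicator {t..c * t} x"
    proof (cases "x \<in> {t..c * t}")
      case True
      have "x powr (A - 1) \<le> c powr \<bar>A - 1\<bar> * t powr (A - 1)"
        using True assms by (intro powr_comparable) auto
      moreover have "(1 + x) powr B \<le> c powr \<bar>B\<bar> * (1 + t) powr B"
        using True assms by (intro powr_comparable) (auto simp: algebra_simps)
      ultimately have "x powr (A - 1) * (1 + x) powr B \<le> ?d"
        by (intro mult_mono) auto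
      with True assms show ?thesis by (simp add: ennreal_leI)
    qed simp
  qed
  also have "\<dots> = ennreal ?d * ennreal (c * t - t)"
    using assms by (subst nn_integral_cmult_indicator) auto
  also have "\<dots> = ennreal (?d * (c * t - t))"
    using assms by (intro ennreal_mult[symmetric]) auto
  also have "\<dots> \<le> ennreal (?d * (c * t))"
    using assms by (intro ennreal_leI mult_left_mono) auto
  also have "?d * (c * t) = c * c powr \<bar>A - 1\<bar> * c powr \<bar>B\<bar> * ((t powr (A - 1) * t powr 1) * (1 + t) powr B)"
    using assms by simp
  also have "t powr (A - 1) * t powr 1 = t powr A"
    unfolding powr_add[symmetric] by simp
  finally show ?thesis .
qed

text \<open>Only the window from x0 to 2 x0, mapped into the support by \<open>sub\<close>, is kept.
  There x and 1 + x vary by a factor of at most 2, which explains the powers of 2; the length x0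
  raises the exponent to k/2.\<close>

lemma radon_1d_indicator_ge:
  fixes S t c x0 :: real
  assumes "S > 0" "x0 > 0"
    and sub: "\<And>x. x0 \<le> x \<Longrightarrow> x \<le> 2 * x0 \<Longrightarrow> t \<le> S + (1 + S) * x \<and> S + (1 + S) * x \<le> c * t"
  shows "ennreal (x0 powr (k / 2) * (1 + x0) powr (-1/2) / (2 powr \<bar>k / 2 - 1\<bar> * 2 powr (1/2))) \<le>
    radon_1d k S (indicator {t..c * t})"
proof -
  let ?d = "(x0 powr (k / 2 - 1) / 2 powr \<bar>k / 2 - 1\<bar>) * ((1 + x0) powr (-1/2) / 2 powr \<bar>-1/2\<bar>)"
  have "x0 powr (k / 2) = x0 powr (k / 2 - 1) * x0 powr 1"
    unfolding powr_add[symmetric] by simp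
  then have "x0 powr (k / 2) * (1 + x0) powr (-1/2) / (2 powr \<bar>k / 2 - 1\<bar> * 2 powr (1/2)) = ?d * (2 * x0 - x0)"
    using assms by simp
  then have "ennreal (x0 powr (k / 2) * (1 + x0) powr (-1/2) / (2 powr \<bar>k / 2 - 1\<bar> * 2 powr (1/2))) =
      ennreal ?d * ennreal (2 * x0 - x0)"
    using assms by (simp only:) (intro ennreal_mult, auto)
  also have "\<dots> = (\<integral>\<^sup>+x. ennreal ?d * indicator {x0..2 * x0} x \<partial>lborel)"
    using assms by (subst nn_integral_cmult_indicator) auto
  also have "\<dots> \<le> radon_1d k S (indicator {t..c * t})"
    unfolding radon_1d_def
  proof (rule nn_integral_mono)
    fix x :: real
    show "ennreal ?d * indicator {x0..2 * x0} x \<le>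
      ennreal (indicator {t..c * t} (S + (1 + S) * x) * x powr (k / 2 - 1) * (1 + x) powr (-1/2)) * indicator {0<..} x"
    proof (cases "x \<in> {x0..2 * x0}")
      case True
      have "x0 powr (k / 2 - 1) \<le> 2 powr \<bar>k / 2 - 1\<bar> * x powr (k / 2 - 1)"
        using True assms by (intro powr_comparable) auto
      then have 1: "x0 powr (k / 2 - 1) / 2 powr \<bar>k / 2 - 1\<bar> \<le> x powr (k / 2 - 1)"
        by (simp add: divide_le_eq mult.commute)
      have "(1 + x0) powr (-1/2) \<le> 2 powr \<bar>-1/2\<bar> * (1 + x) powr (-1/2)"
        using True assms by (intro powr_comparable) auto
      then have 2: "(1 + x0) powr (-1/2) / 2 powr \<bar>-1/2\<bar> \<le> (1 + x) powr (-1/2)"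
        by (simp add: divide_le_eq mult.commute)
      have "?d \<le> x powr (k / 2 - 1) * (1 + x) powr (-1/2)"
        using 1 2 by (intro mult_mono) auto
      with True assms sub[of x] show ?thesis by (simp add: ennreal_leI)
    qed simp
  qed
  finally show ?thesis .
qed

text \<open>The inequality is available only at an unknown S between l and 2 l, so the window
  condition is required for all such S; powers of S are then replaced by powers of l up to the
  factor \<open>G\<close>.\<close>

lemma indicator_test:
  fixes k A B g1 g2 p K c :: real
  assumes p: "p > 0" and K: "K \<ge> 0" and c: "c \<ge> 1"
    and hyp: "\<And>F l u. F \<in> borel_measurable borel \<Longrightarrow> (\<And>x. 0 \<le> F x) \<Longrightarrow>
      norm_1d p A B F < \<infinity> \<Longrightarrow> 0 \<le> l \<Longrightarrow> l < u \<Longrightarrow> \<exists>S. l < S \<and> S < u \<and> radon_1d k S F \<le>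
      ennreal (K * (S powr (- (g1 / 2)) * (1 + S) powr (- (g2 / 2))) * enn2real (norm_1d p A B F) powr (1 / p))"
  obtains K' where "K' \<ge> 0" "\<And>l t x0. l > 0 \<Longrightarrow> t > 0 \<Longrightarrow> x0 > 0 \<Longrightarrow>
    (\<And>S x. l < S \<Longrightarrow> S < 2 * l \<Longrightarrow> x0 \<le> x \<Longrightarrow> x \<le> 2 * x0 \<Longrightarrow> t \<le> S + (1 + S) * x \<and> S + (1 + S) * x \<le> c * t) \<Longrightarrow>
    x0 powr (k / 2) * (1 + x0) powr (-1/2) * (l powr (g1 / 2) * (1 + l) powr (g2 / 2)) \<le>
      K' * (t powr (A / p) * (1 + t) powr (B / p))"
proof -
  define D where "D = c * c powr \<bar>A - 1\<bar> * c powr \<bar>B\<bar>"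
  define E where "E = 2 powr \<bar>k / 2 - 1\<bar> * 2 powr (1/2::real)"
  define G where "G = 2 powr \<bar>- (g1 / 2)\<bar> * 2 powr \<bar>- (g2 / 2)\<bar>"
  have D: "D > 0" and E: "E > 0" and G: "G > 0" using c by (auto simp: D_def E_def G_def)
  show ?thesis
  proof (rule that[of "E * K * G * D powr (1 / p)"])
    show "0 \<le> E * K * G * D powr (1 / p)" using E G K by simp
    fix l t x0 :: real
    assume l: "l > 0" and t: "t > 0" and x0: "x0 > 0"
      and sub: "\<And>S x. l < S \<Longrightarrow> S < 2 * l \<Longrightarrow> x0 \<le> x \<Longrightarrow> x \<le> 2 * x0 \<Longrightarrow> t \<le> S + (1 + S) * x \<and> S + (1 + S) * x \<le> c * t"
    let ?F = "indicator {t..c * t} :: real \<Rightarrow> real"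
    define N where "N = norm_1d p A B ?F"
    have N: "N \<le> ennreal (D * (t powr A * (1 + t) powr B))"
      unfolding N_def D_def by (rule norm_1d_indicator_le[OF t c])
    then have fin: "N < \<infinity>" by (auto intro: le_less_trans)
    have N': "enn2real N \<le> D * (t powr A * (1 + t) powr B)"
      using N D by (intro enn2real_leI) auto
    obtain S where S: "l < S" "S < 2 * l" and le: "radon_1d k S ?F \<le>
      ennreal (K * (S powr (- (g1 / 2)) * (1 + S) powr (- (g2 / 2))) * enn2real N powr (1 / p))"
      using hyp[of ?F l "2 * l"] fin l by (auto simp: N_def)
    have "ennreal (x0 powr (k / 2) * (1 + x0) powr (-1/2) / E) \<le> radon_1d k S ?F"
      unfolding E_def using S l x0 sub by (intro radon_1d_indicator_ge) auto
    also note le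
    finally have 1: "x0 powr (k / 2) * (1 + x0) powr (-1/2) / E \<le>
        K * (S powr (- (g1 / 2)) * (1 + S) powr (- (g2 / 2))) * enn2real N powr (1 / p)"
      using K by (simp add: ennreal_le_iff)
    have "S powr (- (g1 / 2)) * (1 + S) powr (- (g2 / 2)) \<le>
       (2 powr \<bar>- (g1 / 2)\<bar> * l powr (- (g1 / 2))) * (2 powr \<bar>- (g2 / 2)\<bar> * (1 + l) powr (- (g2 / 2)))"
      using S l by (intro mult_mono powr_comparable) auto
    then have 2: "S powr (- (g1 / 2)) * (1 + S) powr (- (g2 / 2)) \<le> G * (l powr (- (g1 / 2)) * (1 + l) powr (- (g2 / 2)))"
      by (simp add: G_def mult_ac)
    have 3: "enn2real N powr (1 / p) \<le> D powr (1 / p) * (t powr (A / p) * (1 + t) powr (B / p))"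
    proof -
      have "enn2real N powr (1 / p) \<le> (D * (t powr A * (1 + t) powr B)) powr (1 / p)"
        using N' p by (intro powr_mono2) auto
      also have "\<dots> = D powr (1 / p) * (t powr (A / p) * (1 + t) powr (B / p))"
        using D t by (simp add: powr_mult powr_powr)
      finally show ?thesis .
    qed
    have "x0 powr (k / 2) * (1 + x0) powr (-1/2) / E \<le>
        K * (G * (l powr (- (g1 / 2)) * (1 + l) powr (- (g2 / 2)))) *
        (D powr (1 / p) * (t powr (A / p) * (1 + t) powr (B / p)))"
      by (rule order_trans[OF 1], intro mult_mono mult_left_mono 2 3) (use K G D in auto)
    then have "x0 powr (k / 2) * (1 + x0) powr (-1/2) \<le>
        (K * (G * (l powr (- (g1 / 2)) * (1 + l) powr (- (g2 / 2)))) *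
        (D powr (1 / p) * (t powr (A / p) * (1 + t) powr (B / p)))) * E"
      using E by (simp add: pos_divide_le_eq)
    also have "\<dots> = E * K * G * D powr (1 / p) * (t powr (A / p) * (1 + t) powr (B / p)) *
        (l powr (- (g1 / 2)) * (1 + l) powr (- (g2 / 2)))"
      by (simp only: mult_ac)
    finally have "x0 powr (k / 2) * (1 + x0) powr (-1/2) * (l powr (g1 / 2) * (1 + l) powr (g2 / 2)) \<le>
      E * K * G * D powr (1 / p) * (t powr (A / p) * (1 + t) powr (B / p)) *
        (l powr (- (g1 / 2)) * (1 + l) powr (- (g2 / 2))) * (l powr (g1 / 2) * (1 + l) powr (g2 / 2))"
      by (intro mult_right_mono) auto
    also have "\<dots> = E * K * G * D powr (1 / p) * (t powr (A / p) * (1 + t) powr (B / p)) *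
        ((l powr (- (g1 / 2)) * l powr (g1 / 2)) * ((1 + l) powr (- (g2 / 2)) * (1 + l) powr (g2 / 2)))"
      by (simp only: mult_ac)
    also have "(l powr (- (g1 / 2)) * l powr (g1 / 2)) * ((1 + l) powr (- (g2 / 2)) * (1 + l) powr (g2 / 2)) = 1"
      using l by (simp add: powr_minus)
    finally show "x0 powr (k / 2) * (1 + x0) powr (-1/2) * (l powr (g1 / 2) * (1 + l) powr (g2 / 2)) \<le>
      E * K * G * D powr (1 / p) * (t powr (A / p) * (1 + t) powr (B / p))" by simp
  qed
qed

text \<open>Each of three choices of the scales l, x0 and t leaves a single power of l bounded as l
  tends to 0 or to infinity, which determines the sign of its exponent.\<close>

lemma necessary_conditions_1d:
  fixes k A B g1 g2 p K :: real
  assumes p: "p > 0" and K: "K \<ge> 0"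
    and hyp: "\<And>F l u. F \<in> borel_measurable borel \<Longrightarrow> (\<And>x. 0 \<le> F x) \<Longrightarrow>
      norm_1d p A B F < \<infinity> \<Longrightarrow> 0 \<le> l \<Longrightarrow> l < u \<Longrightarrow> \<exists>S. l < S \<and> S < u \<and> radon_1d k S F \<le>
      ennreal (K * (S powr (- (g1 / 2)) * (1 + S) powr (- (g2 / 2))) * enn2real (norm_1d p A B F) powr (1 / p))"
  shows "0 \<le> g1 \<and> 2 * A / p - k \<le> g1 \<and> g1 + g2 \<le> 2 * (A + B) / p"
proof -
  \<comment> \<open>In the first test S < 1 and x \<le> 2, so S + (1 + S) x \<le> 5; the other two
    tests need less.\<close>
  have five: "(5::real) \<ge> 1" by simp
  show ?thesis
  proof (rule indicator_test[OF p K five hyp])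
    fix K' assume K': "K' \<ge> 0" "\<And>l t x0. l > 0 \<Longrightarrow> t > 0 \<Longrightarrow> x0 > 0 \<Longrightarrow>
      (\<And>S x. l < S \<Longrightarrow> S < 2 * l \<Longrightarrow> x0 \<le> x \<Longrightarrow> x \<le> 2 * x0 \<Longrightarrow> t \<le> S + (1 + S) * x \<and> S + (1 + S) * x \<le> 5 * t) \<Longrightarrow>
      x0 powr (k / 2) * (1 + x0) powr (-1/2) * (l powr (g1 / 2) * (1 + l) powr (g2 / 2)) \<le>
        K' * (t powr (A / p) * (1 + t) powr (B / p))"
    \<comment> \<open>Subspaces approach the origin while the shell stays at T of order 1: norm and
      transform stay of order 1, so the weight must not blow up.\<close>
    have "0 \<le> g1 / 2"
    proof (rule exponent_nonneg_if_bounded_at_0)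
      fix l :: real assume l: "0 < l" "l \<le> 1/2"
      have "1 powr (k / 2) * (1 + 1) powr (-1/2) * (l powr (g1 / 2) * (1 + l) powr (g2 / 2)) \<le>
        K' * (1 powr (A / p) * (1 + 1) powr (B / p))"
      proof (rule K'(2))
        fix S x :: real assume *: "l < S" "S < 2 * l" "1 \<le> x" "x \<le> 2 * 1"
        have "S * x \<le> 1 * 2" using * l by (intro mult_mono) auto
        moreover have "0 \<le> S * x" using * l by simp
        ultimately show "1 \<le> S + (1 + S) * x \<and> S + (1 + S) * x \<le> 5 * 1"
          using * l unfolding distrib_right by (intro conjI; linarith)
      qed (use l in auto)
      then have 1: "2 powr (-1/2) * (l powr (g1 / 2) * (1 + l) powr (g2 / 2)) \<le> K' * 2 powr (B / p)"
        by simp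
      have "1 powr (g2 / 2) \<le> 2 powr \<bar>g2 / 2\<bar> * (1 + l) powr (g2 / 2)"
        using l by (intro powr_comparable) auto
      then have "l powr (g1 / 2) * 1 \<le> l powr (g1 / 2) * (2 powr \<bar>g2 / 2\<bar> * (1 + l) powr (g2 / 2))"
        by (intro mult_left_mono) auto
      also have "\<dots> = (2 powr (1/2) * 2 powr (-1/2)) * (2 powr \<bar>g2 / 2\<bar> * (l powr (g1 / 2) * (1 + l) powr (g2 / 2)))"
        unfolding powr_add[symmetric] by simp
      also have "\<dots> = 2 powr \<bar>g2 / 2\<bar> * 2 powr (1/2) * (2 powr (-1/2) * (l powr (g1 / 2) * (1 + l) powr (g2 / 2)))"
        by (simp only: mult_ac)
      also have "\<dots> \<le> 2 powr \<bar>g2 / 2\<bar> * 2 powr (1/2) * (K' * 2 powr (B / p))"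
        by (intro mult_left_mono 1) auto
      finally show "l powr (g1 / 2) \<le> 2 powr \<bar>g2 / 2\<bar> * 2 powr (1/2) * (K' * 2 powr (B / p))" by simp
    qed
    moreover
    \<comment> \<open>The shell shrinks with the subspace, x0 = l and t = 2 l: the transform is at
      least of order l^(k/2), the norm at most of order l^(A/p).\<close>
    have "0 \<le> k / 2 + g1 / 2 - A / p"
    proof (rule exponent_nonneg_if_bounded_at_0)
      fix l :: real assume l: "0 < l" "l \<le> 1/2"
      have "l powr (k / 2) * (1 + l) powr (-1/2) * (l powr (g1 / 2) * (1 + l) powr (g2 / 2)) \<le>
        K' * ((2 * l) powr (A / p) * (1 + 2 * l) powr (B / p))"
      proof (rule K'(2))
        fix S x :: real assume *: "l < S" "S < 2 * l" "l \<le> x" "x \<le> 2 * l"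
        have "S * x \<le> 1 * (2 * l)" using * l by (intro mult_mono) auto
        moreover have "0 \<le> S * x" using * l by simp
        ultimately show "2 * l \<le> S + (1 + S) * x \<and> S + (1 + S) * x \<le> 5 * (2 * l)"
          using * l unfolding distrib_right by (intro conjI; linarith)
      qed (use l in auto)
      also have "l powr (k / 2) * (1 + l) powr (-1/2) * (l powr (g1 / 2) * (1 + l) powr (g2 / 2)) =
          (l powr (k / 2) * l powr (g1 / 2)) * ((1 + l) powr (-1/2) * (1 + l) powr (g2 / 2))"
        by (simp only: mult_ac)
      also have "\<dots> = l powr (k / 2 + g1 / 2) * (1 + l) powr (-1/2 + g2 / 2)"
        unfolding powr_add[symmetric] ..
      finally have 1: "l powr (k / 2 + g1 / 2) * (1 + l) powr (-1/2 + g2 / 2) \<le>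
        K' * ((2 * l) powr (A / p) * (1 + 2 * l) powr (B / p))" .
      define D where "D = 2 powr \<bar>-1/2 + g2 / 2\<bar>"
      have "1 powr (-1/2 + g2 / 2) \<le> D * (1 + l) powr (-1/2 + g2 / 2)"
        unfolding D_def using l by (intro powr_comparable) auto
      then have "l powr (k / 2 + g1 / 2) * 1 \<le> l powr (k / 2 + g1 / 2) * (D * (1 + l) powr (-1/2 + g2 / 2))"
        by (intro mult_left_mono) auto
      also have "\<dots> = D * (l powr (k / 2 + g1 / 2) * (1 + l) powr (-1/2 + g2 / 2))"
        by (simp only: mult_ac)
      also have "\<dots> \<le> D * (K' * ((2 * l) powr (A / p) * (1 + 2 * l) powr (B / p)))"
        by (intro mult_left_mono 1) (auto simp: D_def)
      also have "\<dots> \<le> D * (K' * ((2 * l) powr (A / p) * (2 powr \<bar>B / p\<bar> * 1 powr (B / p))))"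
        using l K' by (intro mult_left_mono powr_comparable) (auto simp: D_def)
      also have "\<dots> = D * (K' * (2 powr (A / p) * 2 powr \<bar>B / p\<bar>)) * l powr (A / p)"
        using l by (simp add: powr_mult)
      finally have "l powr (k / 2 + g1 / 2) \<le> D * (K' * (2 powr (A / p) * 2 powr \<bar>B / p\<bar>)) * l powr (A / p)"
        by simp
      then show "l powr (k / 2 + g1 / 2 - A / p) \<le> D * (K' * (2 powr (A / p) * 2 powr \<bar>B / p\<bar>))"
        using l by (simp add: powr_diff[of l "k / 2 + g1 / 2"] pos_divide_le_eq)
    qed
    moreover
    \<comment> \<open>Subspaces recede to infinity with x of order 1, so T is of order l: the
      transform is at least of order 1, the norm at most of order l^((A + B)/p).\<close>
    have "g1 / 2 + g2 / 2 - (A / p + B / p) \<le> 0"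
    proof (rule exponent_nonpos_if_bounded_at_top)
      fix l :: real assume l: "1 \<le> l"
      have "1 powr (k / 2) * (1 + 1) powr (-1/2) * (l powr (g1 / 2) * (1 + l) powr (g2 / 2)) \<le>
        K' * ((2 * l) powr (A / p) * (1 + 2 * l) powr (B / p))"
      proof (rule K'(2))
        fix S x :: real assume *: "l < S" "S < 2 * l" "1 \<le> x" "x \<le> 2 * 1"
        have "l * 1 \<le> S * x" using * l by (intro mult_mono) auto
        moreover have "S * x \<le> (2 * l) * 2" using * l by (intro mult_mono) auto
        ultimately show "2 * l \<le> S + (1 + S) * x \<and> S + (1 + S) * x \<le> 5 * (2 * l)"
          using * l unfolding distrib_right by (intro conjI; linarith)
      qed (use l in auto)
      then have 1: "2 powr (-1/2) * (l powr (g1 / 2) * (1 + l) powr (g2 / 2)) \<le>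
        K' * ((2 * l) powr (A / p) * (1 + 2 * l) powr (B / p))"
        by simp
      define D where "D = 2 powr \<bar>g2 / 2\<bar> * 2 powr (1/2::real)"
      have "l powr (g2 / 2) \<le> 2 powr \<bar>g2 / 2\<bar> * (1 + l) powr (g2 / 2)"
        using l by (intro powr_comparable) auto
      then have "l powr (g1 / 2) * l powr (g2 / 2) \<le> l powr (g1 / 2) * (2 powr \<bar>g2 / 2\<bar> * (1 + l) powr (g2 / 2))"
        by (intro mult_left_mono) auto
      also have "\<dots> = (2 powr (1/2) * 2 powr (-1/2)) * (2 powr \<bar>g2 / 2\<bar> * (l powr (g1 / 2) * (1 + l) powr (g2 / 2)))"
        unfolding powr_add[symmetric] by simp
      also have "\<dots> = D * (2 powr (-1/2) * (l powr (g1 / 2) * (1 + l) powr (g2 / 2)))"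
        unfolding D_def by (simp only: mult_ac)
      also have "\<dots> \<le> D * (K' * ((2 * l) powr (A / p) * (1 + 2 * l) powr (B / p)))"
        by (intro mult_left_mono 1) (auto simp: D_def)
      also have "\<dots> \<le> D * (K' * ((2 * l) powr (A / p) * (3 powr \<bar>B / p\<bar> * l powr (B / p))))"
        using l K' by (intro mult_left_mono powr_comparable) (auto simp: D_def)
      also have "\<dots> = D * (K' * (2 powr (A / p) * 3 powr \<bar>B / p\<bar>)) * (l powr (A / p) * l powr (B / p))"
        using l by (simp add: powr_mult)
      finally have "l powr (g1 / 2 + g2 / 2) \<le> D * (K' * (2 powr (A / p) * 3 powr \<bar>B / p\<bar>)) * l powr (A / p + B / p)"
        by (simp add: powr_add)
      then show "l powr (g1 / 2 + g2 / 2 - (A / p + B / p)) \<le> D * (K' * (2 powr (A / p) * 3 powr \<bar>B / p\<bar>))"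
        using l by (simp add: powr_diff[of l "g1 / 2 + g2 / 2"] pos_divide_le_eq)
    qed
    ultimately show "0 \<le> g1 \<and> 2 * A / p - k \<le> g1 \<and> g1 + g2 \<le> 2 * (A + B) / p"
      by (simp add: add_divide_distrib)
  qed
qed

section \<open>The logarithmic test for k = 1\<close>

lemma nn_integral_inverse_Icc:
  fixes a b :: real
  assumes "0 < a" "a \<le> b"
  shows "(\<integral>\<^sup>+x\<in>{a..b}. ennreal (1 / x) \<partial>lborel) = ennreal (ln b - ln a)"
  using assms by (intro nn_integral_FTC_Icc) (auto intro!: derivative_eq_intros)

text \<open>The kernel \<open>x\<^sup>-\<^sup>1\<^sup>/\<^sup>2\<close> for \<open>k = 1\<close> just fails to be locally in \<open>L\<^sup>2\<close>: for \<open>p \<le> 2\<close> the truncations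
  of \<open>(T - 1)\<^sup>-\<^sup>1\<^sup>/\<^sup>2\<close> at \<open>1 + exp (- L)\<close> have norm of order \<open>L\<^sup>1\<^sup>/\<^sup>2\<close>, but integrals of order \<open>L\<close>.\<close>
lemma log_test_norm:
  fixes A B p L :: real
  assumes p: "0 < p" "p \<le> 2" and L: "L > 0"
  shows "norm_1d p A B (\<lambda>T. (T - 1) powr (-1/2) * indicator {1 + exp (- L)..2} T) \<le>
    ennreal (2 powr \<bar>A - 1\<bar> * 3 powr \<bar>B\<bar> * (2 * L powr (p / 2)))"
proof -
  define \<epsilon> where "\<epsilon> = exp (- L)"
  have \<epsilon>: "0 < \<epsilon>" "\<epsilon> < 1" using L by (auto simp: \<epsilon>_def)
  define D where "D = 2 powr \<bar>A - 1\<bar> * 3 powr \<bar>B\<bar>"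
  have D: "D > 0" by (simp add: D_def)
  define c1 c2 where "c1 = D * L powr ((p - 2) / 2)" and "c2 = D * L powr (p / 2)"
  have c: "c1 \<ge> 0" "c2 \<ge> 0" using D by (auto simp: c1_def c2_def)
  let ?F = "\<lambda>T. (T - 1) powr (-1/2) * indicator {1 + \<epsilon>..2} T"
  have "norm_1d p A B ?F \<le> (\<integral>\<^sup>+T. ennreal c1 * (ennreal (1 / (T - 1)) * indicator {1 + \<epsilon>..2} T) +
      ennreal c2 * indicator {1..2} T \<partial>lborel)"
    unfolding norm_1d_def
  proof (rule nn_integral_mono)
    fix T :: real
    show "ennreal (?F T powr p * T powr (A - 1) * (1 + T) powr B) * indicator {0<..} T \<le>
      ennreal c1 * (ennreal (1 / (T - 1)) * indicator {1 + \<epsilon>..2} T) + ennreal c2 * indicator {1..2} T"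
    proof (cases "T \<in> {1 + \<epsilon>..2}")
      case True
      then have T: "T > 1" "T \<le> 2" using \<epsilon> by auto
      define y where "y = T - 1"
      have y: "0 < y" "y \<le> 1" using T by (auto simp: y_def)
      have "T powr (A - 1) \<le> 2 powr \<bar>A - 1\<bar> * 1 powr (A - 1)"
        using T by (intro powr_comparable) auto
      moreover have "(1 + T) powr B \<le> 3 powr \<bar>B\<bar> * 1 powr B"
        using T by (intro powr_comparable) auto
      ultimately have "T powr (A - 1) * (1 + T) powr B \<le> D"
        unfolding D_def by (intro mult_mono) auto
      then have 1: "y powr (- p / 2) * (T powr (A - 1) * (1 + T) powr B) \<le> y powr (- p / 2) * D"
        by (intro mult_left_mono) auto
      \<comment> \<open>Splitting at y = 1 / L balances the terms: the integral of 1 / y over the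
        support is L, so both contribute a multiple of L^(p/2), for every p \<le> 2.\<close>
      have 2: "y powr (- p / 2) \<le> L powr ((p - 2) / 2) * (1 / y) + L powr (p / 2)"
      proof (cases "y \<le> 1 / L")
        case True
        have "y powr (- p / 2) = y powr ((2 - p) / 2) * (1 / y)"
        proof -
          have "y powr ((2 - p) / 2) * y powr (-1) = y powr (- p / 2)"
            unfolding powr_add[symmetric] by (simp add: field_simps)
          then show ?thesis using y by (simp add: powr_minus_divide)
        qed
        also have "\<dots> \<le> (1 / L) powr ((2 - p) / 2) * (1 / y)"
          using y True p L by (intro mult_right_mono powr_mono2) auto
        also have "(1 / L) powr ((2 - p) / 2) = L powr (- ((2 - p) / 2))"
          using L by (simp add: powr_divide powr_minus_divide)
        also have "- ((2 - p) / 2) = (p - 2) / 2" by (simp add: field_simps)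
        finally show ?thesis by (simp add: add_increasing2)
      next
        case False
        then have "y powr (- p / 2) \<le> (1 / L) powr (- p / 2)"
          using p L by (intro powr_mono2') auto
        also have "\<dots> = L powr (p / 2)"
          using L by (simp add: powr_divide powr_minus_divide)
        finally show ?thesis using y by (simp add: add_increasing)
      qed
      have "?F T powr p = y powr (- p / 2)"
        using True y by (simp add: y_def powr_powr)
      then have "?F T powr p * T powr (A - 1) * (1 + T) powr B \<le> y powr (- p / 2) * D"
        using 1 by (simp add: mult.assoc)
      also have "\<dots> \<le> (L powr ((p - 2) / 2) * (1 / y) + L powr (p / 2)) * D"
        using 2 D by (intro mult_right_mono) auto
      also have "\<dots> = c1 * (1 / y) + c2"
        by (simp add: c1_def c2_def algebra_simps)
      finally have "ennreal (?F T powr p * T powr (A - 1) * (1 + T) powr B) \<le> ennreal (c1 * (1 / y) + c2)"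
        by (rule ennreal_leI)
      also have "\<dots> = ennreal c1 * ennreal (1 / (T - 1)) + ennreal c2"
        using c y by (subst ennreal_plus) (auto simp: ennreal_mult y_def simp del: times_divide_eq_right)
      finally show ?thesis using True T by simp
    qed (use p in simp)
  qed
  also have "\<dots> = ennreal c1 * (\<integral>\<^sup>+T\<in>{1 + \<epsilon>..2}. ennreal (1 / (T - 1)) \<partial>lborel) + ennreal c2 * 1"
    by (subst nn_integral_add) (auto simp: nn_integral_cmult nn_integral_cmult_indicator)
  also have "(\<integral>\<^sup>+T\<in>{1 + \<epsilon>..2}. ennreal (1 / (T - 1)) \<partial>lborel) = ennreal (ln (2 - 1) - ln (1 + \<epsilon> - 1))"
    using \<epsilon> by (intro nn_integral_FTC_Icc) (auto intro!: derivative_eq_intros)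
  also have "ln (2 - 1) - ln (1 + \<epsilon> - 1) = L"
    by (simp add: \<epsilon>_def)
  also have "ennreal c1 * ennreal L + ennreal c2 * 1 = ennreal (c1 * L + c2)"
    using c L by (simp add: ennreal_mult ennreal_plus)
  also have "c1 * L = c2"
  proof -
    have "L powr ((p - 2) / 2) * L powr 1 = L powr (p / 2)"
      unfolding powr_add[symmetric] by (simp add: field_simps)
    then show ?thesis using L by (simp add: c1_def c2_def)
  qed
  also have "c2 + c2 = D * (2 * L powr (p / 2))"
    by (simp add: c2_def)
  finally show ?thesis by (simp add: \<epsilon>_def D_def)
qed

text \<open>For S within \<epsilon> = exp (- L) above 1 and x between \<epsilon> and 1/4, T lies in
  the support and T - 1 \<le> 4 x. The integrand is then at least 1 / (4 x), and integrating gives a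
  quarter of L - ln 4.\<close>

lemma log_test_radon:
  fixes S L :: real
  assumes L: "exp (- L) \<le> 1 / 8" and S: "1 < S" "S < 1 + exp (- L)"
  shows "ennreal ((L - ln 4) / 4) \<le> radon_1d 1 S (\<lambda>T. (T - 1) powr (-1/2) * indicator {1 + exp (- L)..2} T)"
proof -
  define \<epsilon> where "\<epsilon> = exp (- L)"
  have \<epsilon>: "0 < \<epsilon>" "\<epsilon> \<le> 1 / 8" using L by (auto simp: \<epsilon>_def)
  let ?F = "\<lambda>T. (T - 1) powr (-1/2) * indicator {1 + \<epsilon>..2} T"
  have "ln (1 / 4) - ln \<epsilon> = L - ln 4" by (simp add: \<epsilon>_def ln_div)
  moreover have "ln \<epsilon> \<le> ln (1 / 4)"
    using \<epsilon> by (subst ln_le_cancel_iff) auto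
  ultimately have "ennreal ((L - ln 4) / 4) = ennreal (1 / 4) * ennreal (ln (1 / 4) - ln \<epsilon>)"
    by (subst ennreal_mult[symmetric]) auto
  also have "\<dots> = ennreal (1 / 4) * (\<integral>\<^sup>+x\<in>{\<epsilon>..1/4}. ennreal (1 / x) \<partial>lborel)"
    using \<epsilon> by (subst nn_integral_inverse_Icc) auto
  also have "\<dots> = (\<integral>\<^sup>+x. ennreal (1 / 4) * (ennreal (1 / x) * indicator {\<epsilon>..1/4} x) \<partial>lborel)"
    by (intro nn_integral_cmult[symmetric]) measurable
  also have "\<dots> \<le> radon_1d 1 S ?F"
    unfolding radon_1d_def
  proof (rule nn_integral_mono)
    fix x :: real
    show "ennreal (1 / 4) * (ennreal (1 / x) * indicator {\<epsilon>..1/4} x) \<le>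
      ennreal (?F (S + (1 + S) * x) * x powr (1 / 2 - 1) * (1 + x) powr (-1/2)) * indicator {0<..} x"
    proof (cases "x \<in> {\<epsilon>..1/4}")
      case True
      then have x: "0 < x" "\<epsilon> \<le> x" "x \<le> 1 / 4" using \<epsilon> by auto
      define T where "T = S + (1 + S) * x"
      have Sx: "x \<le> S * x" "S * x \<le> 9 / 8 * x"
        using S x \<epsilon> by (auto simp: \<epsilon>_def[symmetric] intro!: mult_right_mono)
      have T: "1 + \<epsilon> \<le> T" "T \<le> 2" "T - 1 \<le> 4 * x" "0 < T - 1"
        using Sx S x \<epsilon> unfolding T_def \<epsilon>_def[symmetric] distrib_right by linarith+
      have "(4 * x) powr (-1/2) \<le> (T - 1) powr (-1/2)"
        using T by (intro powr_mono2') auto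
      moreover have "4 powr (-1/2) \<le> (1 + x) powr (-1/2)"
        using x by (intro powr_mono2') auto
      ultimately have "(4 * x) powr (-1/2) * x powr (-1/2) * 4 powr (-1/2) \<le>
          (T - 1) powr (-1/2) * x powr (-1/2) * (1 + x) powr (-1/2)"
        by (intro mult_mono) auto
      moreover have "(4 * x) powr (-1/2) * x powr (-1/2) * 4 powr (-1/2) = 1 / 4 * (1 / x)"
      proof -
        have "(4 * x) powr (-1/2) * x powr (-1/2) * 4 powr (-1/2) =
            (4 powr (-1/2) * 4 powr (-1/2)) * (x powr (-1/2) * x powr (-1/2))"
          using x by (simp add: powr_mult)
        also have "\<dots> = 4 powr (-1) * x powr (-1)"
          unfolding powr_add[symmetric] by simp
        also have "\<dots> = 1 / 4 * (1 / x)"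
          using x by (simp add: powr_minus_divide)
        finally show ?thesis .
      qed
      ultimately have "1 / 4 * (1 / x) \<le> (T - 1) powr (-1/2) * x powr (-1/2) * (1 + x) powr (-1/2)"
        by (simp only:)
      moreover have "?F T = (T - 1) powr (-1/2)" "1 / 2 - 1 = (-1/2 :: real)"
        using T by simp_all
      ultimately have "1 / 4 * (1 / x) \<le> ?F T * x powr (1 / 2 - 1) * (1 + x) powr (-1/2)"
        by (simp only:)
      then have "ennreal (1 / 4 * (1 / x)) \<le> ennreal (?F T * x powr (1 / 2 - 1) * (1 + x) powr (-1/2))"
        by (rule ennreal_leI)
      moreover have "ennreal (1 / 4 * (1 / x)) = ennreal (1 / 4) * ennreal (1 / x)"
        using x by (intro ennreal_mult) auto
      ultimately have "ennreal (1 / 4) * ennreal (1 / x) \<le>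
          ennreal (?F T * x powr (1 / 2 - 1) * (1 + x) powr (-1/2))"
        by (simp only:)
      moreover have "indicator {\<epsilon>..1/4} x = (1::ennreal)" "indicator {0<..} x = (1::ennreal)"
        using True x by simp_all
      ultimately show ?thesis
        by (simp only: T_def mult_1_right)
    qed simp
  qed
  finally show ?thesis by (simp add: \<epsilon>_def)
qed

text \<open>S lies between 1 and 2, so all weights are bounded by \<open>G\<close>, and a transform
  of order L would be dominated by a norm of order at most the square root of L.\<close>

lemma k1_requires_p_gt_2:
  fixes A B g1 g2 p K :: real
  assumes p: "p > 0" and K: "K \<ge> 0"
    and hyp: "\<And>F l u. F \<in> borel_measurable borel \<Longrightarrow> (\<And>x. 0 \<le> F x) \<Longrightarrow>
      norm_1d p A B F < \<infinity> \<Longrightarrow> 0 \<le> l \<Longrightarrow> l < u \<Longrightarrow> \<exists>S. l < S \<and> S < u \<and> radon_1d 1 S F \<le>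
      ennreal (K * (S powr (- (g1 / 2)) * (1 + S) powr (- (g2 / 2))) * enn2real (norm_1d p A B F) powr (1 / p))"
  shows "p > 2"
proof (rule ccontr)
  assume "\<not> p > 2"
  then have p2: "p \<le> 2" by simp
  define D where "D = 2 powr \<bar>A - 1\<bar> * 3 powr \<bar>B\<bar> * 2"
  define G where "G = 2 powr \<bar>- (g1 / 2)\<bar> * 3 powr \<bar>- (g2 / 2)\<bar>"
  have D: "D > 0" and G: "G > 0" by (auto simp: D_def G_def)
  define E where "E = 4 * (K * G * D powr (1 / p))"
  have E: "E \<ge> 0" using K G by (simp add: E_def)
  \<comment> \<open>\<open>s\<close> is the square root of the cutoff L. The estimate would give L -
    ln 4 \<le> E s, but L = E s + 2 s and 2 s \<ge> 4 > ln 4.\<close>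
  define s where "s = E + 2"
  define L where "L = s\<^sup>2"
  have L4: "L \<ge> 4"
    using E power_mono[of 2 s 2] by (simp add: L_def s_def)
  have "exp 4 \<ge> (8::real)"
    using exp_lower_Taylor_quadratic[of "4::real"] by simp
  then have "exp (- 4) \<le> (1 / 8 :: real)"
    by (simp add: exp_minus inverse_eq_divide divide_le_eq)
  then have e8: "exp (- L) \<le> 1 / 8"
    using L4 by (smt (verit) exp_le_cancel_iff)
  let ?F = "\<lambda>T. (T - 1) powr (-1/2) * indicator {1 + exp (- L)..2} T"
  define N where "N = norm_1d p A B ?F"
  have N: "N \<le> ennreal (D * L powr (p / 2))"
    unfolding N_def D_def using log_test_norm[OF p p2, of L A B] L4 by (simp add: mult.assoc)
  then have fin: "N < \<infinity>" by (auto intro: le_less_trans)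
  have "enn2real N \<le> D * L powr (p / 2)"
    using N D by (intro enn2real_leI) auto
  then have "enn2real N powr (1 / p) \<le> (D * L powr (p / 2)) powr (1 / p)"
    using p by (intro powr_mono2) auto
  also have "\<dots> = D powr (1 / p) * L powr (1 / 2)"
    using D p L4 by (simp add: powr_mult powr_powr)
  also have "L powr (1 / 2) = s"
    using L4 E by (simp add: powr_half_sqrt L_def s_def)
  finally have N': "enn2real N powr (1 / p) \<le> D powr (1 / p) * s" .
  have meas: "?F \<in> borel_measurable borel" by measurable
  obtain S where S: "1 < S" "S < 1 + exp (- L)" and le: "radon_1d 1 S ?F \<le>
      ennreal (K * (S powr (- (g1 / 2)) * (1 + S) powr (- (g2 / 2))) * enn2real N powr (1 / p))"
    using hyp[OF meas, of 1 "1 + exp (- L)"] fin by (auto simp: N_def)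
  have "ennreal ((L - ln 4) / 4) \<le> radon_1d 1 S ?F"
    by (rule log_test_radon[OF e8 S])
  also note le
  finally have 1: "(L - ln 4) / 4 \<le> K * (S powr (- (g1 / 2)) * (1 + S) powr (- (g2 / 2))) * enn2real N powr (1 / p)"
    using K by (simp add: ennreal_le_iff)
  have "S powr (- (g1 / 2)) * (1 + S) powr (- (g2 / 2)) \<le>
     (2 powr \<bar>- (g1 / 2)\<bar> * 1 powr (- (g1 / 2))) * (3 powr \<bar>- (g2 / 2)\<bar> * 1 powr (- (g2 / 2)))"
    using S e8 by (intro mult_mono powr_comparable) auto
  then have 2: "S powr (- (g1 / 2)) * (1 + S) powr (- (g2 / 2)) \<le> G"
    by (simp add: G_def)
  have "(L - ln 4) / 4 \<le> K * G * (D powr (1 / p) * s)"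
    by (rule order_trans[OF 1], intro mult_mono mult_left_mono 2 N') (use K G in auto)
  then have "L - ln 4 \<le> E * s"
    by (simp add: E_def mult_ac)
  moreover have "L = E * s + 2 * s"
    by (simp add: L_def s_def power2_eq_square algebra_simps)
  moreover have "ln 4 < (4::real)"
    using ln_less_self[of 4] by simp
  ultimately show False using E by (simp add: s_def)
qed

lemma radon_estimate_necessary:
  fixes p a1 a2 g1 g2 :: real
  assumes kn: "CARD('k::finite) < CARD('n::finite)" and p: "p > 0"
    and est: "radon_estimate TYPE('k) TYPE('n) p a1 a2 g1 g2"
  shows "0 \<le> g1 \<and> (a1 + CARD('n)) / p - CARD('k) \<le> g1 \<and> g1 + g2 \<le> (a1 + a2 + CARD('n) - 1) / p"
    (is ?conditions) and "CARD('k) = 1 \<longrightarrow> p > 2"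
proof -
  have "?conditions \<and> (CARD('k) = 1 \<longrightarrow> p > 2)"
  proof (rule radon_1d_if_estimate[OF kn p est])
    fix K :: real
    assume K: "0 \<le> K" and hyp: "\<And>F l u. F \<in> borel_measurable borel \<Longrightarrow> (\<And>x. 0 \<le> F x) \<Longrightarrow>
      norm_1d p ((a1 + CARD('n)) / 2) ((a2 - 1) / 2) F < \<infinity> \<Longrightarrow> 0 \<le> l \<Longrightarrow> l < u \<Longrightarrow>
      \<exists>S. l < S \<and> S < u \<and> radon_1d CARD('k) S F \<le>
      ennreal (K * (S powr (- (g1 / 2)) * (1 + S) powr (- (g2 / 2))) *
        enn2real (norm_1d p ((a1 + CARD('n)) / 2) ((a2 - 1) / 2) F) powr (1 / p))"
    have sum: "2 * ((a1 + real CARD('n)) / 2 + (a2 - 1) / 2) = a1 + a2 + CARD('n) - 1"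
      by (simp add: field_simps)
    have two: "2 * ((a1 + real CARD('n)) / 2) = a1 + CARD('n)"
      by simp
    have "0 \<le> g1 \<and> 2 * ((a1 + CARD('n)) / 2) / p - CARD('k) \<le> g1 \<and>
        g1 + g2 \<le> 2 * ((a1 + real CARD('n)) / 2 + (a2 - 1) / 2) / p"
      by (rule necessary_conditions_1d[OF p K hyp])
    then have conditions: ?conditions
      unfolding sum two .
    have "p > 2" if "CARD('k) = 1"
    proof -
      have r: "real CARD('k) = 1" using that by simp
      show ?thesis
        by (rule k1_requires_p_gt_2[OF p K hyp[unfolded r]])
    qed
    with conditions show "?conditions \<and> (CARD('k) = 1 \<longrightarrow> p > 2)"
      by blast
  qed
  then show ?conditions "CARD('k) = 1 \<longrightarrow> p > 2"
    by blast+
qed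

section \<open>The characterization\<close>

text \<open>The range of p is stated as a product instead of a quotient, so that k = 1 needs no
  convention. The endpoint a1 + a2 = k - n occurs only with p = 1, where the pointwise bound accepts
  equality.\<close>

lemma radon_estimate_sufficient:
  fixes p a1 a2 g1 g2 :: real
  defines "n \<equiv> real CARD('n::finite)" and "k \<equiv> real CARD('k::finite)"
  assumes kn: "CARD('k) < CARD('n)"
    and range: "(1 \<le> p \<and> p * (k - 1) < a1 + a2 + n - 1) \<or> (a1 + a2 = k - n \<and> p = 1)"
    and k: "k \<ge> 2 \<or> (k = 1 \<and> p > 2)"
    and g: "0 \<le> g1" "(a1 + n) / p - k \<le> g1" "g1 + g2 \<le> (a1 + a2 + n - 1) / p"
    and crit: "(a1 + n) / p - k = 0 \<Longrightarrow> g1 > 0"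
  shows "radon_estimate TYPE('k) TYPE('n) p a1 a2 g1 g2"
proof -
  define A B where "A = (a1 + n) / 2" and "B = (a2 - 1) / 2"
  have A2: "2 * A = a1 + n" and AB: "2 * (A + B) = a1 + a2 + n - 1"
    by (simp_all add: A_def B_def field_simps)
  show ?thesis
  proof (cases "p = 1")
    case True
    then have k2: "k \<ge> 2" using k by simp
    have c: "0 \<le> g1" "2 * A - k \<le> g1" "g1 + g2 \<le> 2 * (A + B)"
      using g unfolding A2 AB True by simp_all
    \<comment> \<open>Equality here is the endpoint a1 + a2 = k - n.\<close>
    have k1: "k - 1 \<le> 2 * (A + B)"
      using range unfolding AB True by auto
    show ?thesis
    proof (rule radon_estimate_if_1d[OF kn, of p 1])
      fix F :: "real \<Rightarrow> real" and S :: real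
      assume F: "F \<in> borel_measurable borel" "\<And>x. 0 \<le> F x" and S: "S > 0"
        and fin: "norm_1d p ((a1 + CARD('n)) / 2) ((a2 - 1) / 2) F < \<infinity>"
      let ?N = "norm_1d 1 A B F" and ?W = "S powr (- (g1 / 2)) * (1 + S) powr (- (g2 / 2))"
      have N: "?N = ennreal (enn2real ?N)"
        using fin unfolding A_def B_def n_def True by simp
      have "radon_1d k S F \<le> ennreal ?W * ?N"
        by (rule radon_1d_bound_p1[OF k2 c k1 F S])
      also have "\<dots> = ennreal (?W * enn2real ?N)"
        by (subst N, subst ennreal_mult[symmetric]) auto
      also have "\<dots> = ennreal (1 * ?W * enn2real ?N powr (1 / 1))"
        by simp
      finally show "radon_1d CARD('k) S F \<le> ennreal (1 * ?W *
          enn2real (norm_1d p ((a1 + CARD('n)) / 2) ((a2 - 1) / 2) F) powr (1 / p))"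
        unfolding A_def B_def n_def k_def True .
    qed (use True in auto)
  next
    case False
    then have p1: "p > 1" and r: "p * (k - 1) < 2 * (A + B)"
      using range unfolding AB by auto
    show ?thesis
    proof (rule radon_1d_bound_p_gt1[OF p1 k g(1) _ _ r, of g2])
      show "2 * A / p - k \<le> g1" "g1 + g2 \<le> 2 * (A + B) / p"
        using g unfolding A2 AB by auto
      show "0 < g1" if "2 * A / p - k = 0"
        using that crit unfolding A2 by simp
      fix K :: real
      assume K: "0 \<le> K" and bound: "\<And>F S. F \<in> borel_measurable borel \<Longrightarrow> (\<And>x. 0 \<le> F x) \<Longrightarrow> S > 0 \<Longrightarrow>
        norm_1d p A B F < \<infinity> \<Longrightarrow> radon_1d k S F \<le>
        ennreal (K * (S powr (- (g1 / 2)) * (1 + S) powr (- (g2 / 2))) * enn2real (norm_1d p A B F) powr (1 / p))"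
      show ?thesis
        by (rule radon_estimate_if_1d[OF kn _ K])
          (use p1 bound[unfolded A_def B_def n_def k_def] in auto)
    qed
  qed
qed

theorem theorem4p6:
  fixes p a1 a2 g1 g2 :: real
  defines "n \<equiv> real CARD('n::finite)" and "k \<equiv> real CARD('k::finite)"
  assumes n2: "CARD('n) \<ge> 2" and kn: "CARD('k) \<le> CARD('n) - 1"
    and range: "(a1 + a2 > k - n \<and> 1 \<le> p \<and> (CARD('k) = 1 \<or> p < (a1 + a2 + n - 1) / (k - 1)))
                \<or> (a1 + a2 = k - n \<and> p = 1)"
    and crit: "p = (a1 + n) / k \<Longrightarrow> g1 > 0"
  shows "(CARD('k) \<ge> 2 \<longrightarrow>
            (radon_estimate TYPE('k) TYPE('n) p a1 a2 g1 g2 \<longleftrightarrow>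
              g1 \<ge> max 0 ((a1 + n) / p - k) \<and> g1 + g2 \<le> (a1 + a2 + n - 1) / p))
       \<and> (CARD('k) = 1 \<longrightarrow>
            (radon_estimate TYPE('k) TYPE('n) p a1 a2 g1 g2 \<longleftrightarrow>
              g1 \<ge> max 0 ((a1 + n) / p - k) \<and> g1 + g2 \<le> (a1 + a2 + n - 1) / p \<and> p > 2))"
proof -
  have kn': "CARD('k) < CARD('n)" using n2 kn by linarith
  have p: "p \<ge> 1" using range by auto
  then have p0: "p > 0" by simp
  have k0: "k \<ge> 1" by (simp add: k_def Suc_leI)
  \<comment> \<open>For k = 1 the product is 0 and the inequality is a1 + a2 > k - n itself,
    matching an upper bound of +\<infinity> for p.\<close>
  have range': "(1 \<le> p \<and> p * (k - 1) < a1 + a2 + n - 1) \<or> (a1 + a2 = k - n \<and> p = 1)"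
  proof (cases "CARD('k) = 1")
    case True
    then show ?thesis using range by (auto simp: k_def)
  next
    case False
    moreover have "0 < CARD('k)" by simp
    ultimately have "CARD('k) > 1" by linarith
    then have "k > 1" by (simp add: k_def)
    then show ?thesis using range False by (auto simp: pos_less_divide_eq)
  qed
  have crit': "g1 > 0" if "(a1 + n) / p - k = 0"
    using that p k0 by (intro crit) (simp add: field_simps)
  note necessary = radon_estimate_necessary[OF kn', of p a1 a2 g1 g2, folded n_def k_def]
  note sufficient = radon_estimate_sufficient[OF kn', of p a1 a2 g1 g2, folded n_def k_def, OF range' _ _ _ _ crit']
  show ?thesis
  proof (intro conjI impI)
    assume "CARD('k) \<ge> 2"
    then have k2: "k \<ge> 2" by (simp add: k_def)
    show "radon_estimate TYPE('k) TYPE('n) p a1 a2 g1 g2 \<longleftrightarrow>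
        g1 \<ge> max 0 ((a1 + n) / p - k) \<and> g1 + g2 \<le> (a1 + a2 + n - 1) / p"
    proof
      assume "radon_estimate TYPE('k) TYPE('n) p a1 a2 g1 g2"
      from necessary(1)[OF p0 this]
      show "g1 \<ge> max 0 ((a1 + n) / p - k) \<and> g1 + g2 \<le> (a1 + a2 + n - 1) / p" by simp
    qed (use k2 in \<open>intro sufficient, simp_all\<close>)
  next
    assume k1: "CARD('k) = 1"
    then have k1': "k = 1" by (simp add: k_def)
    show "radon_estimate TYPE('k) TYPE('n) p a1 a2 g1 g2 \<longleftrightarrow>
        g1 \<ge> max 0 ((a1 + n) / p - k) \<and> g1 + g2 \<le> (a1 + a2 + n - 1) / p \<and> p > 2"
    proof
      assume est: "radon_estimate TYPE('k) TYPE('n) p a1 a2 g1 g2"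
      from necessary(1)[OF p0 est] necessary(2)[OF p0 est] k1
      show "g1 \<ge> max 0 ((a1 + n) / p - k) \<and> g1 + g2 \<le> (a1 + a2 + n - 1) / p \<and> p > 2" by simp
    qed (use k1' in \<open>intro sufficient, simp_all\<close>)
  qed
qed

end
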